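(* Consider $\min_{\mathbf{x}\in\mathbb{R}^n}\max_{\mathbf{y}\in\mathbb{R}^m}F(\mathbf{x})+H(\mathbf{x},\mathbf{y})-G(\mathbf{y})$ with $H(\mathbf{x},\mathbf{y})=\mathbf{x}^\top\mathbf{B}\mathbf{y}-\mathbf{x}^\top\mathbf{u}_{\mathbf{x}}+\mathbf{u}_{\mathbf{y}}^\top\mathbf{y}$, under the assumptions in the context, and set $$L_{\mathrm{Str}}=L_F\vee\left(\tfrac{\mu_F}{\mu_G}L_G\right),\quad L_{\mathrm{Bil}}=\sqrt{\lambda_{\max}(\mathbf{B}^\top\mathbf{B})\cdot\tfrac{\mu_F}{\mu_G}},\quad \mu_{\mathrm{Str}}=\mu_F,\quad \mathcal{R}=\tfrac{\mu_G}{\mu_F}.$$ Let $\Gamma_0$ be an upper estimate of the initial distance to the saddle point, $\sqrt{\mathbb{E}[\|\mathbf{x}_0^{[0]}-\boldsymbol{\omega}_{\mathbf{x}}^\star\|^2+\mathcal{R}\|\mathbf{y}_0^{[0]}-\boldsymbol{\omega}_{\mathbf{y}}^\star\|^2]}\le\Gamma_0$. When scheduled restarting is employed on top of the stochastic AG-EG algorithm (see context), with the $s$-th epoch of length $$\mathscr{T}_s\asymp\sqrt{\tfrac{L_{\mathrm{Str}}}{\mu_{\mathrm{Str}}}}+\tfrac{L_{\mathrm{Bil}}}{\mu_{\mathrm{Str}}}+\tfrac{\sigma^2}{\mu_{\mathrm{Str}}^2\,\Gamma_0^2\,e^{1-s}},$$ the iteration complexity is $$O\left(\left(\sqrt{\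tfrac{L_{\mathrm{Str}}}{\mu_{\mathrm{Str}}}}+\tfrac{L_{\mathrm{Bil}}}{\mu_{\mathrm{Str}}}\right)\log\left(\tfrac1\varepsilon\right)+\tfrac{\sigma^2}{\mu_{\mathrm{Str}}^2\varepsilon^2}\right)=O\left(\left(\sqrt{\tfrac{L_F}{\mu_F}\vee\tfrac{L_G}{\mu_G}}+\sqrt{\tfrac{\lambda_{\max}(\mathbf{B}^\top\mathbf{B})}{\mu_F\mu_G}}\right)\log\left(\tfrac1\varepsilon\right)+\tfrac{\sigma^2}{\mu_F^2\varepsilon^2}\right).$$
   Context: Norms are Euclidean; $a\vee b=\max(a,b)$; $\lambda_{\max}$ is the largest eigenvalue; $a\asymp b$ means equality up to positive numerical constant factors; $O(\cdot)$ hides a constant factor. The dependence of the logarithm on $\Gamma_0$ is not displayed. Assumptions. $F:\mathbb{R}^n\to\mathbb{R}$ is $L_F$-smooth and $\mu_F$-strongly convex, i.e. $\frac{\mu_F}{2}\|\mathbf{x}-\mathbf{x}'\|^2\le F(\mathbf{x})-F(\mathbf{x}')-\nabla F(\mathbf{x}')^\top(\mathbf{x}-\mathbf{x}')\le\frac{L_F}{2}\|\mathbf{x}-\mathbf{x}'\|^2$ for all $\mathbf{x},\mathbf{x}'$; likewise $G:\mathbb{R}^m\to\mathbb{R}$ is $L_G$-smooth and $\mu_G$-strongly convex; $\mu_F,\mu_G>0$. $\mathbf{B}\in\mathbb{R}^{n\times m}$ with $n\ge m$ (without loss of generality). There are distributions $\mathcal{D}_\xi,\mathcal{D}_\zeta$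 and stochastic gradients $\nabla f(\mathbf{x};\xi),\nabla g(\mathbf{y};\xi),\nabla_{\mathbf{x}}h(\mathbf{x},\mathbf{y};\zeta),\nabla_{\mathbf{y}}h(\mathbf{x},\mathbf{y};\zeta)$ that for all $\mathbf{x},\mathbf{y}$ are unbiased for $\nabla F(\mathbf{x}),\nabla G(\mathbf{y}),\nabla_{\mathbf{x}}H(\mathbf{x},\mathbf{y}),\nabla_{\mathbf{y}}H(\mathbf{x},\mathbf{y})$ and satisfy $\mathbb{E}_\xi[\|\nabla f(\mathbf{x};\xi)-\nabla F(\mathbf{x})\|^2+\frac{1}{\mathcal{R}}\|\nabla g(\mathbf{y};\xi)-\nabla G(\mathbf{y})\|^2]\le\sigma_{\mathrm{Str}}^2$ and $\mathbb{E}_\zeta[\|\nabla_{\mathbf{x}}h-\nabla_{\mathbf{x}}H\|^2+\frac{1}{\mathcal{R}}\|\nabla_{\mathbf{y}}h-\nabla_{\mathbf{y}}H\|^2]\le\sigma_{\mathrm{Bil}}^2$. Saddle point and iteration complexity: $(\boldsymbol{\omega}_{\mathbf{x}}^\star,\boldsymbol{\omega}_{\mathbf{y}}^\star)$ is the unique saddle point of $\mathscr{F}=F+H-G$, i.e. $\mathscr{F}(\boldsymbol{\omega}_{\mathbf{x}}^\star,\mathbf{y})\le\mathscr{F}(\boldsymbol{\omega}_{\mathbf{x}}^\star,\boldsymbol{\omega}_{\mathbf{y}}^\star)\le\mathscr{F}(\mathbf{x},\boldsymbol{\omega}_{\mathbf{y}}^\star)$ for all $\mathbf{x},\mathbf{y}$.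 Given a desired accuracy $\varepsilon>0$, the iteration complexity is the total number of iterations (over all epochs) needed to output $(\mathbf{x},\mathbf{y})$ with $\mathbb{E}[\|\mathbf{x}-\boldsymbol{\omega}_{\mathbf{x}}^\star\|^2+\mathcal{R}\|\mathbf{y}-\boldsymbol{\omega}_{\mathbf{y}}^\star\|^2]\le\varepsilon^2$. Noise level and stepsizes: fix $r\in(0,1)$ and $\beta\in(0,\infty)$ as numerical constants (for instance $r=\frac12$, $\beta=1$), and let $\sigma=\frac{1}{\sqrt3}\sqrt{\frac{1}{1-r}\sigma_{\mathrm{Str}}^2+(2+\frac1\beta)\sigma_{\mathrm{Bil}}^2}$. In an epoch of length $\mathscr{T}$ started from $(\mathbf{x}_0,\mathbf{y}_0)$, with $D=\sqrt{\mathbb{E}[\|\mathbf{x}_0-\boldsymbol{\omega}_{\mathbf{x}}^\star\|^2+\mathcal{R}\|\mathbf{y}_0-\boldsymbol{\omega}_{\mathbf{y}}^\star\|^2]}$, the stepsizes are $\alpha_t=\frac{2}{t+1}$ and $$\eta_t=\frac{t}{\left(\frac2r L_{\mathrm{Str}}\vee\frac{\sigma[\mathscr{T}(\mathscr{T}+1)^2]^{1/2}}{\mathscr{C}D}\right)+\sqrt{\frac{1+\beta}{r}}\,L_{\mathrm{Bil}}\,t},$$ where $\mathscr{C}\in(0,\infty)$ is an input parameter; when only an upper estimate of $D$ is known, $\mathscr{C}\ge1$ is chosen so that $\mathscr{C}D$ equals that estimate. Stochastic AG-EG algorithm with scheduled restarting: starting from $\mathbf{x}_0^{[0]},\mathbf{y}_0^{[0]}$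 (possibly random), for each epoch $s=1,\dots,\mathscr{S}$ set $\mathbf{x}^{\mathrm{ag}}_{-1/2}=\mathbf{x}^{\mathrm{md}}_0=\mathbf{x}_0=\mathbf{x}_0^{[s-1]}$, $\mathbf{y}^{\mathrm{ag}}_{-1/2}=\mathbf{y}^{\mathrm{md}}_0=\mathbf{y}_0=\mathbf{y}_0^{[s-1]}$. For $t=1,\dots,\mathscr{T}_s$ draw $\xi_{t-\frac12}\sim\mathcal{D}_\xi$ and, independently, $\zeta_{t-\frac12},\zeta_t\sim\mathcal{D}_\zeta$, and set $\mathbf{x}_{t-\frac12}=\mathbf{x}_{t-1}-\eta_t(\nabla f(\mathbf{x}^{\mathrm{md}}_{t-1};\xi_{t-\frac12})+\nabla_{\mathbf{x}}h(\mathbf{x}_{t-1},\mathbf{y}_{t-1};\zeta_{t-\frac12}))$, $\mathbf{y}_{t-\frac12}=\mathbf{y}_{t-1}-\frac{\eta_t}{\mathcal{R}}(-\nabla_{\mathbf{y}}h(\mathbf{x}_{t-1},\mathbf{y}_{t-1};\zeta_{t-\frac12})+\nabla g(\mathbf{y}^{\mathrm{md}}_{t-1};\xi_{t-\frac12}))$, $\mathbf{x}^{\mathrm{ag}}_{t-\frac12}=(1-\alpha_t)\mathbf{x}^{\mathrm{ag}}_{t-\frac32}+\alpha_t\mathbf{x}_{t-\frac12}$, $\ \mathbf{y}^{\mathrm{ag}}_{t-\frac12}=(1-\alpha_t)\mathbf{y}^{\mathrm{ag}}_{t-\frac32}+\alpha_t\mathbf{y}_{t-\frac12}$, $\mathbf{x}_t=\mathbf{x}_{t-1}-\eta_t(\nabla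 f(\mathbf{x}^{\mathrm{md}}_{t-1};\xi_{t-\frac12})+\nabla_{\mathbf{x}}h(\mathbf{x}_{t-\frac12},\mathbf{y}_{t-\frac12};\zeta_t))$, $\mathbf{y}_t=\mathbf{y}_{t-1}-\frac{\eta_t}{\mathcal{R}}(-\nabla_{\mathbf{y}}h(\mathbf{x}_{t-\frac12},\mathbf{y}_{t-\frac12};\zeta_t)+\nabla g(\mathbf{y}^{\mathrm{md}}_{t-1};\xi_{t-\frac12}))$, $\mathbf{x}^{\mathrm{md}}_t=(1-\alpha_{t+1})\mathbf{x}^{\mathrm{ag}}_{t-\frac12}+\alpha_{t+1}\mathbf{x}_t$, $\ \mathbf{y}^{\mathrm{md}}_t=(1-\alpha_{t+1})\mathbf{y}^{\mathrm{ag}}_{t-\frac12}+\alpha_{t+1}\mathbf{y}_t$. At the end of the epoch set $\mathbf{x}_0^{[s]}=\mathbf{x}^{\mathrm{ag}}_{\mathscr{T}_s-\frac12}$, $\mathbf{y}_0^{[s]}=\mathbf{y}^{\mathrm{ag}}_{\mathscr{T}_s-\frac12}$. The output is $[\mathbf{x}_0^{[\mathscr{S}]};\mathbf{y}_0^{[\mathscr{S}]}]$. *)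

theory Defs
  imports "HOL-Probability.Probability"
begin

section \<open>The saddle-point problem\<close>

definition grad :: "('a::euclidean_space \<Rightarrow> real) \<Rightarrow> 'a \<Rightarrow> 'a" where
  "grad f x = (THE D. GDERIV f x :> D)"

definition smooth_strongly_convex :: "real \<Rightarrow> real \<Rightarrow> ('a::euclidean_space \<Rightarrow> real) \<Rightarrow> bool" where
  "smooth_strongly_convex L \<mu> f \<longleftrightarrow>
     (\<forall>x. f differentiable (at x)) \<and>
     (\<forall>x x'. \<mu> / 2 * (norm (x - x'))\<^sup>2 \<le> f x - f x' - grad f x' \<bullet> (x - x') \<and>
             f x - f x' - grad f x' \<bullet> (x - x') \<le> L / 2 * (norm (x - x'))\<^sup>2)"

definition bilinear_coupling ::
  "real^'m^'n \<Rightarrow> real^'n \<Rightarrow> real^'m \<Rightarrow> real^'n \<Rightarrow> real^'m \<Rightarrow> real" where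
  "bilinear_coupling B ux uy x y = x \<bullet> (B *v y) - x \<bullet> ux + uy \<bullet> y"

definition saddle_point :: "('a \<Rightarrow> 'b \<Rightarrow> real) \<Rightarrow> 'a \<Rightarrow> 'b \<Rightarrow> bool" where
  "saddle_point \<F> wx wy \<longleftrightarrow> (\<forall>x y. \<F> wx y \<le> \<F> wx wy \<and> \<F> wx wy \<le> \<F> x wy)"

definition lambda_max :: "real^'k^'k \<Rightarrow> real" where
  "lambda_max A = (GREATEST l. \<exists>v. v \<noteq> 0 \<and> A *v v = l *\<^sub>R v)"

section \<open>Stochastic gradients\<close>

text \<open>Expectations of nonnegative quantities are taken as \<open>\<integral>\<^sup>+\<close>, with values in \<open>[0, \<infinity>]\<close>, so that an
  upper bound on such an expectation entails that it is finite. Joint measurability in the point and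
  the sample is what makes the algorithm's iterates random variables.\<close>

definition stochastic_gradients_Str ::
  "(real^'n \<Rightarrow> real) \<Rightarrow> (real^'m \<Rightarrow> real) \<Rightarrow> real \<Rightarrow> 'a measure \<Rightarrow>
   (real^'n \<Rightarrow> 'a \<Rightarrow> real^'n) \<Rightarrow> (real^'m \<Rightarrow> 'a \<Rightarrow> real^'m) \<Rightarrow> real \<Rightarrow> bool" where
  "stochastic_gradients_Str F G R D\<^sub>\<xi> gf gg \<sigma>\<^sub>S\<^sub>t\<^sub>r \<longleftrightarrow>
     prob_space D\<^sub>\<xi> \<and>
     (\<lambda>(x, \<xi>). gf x \<xi>) \<in> borel_measurable (borel \<Otimes>\<^sub>M D\<^sub>\<xi>) \<and>
     (\<lambda>(y, \<xi>). gg y \<xi>) \<in> borel_measurable (borel \<Otimes>\<^sub>M D\<^sub>\<xi>) \<and>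
     (\<forall>x. has_bochner_integral D\<^sub>\<xi> (\<lambda>\<xi>. gf x \<xi>) (grad F x)) \<and>
     (\<forall>y. has_bochner_integral D\<^sub>\<xi> (\<lambda>\<xi>. gg y \<xi>) (grad G y)) \<and>
     (\<forall>x y. (\<integral>\<^sup>+\<xi>. ennreal ((norm (gf x \<xi> - grad F x))\<^sup>2
                            + 1 / R * (norm (gg y \<xi> - grad G y))\<^sup>2) \<partial>D\<^sub>\<xi>)
            \<le> ennreal (\<sigma>\<^sub>S\<^sub>t\<^sub>r\<^sup>2))"

definition stochastic_gradients_Bil ::
  "(real^'n \<Rightarrow> real^'m \<Rightarrow> real) \<Rightarrow> real \<Rightarrow> 'b measure \<Rightarrow>
   (real^'n \<Rightarrow> real^'m \<Rightarrow> 'b \<Rightarrow> real^'n) \<Rightarrow> (real^'n \<Rightarrow> real^'m \<Rightarrow> 'b \<Rightarrow> real^'m) \<Rightarrow> real \<Rightarrow> bool" where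
  "stochastic_gradients_Bil H R D\<^sub>\<zeta> hx hy \<sigma>\<^sub>B\<^sub>i\<^sub>l \<longleftrightarrow>
     prob_space D\<^sub>\<zeta> \<and>
     (\<lambda>((x, y), \<zeta>). hx x y \<zeta>) \<in> borel_measurable (borel \<Otimes>\<^sub>M D\<^sub>\<zeta>) \<and>
     (\<lambda>((x, y), \<zeta>). hy x y \<zeta>) \<in> borel_measurable (borel \<Otimes>\<^sub>M D\<^sub>\<zeta>) \<and>
     (\<forall>x y. has_bochner_integral D\<^sub>\<zeta> (\<lambda>\<zeta>. hx x y \<zeta>) (grad (\<lambda>x. H x y) x)) \<and>
     (\<forall>x y. has_bochner_integral D\<^sub>\<zeta> (\<lambda>\<zeta>. hy x y \<zeta>) (grad (\<lambda>y. H x y) y)) \<and>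
     (\<forall>x y. (\<integral>\<^sup>+\<zeta>. ennreal ((norm (hx x y \<zeta> - grad (\<lambda>x. H x y) x))\<^sup>2
                            + 1 / R * (norm (hy x y \<zeta> - grad (\<lambda>y. H x y) y))\<^sup>2) \<partial>D\<^sub>\<zeta>)
            \<le> ennreal (\<sigma>\<^sub>B\<^sub>i\<^sub>l\<^sup>2))"

section \<open>Sampling\<close>

text \<open>The random inputs of the algorithm: the starting point, and for step \<open>t\<close> of epoch \<open>s\<close> the samples
  with indices \<open>t - 1/2\<close> (\<open>Xi s t\<close> and \<open>Zeta_half s t\<close>) and \<open>t\<close> (\<open>Zeta s t\<close>).\<close>

datatype draw = Init | Xi nat nat | Zeta_half nat nat | Zeta nat nat

definition draws :: "(nat \<Rightarrow> nat) \<Rightarrow> draw set" where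
  "draws T = insert Init
     (\<Union>s\<in>{1..}. \<Union>t\<in>{1..T s}. {Xi s t, Zeta_half s t, Zeta s t})"

definition generated :: "'w measure \<Rightarrow> ('w \<Rightarrow> 'c) \<Rightarrow> 'c measure \<Rightarrow> 'w set set" where
  "generated M X N = {X -` A \<inter> space M | A. A \<in> sets N}"

text \<open>The inputs take values in different types, so their mutual independence is stated through the
  \<open>\<sigma>\<close>-algebras they generate.\<close>

definition independent_sampling ::
  "'w measure \<Rightarrow> 'a measure \<Rightarrow> 'b measure \<Rightarrow> (nat \<Rightarrow> nat) \<Rightarrow>
   ('w \<Rightarrow> real^'n) \<Rightarrow> ('w \<Rightarrow> real^'m) \<Rightarrow>
   (nat \<Rightarrow> nat \<Rightarrow> 'w \<Rightarrow> 'a) \<Rightarrow> (nat \<Rightarrow> nat \<Rightarrow> 'w \<Rightarrow> 'b) \<Rightarrow> (nat \<Rightarrow> nat \<Rightarrow> 'w \<Rightarrow> 'b) \<Rightarrow> bool" where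
  "independent_sampling M D\<^sub>\<xi> D\<^sub>\<zeta> T x0 y0 \<xi> \<zeta>h \<zeta> \<longleftrightarrow>
     prob_space M \<and>
     x0 \<in> borel_measurable M \<and> y0 \<in> borel_measurable M \<and>
     (\<forall>s\<ge>1. \<forall>t\<in>{1..T s}.
        \<xi> s t \<in> measurable M D\<^sub>\<xi> \<and> distr M D\<^sub>\<xi> (\<xi> s t) = D\<^sub>\<xi> \<and>
        \<zeta>h s t \<in> measurable M D\<^sub>\<zeta> \<and> distr M D\<^sub>\<zeta> (\<zeta>h s t) = D\<^sub>\<zeta> \<and>
        \<zeta> s t \<in> measurable M D\<^sub>\<zeta> \<and> distr M D\<^sub>\<zeta> (\<zeta> s t) = D\<^sub>\<zeta>) \<and>
     prob_space.indep_sets M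
       (\<lambda>d. case d of
              Init \<Rightarrow> generated M (\<lambda>\<omega>. (x0 \<omega>, y0 \<omega>)) borel
            | Xi s t \<Rightarrow> generated M (\<xi> s t) D\<^sub>\<xi>
            | Zeta_half s t \<Rightarrow> generated M (\<zeta>h s t) D\<^sub>\<zeta>
            | Zeta s t \<Rightarrow> generated M (\<zeta> s t) D\<^sub>\<zeta>)
       (draws T)"

section \<open>Stochastic AG-EG with scheduled restarting\<close>

definition alpha :: "nat \<Rightarrow> real" where
  "alpha t = 2 / (real t + 1)"

definition noise_level :: "real \<Rightarrow> real \<Rightarrow> real \<Rightarrow> real \<Rightarrow> real" where
  "noise_level r \<beta> \<sigma>\<^sub>S\<^sub>t\<^sub>r \<sigma>\<^sub>B\<^sub>i\<^sub>l =
     1 / sqrt 3 * sqrt (1 / (1 - r) * \<sigma>\<^sub>S\<^sub>t\<^sub>r\<^sup>2 + (2 + 1 / \<beta>) * \<sigma>\<^sub>B\<^sub>i\<^sub>l\<^sup>2)"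

text \<open>The argument \<open>\<Gamma>\<close> is the product of the input parameter \<open>\<C> \<ge> 1\<close> and the distance
  \<open>D\<close>, i.e. the upper estimate of \<open>D\<close> in use; \<open>N\<close> is the length of the epoch.\<close>

definition stepsize ::
  "real \<Rightarrow> real \<Rightarrow> real \<Rightarrow> real \<Rightarrow> real \<Rightarrow> real \<Rightarrow> nat \<Rightarrow> nat \<Rightarrow> real" where
  "stepsize r \<beta> L\<^sub>S\<^sub>t\<^sub>r L\<^sub>B\<^sub>i\<^sub>l \<sigma> \<Gamma> N t =
     real t / (max (2 / r * L\<^sub>S\<^sub>t\<^sub>r) (\<sigma> * sqrt (real N * (real N + 1)\<^sup>2) / \<Gamma>)
               + sqrt ((1 + \<beta>) / r) * L\<^sub>B\<^sub>i\<^sub>l * real t)"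

text \<open>After \<open>t\<close> steps the state is
  \<open>(x\<^sub>t, y\<^sub>t, x\<^sup>a\<^sup>g, y\<^sup>a\<^sup>g, x\<^sup>m\<^sup>d, y\<^sup>m\<^sup>d)\<close> with the \<open>ag\<close> components at index \<open>t - 1/2\<close> and the
  \<open>md\<close> components at index \<open>t\<close>.\<close>

primrec ag_eg ::
  "(real^'n \<Rightarrow> 'a \<Rightarrow> real^'n) \<Rightarrow> (real^'m \<Rightarrow> 'a \<Rightarrow> real^'m) \<Rightarrow>
   (real^'n \<Rightarrow> real^'m \<Rightarrow> 'b \<Rightarrow> real^'n) \<Rightarrow> (real^'n \<Rightarrow> real^'m \<Rightarrow> 'b \<Rightarrow> real^'m) \<Rightarrow>
   real \<Rightarrow> (nat \<Rightarrow> real) \<Rightarrow> real^'n \<Rightarrow> real^'m \<Rightarrow>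
   (nat \<Rightarrow> 'a) \<Rightarrow> (nat \<Rightarrow> 'b) \<Rightarrow> (nat \<Rightarrow> 'b) \<Rightarrow> nat \<Rightarrow>
   (real^'n) \<times> (real^'m) \<times> (real^'n) \<times> (real^'m) \<times> (real^'n) \<times> (real^'m)" where
  "ag_eg gf gg hx hy R \<eta> x0 y0 \<xi> \<zeta>h \<zeta> 0 = (x0, y0, x0, y0, x0, y0)"
| "ag_eg gf gg hx hy R \<eta> x0 y0 \<xi> \<zeta>h \<zeta> (Suc t) =
     (case ag_eg gf gg hx hy R \<eta> x0 y0 \<xi> \<zeta>h \<zeta> t of (x, y, xag, yag, xmd, ymd) \<Rightarrow>
        let k = Suc t;
            xh = x - \<eta> k *\<^sub>R (gf xmd (\<xi> k) + hx x y (\<zeta>h k));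
            yh = y - (\<eta> k / R) *\<^sub>R (- hy x y (\<zeta>h k) + gg ymd (\<xi> k));
            xag' = (1 - alpha k) *\<^sub>R xag + alpha k *\<^sub>R xh;
            yag' = (1 - alpha k) *\<^sub>R yag + alpha k *\<^sub>R yh;
            x' = x - \<eta> k *\<^sub>R (gf xmd (\<xi> k) + hx xh yh (\<zeta> k));
            y' = y - (\<eta> k / R) *\<^sub>R (- hy xh yh (\<zeta> k) + gg ymd (\<xi> k));
            xmd' = (1 - alpha (k + 1)) *\<^sub>R xag' + alpha (k + 1) *\<^sub>R x';
            ymd' = (1 - alpha (k + 1)) *\<^sub>R yag' + alpha (k + 1) *\<^sub>R y'
        in (x', y', xag', yag', xmd', ymd'))"

primrec restarted_ag_eg ::
  "(real^'n \<Rightarrow> 'a \<Rightarrow> real^'n) \<Rightarrow> (real^'m \<Rightarrow> 'a \<Rightarrow> real^'m) \<Rightarrow>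
   (real^'n \<Rightarrow> real^'m \<Rightarrow> 'b \<Rightarrow> real^'n) \<Rightarrow> (real^'n \<Rightarrow> real^'m \<Rightarrow> 'b \<Rightarrow> real^'m) \<Rightarrow>
   real \<Rightarrow> (nat \<Rightarrow> nat \<Rightarrow> real) \<Rightarrow> (nat \<Rightarrow> nat) \<Rightarrow> real^'n \<Rightarrow> real^'m \<Rightarrow>
   (nat \<Rightarrow> nat \<Rightarrow> 'a) \<Rightarrow> (nat \<Rightarrow> nat \<Rightarrow> 'b) \<Rightarrow> (nat \<Rightarrow> nat \<Rightarrow> 'b) \<Rightarrow> nat \<Rightarrow>
   (real^'n) \<times> (real^'m)" where
  "restarted_ag_eg gf gg hx hy R \<eta> T x0 y0 \<xi> \<zeta>h \<zeta> 0 = (x0, y0)"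
| "restarted_ag_eg gf gg hx hy R \<eta> T x0 y0 \<xi> \<zeta>h \<zeta> (Suc s) =
     (case restarted_ag_eg gf gg hx hy R \<eta> T x0 y0 \<xi> \<zeta>h \<zeta> s of (x, y) \<Rightarrow>
      case ag_eg gf gg hx hy R (\<eta> (Suc s)) x y (\<xi> (Suc s)) (\<zeta>h (Suc s)) (\<zeta> (Suc s)) (T (Suc s)) of
        (_, _, xag, yag, _, _) \<Rightarrow> (xag, yag))"

section \<open>Epoch lengths and iteration complexity\<close>

text \<open>The upper estimate of the distance to the saddle point at the start of epoch \<open>s\<close>; its square
  is the quantity \<open>\<Gamma>\<^sub>0\<^sup>2 e\<^bsup>1-s\<^esup>\<close> entering the length of the epoch.\<close>

definition epoch_estimate :: "real \<Rightarrow> nat \<Rightarrow> real" where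
  "epoch_estimate \<Gamma>\<^sub>0 s = \<Gamma>\<^sub>0 * exp ((1 - real s) / 2)"

definition epoch_scale :: "real \<Rightarrow> real \<Rightarrow> real \<Rightarrow> real \<Rightarrow> real \<Rightarrow> nat \<Rightarrow> real" where
  "epoch_scale L\<^sub>S\<^sub>t\<^sub>r L\<^sub>B\<^sub>i\<^sub>l \<mu>\<^sub>S\<^sub>t\<^sub>r \<sigma> \<Gamma>\<^sub>0 s =
     sqrt (L\<^sub>S\<^sub>t\<^sub>r / \<mu>\<^sub>S\<^sub>t\<^sub>r) + L\<^sub>B\<^sub>i\<^sub>l / \<mu>\<^sub>S\<^sub>t\<^sub>r + \<sigma>\<^sup>2 / (\<mu>\<^sub>S\<^sub>t\<^sub>r\<^sup>2 * \<Gamma>\<^sub>0\<^sup>2 * exp (1 - real s))"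

text \<open>A lower numerical constant for the epoch lengths that is large enough for every epoch to reduce
  the expected squared distance by a factor \<open>e\<close>. It is written out, and not existentially quantified
  in the theorem, because a constant obtained from an existential could depend on the types, hence
  on the dimensions \<open>n\<close> and \<open>m\<close>; the numerical constants depend on \<open>r\<close> and \<open>\<beta>\<close> only.\<close>

definition epoch_const :: "real \<Rightarrow> real \<Rightarrow> real" where
  "epoch_const r \<beta> = 1000 * (1 + \<beta>) / r"

definition sq_dist :: "real \<Rightarrow> real^'n \<Rightarrow> real^'m \<Rightarrow> (real^'n) \<times> (real^'m) \<Rightarrow> real" where
  "sq_dist R wx wy z = (norm (fst z - wx))\<^sup>2 + R * (norm (snd z - wy))\<^sup>2"

text \<open>\<open>err S\<close> is the expected squared distance of the output after \<open>S\<close> epochs. The infimum over the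
  empty set is \<open>\<infinity>\<close>, so a finite bound includes the claim that the accuracy is reached.\<close>

definition iteration_complexity :: "(nat \<Rightarrow> nat) \<Rightarrow> (nat \<Rightarrow> ennreal) \<Rightarrow> real \<Rightarrow> enat" where
  "iteration_complexity T err \<epsilon> = (INF S\<in>{S. err S \<le> ennreal (\<epsilon>\<^sup>2)}. enat (\<Sum>s=1..S. T s))"

end

theory Submission
  imports Defs
begin

text \<open>After rescaling \<open>y\<close> by \<open>\<surd>\<R>\<close> the problem becomes a monotone inclusion \<open>g z + A z = 0\<close> with \<open>g\<close> the
  gradient of a smooth strongly convex \<open>f\<close> and \<open>A\<close> affine with skew linear part. Let \<open>gap\<close> be the Bregman
  divergence of \<open>f\<close> from the solution \<open>w\<close> and write \<open>\<eta>\<^sub>t = t / (M + \<kappa> t)\<close>. The potential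
  \<open>t (t + 1) gap z\<^sup>a\<^sup>g + (M + \<kappa> t) \<parallel>z\<^sub>t - w\<parallel>\<^sup>2\<close> satisfies a one-step inequality in conditional
  expectation in which the weight of \<open>\<parallel>z\<^sub>t\<^sub>-\<^sub>1 - w\<parallel>\<^sup>2\<close> is still \<open>M + \<kappa> t\<close>; the excess \<open>\<kappa>\<close> per step is paid
  for by the growth of the bound itself, which gives
  \<open>\<le> (M + \<kappa> t) (\<Gamma>\<^sup>2 + 3 \<sigma>\<^sup>2 \<Sum>k\<^sup>2 / M\<^sup>2)\<close> by induction. The choice of \<open>M\<close> makes the noise term
  at most \<open>\<Gamma>\<^sup>2\<close>, strong convexity turns this into a bound on \<open>\<parallel>z\<^sup>a\<^sup>g - w\<parallel>\<^sup>2\<close>, and the epoch length makes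
  the contraction factor at most \<open>1 / e\<close>. Summing a geometric series of epoch lengths gives the complexity.\<close>

section \<open>Eigenvalues and gradients\<close>

text \<open>The constants come from one budget. An extragradient step yields minus the squared half
  step, weighted by p = k / e with e the step size. A share r of it pays for the Lipschitz error of
  the coupling and for smoothness, which is what \<open>stepsize\<close> is built to ensure; the
  share 1 - r pays for the gradient noise, hence 1 / (1 - r) in \<open>noise_level\<close>. Two
  obstacles shape the argument. One gradient sample drives both the half step and the full step, so
  its noise is correlated with the half point and does not average out. And the iterates are not
  known in advance to have finite second moments, so every inequality is arranged between
  nonnegative quantities before it is integrated. Conditioning on the past is replaced by product
  measures: the three samples of a step are integrated out one at a time, the latest first.\<close>

lemma vector_eq_0_if_quadratic_bound:
  fixes v :: "'a::real_inner"
  assumes "\<And>d. 0 \<le> v \<bullet> d + c * (norm d)\<^sup>2"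
  shows "v = 0"
proof (rule ccontr)
  assume "v \<noteq> 0"
  \<comment> \<open>Along d = - t v the linear term wins as soon as t c < 1; this choice is positive
    and achieves it for either sign of c.\<close>
  define t where "t = 1 / (\<bar>c\<bar> + 1)"
  have t: "t > 0" "t * c < 1"
    by (auto simp: t_def field_simps)
  have "0 \<le> v \<bullet> (- t *\<^sub>R v) + c * (norm (- t *\<^sub>R v))\<^sup>2"
    by (rule assms)
  also have "\<dots> = (t * (norm v)\<^sup>2) * (t * c - 1)"
    using t by (simp add: power_mult_distrib power2_norm_eq_inner power2_eq_square[of t] algebra_simps)
  also have "\<dots> < 0"
    using t \<open>v \<noteq> 0\<close> by (intro mult_pos_neg) auto
  finally show False by simp
qed

text \<open>\<open>lambda_max\<close> is a \<open>GREATEST\<close>, so a greatest eigenvalue has to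
  be exhibited. The maximum l of |B v|^2 on the unit sphere serves: a maximizer is an eigenvector,
  and every eigenvalue is a value of the Rayleigh quotient, hence at most l.\<close>

lemma norm_matrix_vector_le_lambda_max:
  fixes B :: "real^'m^'n"
  shows "(norm (B *v y))\<^sup>2 \<le> lambda_max (transpose B ** B) * (norm y)\<^sup>2"
proof -
  have cont: "continuous_on (sphere 0 1) (\<lambda>v. (norm (B *v v))\<^sup>2)"
    by (intro continuous_intros matrix_vector_mult_linear_continuous_on)
  have ne: "sphere (0::real^'m) 1 \<noteq> {}" by simp
  obtain v where v: "norm v = 1" and max: "\<And>z. norm z = 1 \<Longrightarrow> (norm (B *v z))\<^sup>2 \<le> (norm (B *v v))\<^sup>2"
    using continuous_attains_sup[OF compact_sphere ne cont] by auto
  define l where "l = (norm (B *v v))\<^sup>2"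
  have le: "(norm (B *v z))\<^sup>2 \<le> l * (norm z)\<^sup>2" for z
  proof (cases "z = 0")
    case False
    have "(norm (B *v (z /\<^sub>R norm z)))\<^sup>2 \<le> l"
      unfolding l_def using False by (intro max) auto
    then show ?thesis
      using False by (simp add: matrix_vector_mult_scaleR power_mult_distrib field_simps)
  qed auto
  have BtB: "((transpose B ** B) *v z) \<bullet> d = (B *v z) \<bullet> (B *v d)" for z d
    by (metis dot_lmul_matrix matrix_vector_mul_assoc transpose_matrix_vector)
  \<comment> \<open>First-order optimality without calculus: in |B (v + d)|^2 <= l |v + d|^2 the
    terms at v cancel, which bounds a linear term in d by a quadratic one.\<close>
  have "l *\<^sub>R v - (transpose B ** B) *v v = 0"
  proof (rule vector_eq_0_if_quadratic_bound)
    fix d :: "real^'m"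
    define b c q where "b = (B *v v) \<bullet> (B *v d)" and "c = v \<bullet> d" and "q = (norm d)\<^sup>2"
    have "l + 2 * b \<le> l + 2 * b + (norm (B *v d))\<^sup>2" by simp
    also have "\<dots> = (norm (B *v (v + d)))\<^sup>2"
      unfolding b_def l_def matrix_vector_right_distrib power2_norm_eq_inner
      by (simp add: inner_add_left inner_add_right inner_commute)
    also have "\<dots> \<le> l * (norm (v + d))\<^sup>2" by (rule le)
    also have "(norm (v + d))\<^sup>2 = (norm v)\<^sup>2 + 2 * c + q"
      unfolding c_def q_def power2_norm_eq_inner by (simp add: inner_add_left inner_add_right inner_commute)
    also have "l * \<dots> = l + 2 * (l * c) + l * q" using v by (simp add: distrib_left)
    finally have "b \<le> l * c + l / 2 * q" by simp
    moreover have "(l *\<^sub>R v - (transpose B ** B) *v v) \<bullet> d = l * c - b"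
      unfolding inner_diff_left BtB b_def c_def by simp
    ultimately show "0 \<le> (l *\<^sub>R v - (transpose B ** B) *v v) \<bullet> d + l / 2 * (norm d)\<^sup>2"
      unfolding q_def by linarith
  qed
  then have "(transpose B ** B) *v v = l *\<^sub>R v" by (metis eq_iff_diff_eq_0)
  moreover have "v \<noteq> 0" using v by (metis norm_zero zero_neq_one)
  ultimately have "\<exists>v. v \<noteq> 0 \<and> (transpose B ** B) *v v = l *\<^sub>R v" by blast
  moreover have "l' \<le> l" if "\<exists>v. v \<noteq> 0 \<and> (transpose B ** B) *v v = l' *\<^sub>R v" for l'
  proof -
    from that obtain z where z: "z \<noteq> 0" "(transpose B ** B) *v z = l' *\<^sub>R z" by (elim exE conjE)
    have "l' * (norm z)\<^sup>2 = ((transpose B ** B) *v z) \<bullet> z"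
      unfolding z(2) power2_norm_eq_inner by simp
    also have "\<dots> = (norm (B *v z))\<^sup>2"
      by (simp only: BtB power2_norm_eq_inner)
    also have "\<dots> \<le> l * (norm z)\<^sup>2" by (rule le)
    finally show ?thesis by (rule mult_right_le_imp_le) (use z(1) in simp)
  qed
  ultimately have "lambda_max (transpose B ** B) = l"
    unfolding lambda_max_def by (rule Greatest_equality)
  then show ?thesis using le by simp
qed

lemma lambda_max_nonneg: "0 \<le> lambda_max (transpose B ** B)"
  for B :: "real^'m^'n"
proof -
  obtain v :: "real^'m" where v: "norm v = 1" using vector_choose_size[of 1] by auto
  have "0 \<le> (norm (B *v v))\<^sup>2" by simp
  also have "\<dots> \<le> lambda_max (transpose B ** B)"
    using norm_matrix_vector_le_lambda_max[of B v] v by simp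
  finally show ?thesis .
qed

text \<open>For y = B^T x, |y|^2 = x . B y <= |x| |B y|; squaring and applying
  \<open>norm_matrix_vector_le_lambda_max\<close> leaves a factor |y|^2 to cancel. The spectrum of B
  B^T never enters.\<close>

lemma norm_transpose_vector_le_lambda_max:
  fixes B :: "real^'m^'n"
  shows "(norm (transpose B *v x))\<^sup>2 \<le> lambda_max (transpose B ** B) * (norm x)\<^sup>2"
proof -
  define y where "y = transpose B *v x"
  have "(norm y)\<^sup>2 = x \<bullet> (B *v y)"
    by (metis dot_lmul_matrix transpose_matrix_vector y_def power2_norm_eq_inner)
  also have "\<dots> \<le> norm x * norm (B *v y)" by (rule norm_cauchy_schwarz)
  finally have "((norm y)\<^sup>2)\<^sup>2 \<le> (norm x * norm (B *v y))\<^sup>2" by (intro power_mono) auto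
  also have "\<dots> = (norm x)\<^sup>2 * (norm (B *v y))\<^sup>2" by (simp add: power_mult_distrib)
  also have "\<dots> \<le> (norm x)\<^sup>2 * (lambda_max (transpose B ** B) * (norm y)\<^sup>2)"
    by (intro mult_left_mono norm_matrix_vector_le_lambda_max) auto
  finally have "(norm y)\<^sup>2 * (norm y)\<^sup>2 \<le> (lambda_max (transpose B ** B) * (norm x)\<^sup>2) * (norm y)\<^sup>2"
    by (simp only: power2_eq_square ac_simps)
  then show ?thesis
    using lambda_max_nonneg[of B] mult_right_le_imp_le[of "(norm y)\<^sup>2" "(norm y)\<^sup>2"]
    unfolding y_def[symmetric]
    by (cases "y = 0") auto
qed

lemma grad_eqI:
  assumes "GDERIV f x :> D"
  shows "grad f x = D"
  unfolding grad_def
proof (rule the_equality)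
  show "GDERIV f x :> D" by (rule assms)
next
  fix D' assume "GDERIV f x :> D'"
  then have "(\<lambda>h. h \<bullet> D') = (\<lambda>h. h \<bullet> D)"
    using assms unfolding gderiv_def by (rule has_derivative_unique)
  then have "(D' - D) \<bullet> (D' - D) = 0"
    by (metis inner_diff_right diff_self)
  then show "D' = D" by simp
qed

lemma grad_affine:
  "grad (\<lambda>x. x \<bullet> a + c) x = a"
  by (rule grad_eqI) (auto simp: gderiv_def intro!: derivative_eq_intros)

section \<open>The potential of a single step\<close>

text \<open>\<open>p\<close> directs the half step and \<open>q\<close> the full step, both from
  \<open>u\<close>. The cross term pairs q with the half point, where monotonicity is available, and
  the half step leaves the negative square that pays for the errors.\<close>

lemma extragradient_identity:
  fixes u p q w :: "'x::real_inner" and e :: real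
  shows "(norm (u - e *\<^sub>R q - w))\<^sup>2 = (norm (u - w))\<^sup>2 - 2 * e * (q \<bullet> (u - e *\<^sub>R p - w))
     + e\<^sup>2 * (norm (p - q))\<^sup>2 - (norm (e *\<^sub>R p))\<^sup>2"
  by (simp add: norm_scaleR power_mult_distrib power2_norm_eq_inner inner_simps inner_commute
      power2_eq_square[of e] algebra_simps)

lemma sq_norm_add_le:
  fixes x y :: "'x::real_inner"
  assumes "0 < b"
  shows "(norm (x + y))\<^sup>2 \<le> (1 + b) * (norm x)\<^sup>2 + (1 + 1 / b) * (norm y)\<^sup>2"
proof -
  have "0 \<le> (norm (sqrt b *\<^sub>R x - (1 / sqrt b) *\<^sub>R y))\<^sup>2" by simp
  also have "\<dots> = b * (norm x)\<^sup>2 - 2 * (x \<bullet> y) + (1 / b) * (norm y)\<^sup>2"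
    using assms by (simp add: power2_norm_eq_inner inner_simps inner_commute field_simps)
  finally show ?thesis
    by (simp add: power2_norm_eq_inner inner_simps inner_commute algebra_simps)
qed

text \<open>\<open>A\<close> stacks the two partial gradients of the coupling with the dual sign
  reversed; this sign makes the linear part skew and turns the saddle conditions into
  \<open>stationary\<close>. \<open>g\<close> acts as the gradient of f through the two Bregman
  bounds.\<close>

locale bilinear_saddle =
  fixes f :: "'v::euclidean_space \<Rightarrow> real" and g A :: "'v \<Rightarrow> 'v" and w :: 'v
    and \<mu> L K :: real
  assumes mu_pos: "0 < \<mu>" and L_pos: "0 < L" and K_nonneg: "0 \<le> K"
    and convex: "\<mu> / 2 * (norm (x - y))\<^sup>2 \<le> f x - f y - g y \<bullet> (x - y)"
    and smooth: "f x - f y - g y \<bullet> (x - y) \<le> L / 2 * (norm (x - y))\<^sup>2"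
    and skew: "(A x - A y) \<bullet> (x - y) = 0"
    and lipschitz: "norm (A x - A y) \<le> K * norm (x - y)"
    and stationary: "g w + A w = 0"
    and f_measurable [measurable]: "f \<in> borel_measurable borel"
begin

text \<open>\<open>A w\<close> stands for - g w by \<open>stationary\<close>; in this form
  \<open>skew\<close> can exchange A w . (h - w) for A h . (h - w).\<close>

definition gap :: "'v \<Rightarrow> real" where
  "gap x = f x - f w + A w \<bullet> (x - w)"

lemma gap_measurable [measurable]: "gap \<in> borel_measurable borel"
  unfolding gap_def by measurable

lemma gap_ge: "\<mu> / 2 * (norm (x - w))\<^sup>2 \<le> gap x"
proof -
  have "g w = - A w" using stationary by (simp add: add_eq_0_iff2)
  then show ?thesis using convex[of x w] by (simp add: gap_def)
qed

lemma gap_nonneg: "0 \<le> gap x"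
  using gap_ge[of x] mu_pos by (meson order_trans mult_nonneg_nonneg zero_le_power2 less_imp_le half_gt_zero)

text \<open>Smoothness at md bounds f at the new average, whose displacement from md is a (h - u),
  hence the factor a^2. Convexity at md, applied to ag and w with weights 1 - a and a, then removes
  the value f md.\<close>

lemma gap_step:
  fixes a :: real
  assumes a: "0 \<le> a" "a \<le> 1" and md: "md = (1 - a) *\<^sub>R ag + a *\<^sub>R u"
  shows "gap ((1 - a) *\<^sub>R ag + a *\<^sub>R h)
    \<le> (1 - a) * gap ag + a * ((g md + A h) \<bullet> (h - w)) + L * a\<^sup>2 / 2 * (norm (h - u))\<^sup>2"
proof -
  let ?ag = "(1 - a) *\<^sub>R ag + a *\<^sub>R h"
  have d: "?ag - md = a *\<^sub>R (h - u)" by (simp add: md algebra_simps)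
  have 1: "f ?ag \<le> f md + g md \<bullet> (?ag - md) + L * a\<^sup>2 / 2 * (norm (h - u))\<^sup>2"
    using smooth[of ?ag md] by (simp add: d power_mult_distrib mult.assoc)
  have sq: "0 \<le> \<mu> / 2 * (norm z)\<^sup>2" for z :: 'v using mu_pos by simp
  have "f md + g md \<bullet> (ag - md) \<le> f ag"
    using convex[of ag md] sq[of "ag - md"] by simp
  then have 2: "(1 - a) * (f md + g md \<bullet> (ag - md)) \<le> (1 - a) * f ag"
    using a by (intro mult_left_mono) auto
  have "f md + g md \<bullet> (w - md) \<le> f w"
    using convex[of w md] sq[of "w - md"] by simp
  then have 3: "a * (f md + g md \<bullet> (w - md)) \<le> a * f w"
    using a by (intro mult_left_mono) auto
  have 4: "g md \<bullet> (?ag - md) = (1 - a) * (g md \<bullet> (ag - md)) + a * (g md \<bullet> (w - md)) + a * (g md \<bullet> (h - w))"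
    by (simp add: inner_simps algebra_simps)
  have 5: "A w \<bullet> (?ag - w) = (1 - a) * (A w \<bullet> (ag - w)) + a * (A w \<bullet> (h - w))"
    by (simp add: inner_simps algebra_simps)
  have 6: "A w \<bullet> (h - w) = A h \<bullet> (h - w)"
    using skew[of h w] by (simp add: inner_diff_left)
  show ?thesis
    unfolding gap_def 5 using 1 2 3 unfolding 4 6
    by (simp add: inner_add_left algebra_simps)
qed

text \<open>The gradient noise enters through a square centred at \<open>g md + ((1 - r) / e) *\<^sub>R (u - w)\<close>: completing
  the square absorbs the indefinite term \<open>\<epsilon> \<bullet> (u - w)\<close>, so that both sides are nonnegative and the
  inequality can be integrated with \<open>\<integral>\<^sup>+\<close>, without any integrability of the iterates.\<close>

lemma potential_step:
  fixes k :: nat and p e r \<beta> :: real and gx a1 u ag :: 'v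
  assumes k: "1 \<le> k" and e: "0 < e" and p: "p = k / e" and r: "r < 1" and beta: "0 < \<beta>"
    and step: "(1 + \<beta>) * K\<^sup>2 * e\<^sup>2 + L * alpha k * e \<le> r"
    and md: "md = (1 - alpha k) *\<^sub>R ag + alpha k *\<^sub>R u"
    and h: "h = u - e *\<^sub>R (gx + a1)"
  shows "real k * (real k + 1) * gap ((1 - alpha k) *\<^sub>R ag + alpha k *\<^sub>R h)
      + p * (norm (u - e *\<^sub>R (gx + A h) - w))\<^sup>2
    \<le> real k * (real k - 1) * gap ag + r * p * (norm (u - w))\<^sup>2
      + k * e / (1 - r) * (norm (gx - (g md + ((1 - r) / e) *\<^sub>R (u - w))))\<^sup>2
      + k * e * (1 + 1 / \<beta>) * (norm (a1 - A u))\<^sup>2"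
proof -
  define a where "a = alpha k"
  define \<epsilon> where "\<epsilon> = gx - g md"
  define n where "n = (norm (h - u))\<^sup>2"
  define m where "m = (norm (a1 - A u))\<^sup>2"
  define V where "V = (norm (u - w))\<^sup>2"
  define X where "X = (g md + A h) \<bullet> (h - w)"
  define Y where "Y = \<epsilon> \<bullet> (h - u)"
  define Z where "Z = \<epsilon> \<bullet> (u - w)"
  have p0: "0 \<le> p" and kp: "real k = p * e" using p e by auto
  have "y * (2 / y) = 2" if "y \<noteq> 0" for y :: real using that by simp
  from this[of "real k + 1"] have ak: "(real k + 1) * a = 2"
    by (auto simp only: a_def alpha_def)
  have a: "0 \<le> a" "a \<le> 1"
    using k by (auto simp: a_def alpha_def)
  have n0: "0 \<le> n" by (simp add: n_def)
  have "gap ((1 - a) *\<^sub>R ag + a *\<^sub>R h) \<le> (1 - a) * gap ag + a * X + L * a\<^sup>2 / 2 * n"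
    unfolding n_def X_def by (rule gap_step) (use a md in \<open>auto simp: a_def\<close>)
  then have "real k * (real k + 1) * gap ((1 - a) *\<^sub>R ag + a *\<^sub>R h)
      \<le> real k * (real k + 1) * ((1 - a) * gap ag + a * X + L * a\<^sup>2 / 2 * n)"
    by (intro mult_left_mono) auto
  \<comment> \<open>alpha k = 2 / (k + 1) fits this weight: the old gap keeps k (k - 1), the weight
    of the previous step, and X gets 2 k = 2 p e, its coefficient in the expansion of the distance,
    so the two cancel.\<close>
  also have "\<dots> = real k * ((real k + 1) - (real k + 1) * a) * gap ag + real k * ((real k + 1) * a) * X
      + real k * ((real k + 1) * a) * a * (L / 2 * n)"
    by (simp add: algebra_simps power2_eq_square)
  also have "\<dots> = real k * (real k - 1) * gap ag + 2 * real k * X + real k * L * a * n"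
    unfolding ak by simp
  finally have 1: "real k * (real k + 1) * gap ((1 - a) *\<^sub>R ag + a *\<^sub>R h)
     \<le> real k * (real k - 1) * gap ag + 2 * real k * X + real k * L * a * n" .
  have 7: "(gx + A h) \<bullet> (h - w) = X + Y + Z"
    by (simp add: \<epsilon>_def X_def Y_def Z_def inner_simps)
  have "(norm (u - e *\<^sub>R (gx + A h) - w))\<^sup>2
      = V - 2 * e * ((gx + A h) \<bullet> (h - w)) + e\<^sup>2 * (norm (a1 - A h))\<^sup>2 - n"
    using extragradient_identity[of u e "gx + A h" w "gx + a1"]
    by (simp add: V_def h n_def)
  \<comment> \<open>The difference a1 - A h splits into the Lipschitz error A u - A h and the
    sampling error a1 - A u; \<beta> balances the two.\<close>
  also have "\<dots> \<le> V - 2 * e * (X + Y + Z) + e\<^sup>2 * ((1 + \<beta>) * K\<^sup>2 * n + (1 + 1 / \<beta>) * m) - n"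
  proof -
    have "(norm (A u - A h))\<^sup>2 \<le> (K * norm (u - h))\<^sup>2"
      by (intro power_mono lipschitz) auto
    also have "\<dots> = K\<^sup>2 * n" by (simp add: n_def power_mult_distrib norm_minus_commute)
    finally have "(1 + \<beta>) * (norm (A u - A h))\<^sup>2 \<le> (1 + \<beta>) * (K\<^sup>2 * n)"
      using beta by (intro mult_left_mono) auto
    then have "(norm (a1 - A h))\<^sup>2 \<le> (1 + \<beta>) * K\<^sup>2 * n + (1 + 1 / \<beta>) * m"
      using sq_norm_add_le[OF beta, of "A u - A h" "a1 - A u"] by (simp add: m_def)
    then show ?thesis unfolding 7 by (simp add: mult_left_mono)
  qed
  finally have "p * (norm (u - e *\<^sub>R (gx + A h) - w))\<^sup>2 \<le> p * (V - 2 * e * (X + Y + Z)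
      + e\<^sup>2 * ((1 + \<beta>) * K\<^sup>2 * n + (1 + 1 / \<beta>) * m) - n)"
    using p0 by (intro mult_left_mono) auto
  also have "\<dots> = p * V - 2 * (p * e) * X - 2 * (p * e) * Y - 2 * (p * e) * Z
      + p * ((1 + \<beta>) * K\<^sup>2 * e\<^sup>2 * n) + p * e * e * (1 + 1 / \<beta>) * m - p * n"
    by (simp add: algebra_simps power2_eq_square)
  finally have 2: "p * (norm (u - e *\<^sub>R (gx + A h) - w))\<^sup>2
      \<le> p * V - 2 * (p * e) * X - 2 * (p * e) * Y - 2 * (p * e) * Z
      + p * ((1 + \<beta>) * K\<^sup>2 * e\<^sup>2 * n) + p * e * e * (1 + 1 / \<beta>) * m - p * n" .
  define s where "s = 1 - r"
  have s: "0 < s" using r by (simp add: s_def)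
  have sq: "(norm (c *\<^sub>R x))\<^sup>2 = c\<^sup>2 * (norm x)\<^sup>2" for c and x :: 'v
    by (simp add: power_mult_distrib)
  \<comment> \<open>Y pairs the noise with the half step that the same sample produced. Young's
    inequality charges it to the share s of the budget p n, and the share r is left for the step
    size condition.\<close>
  have "0 \<le> (norm ((s / e) *\<^sub>R (h - u) + \<epsilon>))\<^sup>2" by simp
  also have "\<dots> = (norm ((s / e) *\<^sub>R (h - u)))\<^sup>2 + 2 * ((s / e) * Y) + (norm \<epsilon>)\<^sup>2"
    unfolding Y_def power2_norm_eq_inner by (simp add: inner_add_left inner_add_right inner_commute)
  also have "(norm ((s / e) *\<^sub>R (h - u)))\<^sup>2 = (s / e)\<^sup>2 * n"
    unfolding n_def by (rule sq)
  finally have "0 \<le> p * e * e / s * ((s / e)\<^sup>2 * n + 2 * ((s / e) * Y) + (norm \<epsilon>)\<^sup>2)"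
    using e s p0 by (intro mult_nonneg_nonneg) auto
  also have "\<dots> = p * s * n + 2 * (p * e) * Y + p * e * e / s * (norm \<epsilon>)\<^sup>2"
    using e s by (simp add: distrib_left power2_eq_square)
  finally have 3: "0 \<le> p * s * n + 2 * (p * e) * Y + p * e * e / s * (norm \<epsilon>)\<^sup>2" .
  \<comment> \<open>The cross term is exactly the Z term of 2. The shift also contributes p s V, the
    complement of r p V to the p V in the expansion of the distance.\<close>
  have 4: "p * e * e / s * (norm (gx - (g md + (s / e) *\<^sub>R (u - w))))\<^sup>2
     = p * e * e / s * (norm \<epsilon>)\<^sup>2 - 2 * (p * e) * Z + p * s * V"
  proof -
    have "gx - (g md + (s / e) *\<^sub>R (u - w)) = \<epsilon> - (s / e) *\<^sub>R (u - w)"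
      by (simp add: \<epsilon>_def)
    then have "(norm (gx - (g md + (s / e) *\<^sub>R (u - w))))\<^sup>2 = (norm (\<epsilon> - (s / e) *\<^sub>R (u - w)))\<^sup>2"
      by (rule arg_cong)
    also have "\<dots> = (norm \<epsilon>)\<^sup>2 - 2 * ((s / e) * Z) + (norm ((s / e) *\<^sub>R (u - w)))\<^sup>2"
      unfolding Z_def power2_norm_eq_inner by (simp add: inner_diff_left inner_diff_right inner_commute)
    also have "\<dots> = (norm \<epsilon>)\<^sup>2 - 2 * ((s / e) * Z) + (s / e)\<^sup>2 * V"
      unfolding V_def sq ..
    finally show ?thesis
      using e s by (simp add: distrib_left right_diff_distrib power2_eq_square)
  qed
  have "p * n * ((1 + \<beta>) * K\<^sup>2 * e\<^sup>2 + L * a * e) \<le> p * n * r"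
    using step p0 n0 unfolding a_def by (intro mult_left_mono) auto
  then have 5: "p * ((1 + \<beta>) * K\<^sup>2 * e\<^sup>2 * n) + p * e * L * a * n \<le> p * r * n"
    by (simp add: algebra_simps)
  have 6: "p * s * n = p * n - p * r * n" "p * s * V = p * V - r * p * V"
    by (simp_all add: s_def algebra_simps)
  show ?thesis
    unfolding s_def[symmetric] a_def[symmetric] V_def[symmetric] m_def[symmetric] kp 4
    using 1[unfolded kp] 2 3 5 unfolding 6 by linarith
qed

end

section \<open>Expectations over fresh samples\<close>

text \<open>Bias-variance decomposition about an arbitrary centre. The variance bound makes |X -
  m|^2 Bochner integrable, so the square can be expanded under the integral, where the cross term
  vanishes by unbiasedness.\<close>

lemma (in prob_space) nn_integral_sq_deviation:
  fixes X :: "'a \<Rightarrow> 'v::euclidean_space"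
  assumes X: "has_bochner_integral M X m"
    and var: "(\<integral>\<^sup>+x. ennreal ((norm (X x - m))\<^sup>2) \<partial>M) \<le> ennreal s" and s: "0 \<le> s"
  shows "(\<integral>\<^sup>+x. ennreal ((norm (X x - c))\<^sup>2) \<partial>M) \<le> ennreal ((norm (m - c))\<^sup>2 + s)"
proof -
  have [measurable]: "X \<in> borel_measurable M" using X by auto
  have iX: "integrable M X" and mX: "integral\<^sup>L M X = m"
    using X by (auto simp: has_bochner_integral_iff)
  have "(\<integral>\<^sup>+x. ennreal ((norm (X x - m))\<^sup>2) \<partial>M) < \<infinity>"
    using var by (rule le_less_trans) simp
  then have i1: "integrable M (\<lambda>x. (norm (X x - m))\<^sup>2)"
    by (intro integrableI_bounded) auto
  have i2: "integrable M (\<lambda>x. 2 * ((X x - m) \<bullet> (m - c)) + (norm (m - c))\<^sup>2)"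
    using iX by auto
  have e: "(norm (X x - c))\<^sup>2 = (norm (X x - m))\<^sup>2 + (2 * ((X x - m) \<bullet> (m - c)) + (norm (m - c))\<^sup>2)" for x
    by (simp add: power2_norm_eq_inner inner_simps inner_commute)
  have "(\<integral>\<^sup>+x. ennreal ((norm (X x - c))\<^sup>2) \<partial>M) = ennreal (\<integral>x. (norm (X x - c))\<^sup>2 \<partial>M)"
    unfolding e by (rule nn_integral_eq_integral[OF Bochner_Integration.integrable_add[OF i1 i2]])
      (simp add: e[symmetric])
  also have "(\<integral>x. (norm (X x - c))\<^sup>2 \<partial>M)
      = (\<integral>x. (norm (X x - m))\<^sup>2 \<partial>M) + (2 * ((integral\<^sup>L M X - m) \<bullet> (m - c)) + (norm (m - c))\<^sup>2)"
    unfolding e using i1 i2 iX by (simp add: prob_space)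
  also have "\<dots> = (\<integral>x. (norm (X x - m))\<^sup>2 \<partial>M) + (norm (m - c))\<^sup>2"
    by (simp add: mX)
  also have "(\<integral>x. (norm (X x - m))\<^sup>2 \<partial>M) \<le> s"
    using var s by (subst (asm) nn_integral_eq_integral[OF i1]) auto
  finally show ?thesis
    by (simp add: ennreal_leI algebra_simps)
qed

text \<open>A \<open>measure\<close> serving only as a carrier of its sets: that a random variable
  depends on the draws in \<open>I\<close> alone is expressed as measurability from this
  space.\<close>

definition joint_algebra :: "'w measure \<Rightarrow> ('i \<Rightarrow> 'w set set) \<Rightarrow> 'i set \<Rightarrow> 'w measure" where
  "joint_algebra M E I = sigma (space M) (\<Union>i\<in>I. E i)"

lemma Int_stable_generated: "Int_stable (generated M X N)"
  unfolding Int_stable_def generated_def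
proof safe
  fix A B assume "A \<in> sets N" "B \<in> sets N"
  then show "\<exists>C. X -` A \<inter> space M \<inter> (X -` B \<inter> space M) = X -` C \<inter> space M \<and> C \<in> sets N"
    by (intro exI[of _ "A \<inter> B"]) auto
qed

lemma space_joint_algebra [simp]: "space (joint_algebra M E I) = space M"
  by (simp add: joint_algebra_def space_measure_of_conv)

lemma measurable_joint_algebra_mono:
  assumes "X \<in> measurable (joint_algebra M E I) N" "I \<subseteq> J" "\<And>i. i \<in> J \<Longrightarrow> E i \<subseteq> Pow (space M)"
  shows "X \<in> measurable (joint_algebra M E J) N"
proof -
  have "sets (joint_algebra M E I) \<subseteq> sets (joint_algebra M E J)"
  proof -
    have "(\<Union>i\<in>I. E i) \<subseteq> (\<Union>i\<in>J. E i)" and "(\<Union>i\<in>J. E i) \<subseteq> Pow (space M)"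
      using assms(2) by (rule UN_mono[OF _ order_refl]) (rule UN_least[OF assms(3)])
    then show ?thesis
      unfolding joint_algebra_def by (simp add: sigma_sets_mono' order_trans[of "\<Union>i\<in>I. E i"])
  qed
  then show ?thesis
    using assms(1) by (auto simp: measurable_def)
qed

lemma measurable_joint_algebra_generated:
  assumes "i \<in> I" "E i = generated M X N" "X \<in> measurable M N" "\<And>i. i \<in> I \<Longrightarrow> E i \<subseteq> Pow (space M)"
  shows "X \<in> measurable (joint_algebra M E I) N"
proof (rule measurableI)
  fix A assume "A \<in> sets N"
  then have "X -` A \<inter> space M \<in> (\<Union>i\<in>I. E i)"
    using assms(1,2) by (auto simp: generated_def)
  then show "X -` A \<inter> space (joint_algebra M E I) \<in> sets (joint_algebra M E I)"
    unfolding space_joint_algebra unfolding joint_algebra_def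
    by (subst sets_measure_of) (use assms(4) in \<open>auto intro: sigma_sets.Basic\<close>)
qed (use assms(3) in \<open>auto simp: measurable_space\<close>)

lemma (in prob_space) measurable_joint_algebra_imp:
  assumes "indep_sets E J" "I \<subseteq> J" "X \<in> measurable (joint_algebra M E I) N"
  shows "X \<in> measurable M N"
proof -
  have "(\<Union>i\<in>I. E i) \<subseteq> sets M"
    using assms(1,2) by (auto simp: indep_sets_def)
  then have "sets (joint_algebra M E I) \<subseteq> sets M"
    unfolding joint_algebra_def using sets.space_closed[of M]
    by (subst sets_measure_of) (auto intro!: sets.sigma_sets_subset)
  then show ?thesis
    using assms(3) by (auto simp: measurable_def)
qed

text \<open>Conditioning on the past in Fubini form: since X is independent of the draws that
  determine Y, the joint law of (Y, X) is the product of the law of Y with D.\<close>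

lemma (in prob_space) nn_integral_fresh_sample:
  assumes indep: "indep_sets E J" and stable: "\<And>i. i \<in> J \<Longrightarrow> Int_stable (E i)"
    and I: "I \<subseteq> J" and d: "d \<in> J" "d \<notin> I"
    and Y: "Y \<in> measurable (joint_algebra M E I) N"
    and E: "E d = generated M X D" and X: "X \<in> measurable M D" "distr M D X = D"
    and \<phi>: "(\<lambda>(y, x). \<phi> y x) \<in> borel_measurable (N \<Otimes>\<^sub>M D)"
  shows "(\<integral>\<^sup>+\<omega>. \<phi> (Y \<omega>) (X \<omega>) \<partial>M) = (\<integral>\<^sup>+\<omega>. (\<integral>\<^sup>+x. \<phi> (Y \<omega>) x \<partial>D) \<partial>M)"
proof -
  have Y' [measurable]: "Y \<in> measurable M N"
    by (rule measurable_joint_algebra_imp[OF indep I Y])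
  note X(1) [measurable]
  have pY: "prob_space (distr M N Y)" by (rule prob_space_distr) (rule Y')
  have pD: "prob_space D" using prob_space_distr[OF X(1)] X(2) by simp
  interpret D: prob_space D by (rule pD)
  interpret dY: prob_space "distr M N Y" by (rule pY)
  \<comment> \<open>Two blocks of indices, the past for \<open>True\<close> and the fresh draw for
    \<open>False\<close>; independence of the draws passes to the \<sigma>-algebras of the blocks
    because the generating families are stable under intersection.\<close>
  define K where "K b = (if b then I else {d})" for b :: bool
  have ind: "indep_sets (\<lambda>b. sigma_sets (space M) (\<Union>i\<in>K b. E i)) UNIV"
  proof (rule indep_sets_collect_sigma)
    show "indep_sets E (\<Union>j\<in>UNIV. K j)"
      by (rule indep_sets_mono_index[OF _ indep]) (use I d in \<open>auto simp: K_def\<close>)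
    show "Int_stable (E i)" if "j \<in> UNIV" "i \<in> K j" for i j
      using that I d by (intro stable) (auto simp: K_def split: if_splits)
    show "disjoint_family_on K UNIV"
      using d by (auto simp: disjoint_family_on_def K_def)
  qed
  have EI: "E i \<subseteq> Pow (space M)" if "i \<in> J" for i
    using indep that sets.space_closed[of M] by (auto simp: indep_sets_def)
  have joint: "distr M N Y \<Otimes>\<^sub>M D = distr M (N \<Otimes>\<^sub>M D) (\<lambda>\<omega>. (Y \<omega>, X \<omega>))"
  proof (rule pair_measure_eqI)
    show "sigma_finite_measure (distr M N Y)" "sigma_finite_measure D" by unfold_locales
    show "sets (distr M N Y \<Otimes>\<^sub>M D) = sets (distr M (N \<Otimes>\<^sub>M D) (\<lambda>\<omega>. (Y \<omega>, X \<omega>)))"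
      by (simp cong: sets_pair_measure_cong)
  next
    fix A B assume A: "A \<in> sets (distr M N Y)" and B: "B \<in> sets D"
    let ?a = "Y -` A \<inter> space M" and ?b = "X -` B \<inter> space M"
    have "(\<Union>i\<in>I. E i) \<subseteq> Pow (space M)"
      using I by (intro UN_least EI) auto
    then have "sets (joint_algebra M E I) = sigma_sets (space M) (\<Union>i\<in>I. E i)"
      unfolding joint_algebra_def by (rule sets_measure_of)
    then have "?a \<in> sigma_sets (space M) (\<Union>i\<in>I. E i)"
      using measurable_sets[OF Y, of A] A by simp
    moreover have "?b \<in> sigma_sets (space M) (\<Union>i\<in>{d}. E i)"
      using B E by (auto simp: generated_def intro!: sigma_sets.Basic)
    ultimately have "prob (\<Inter>j\<in>UNIV. if j then ?a else ?b) = (\<Prod>j\<in>UNIV. prob (if j then ?a else ?b))"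
      by (intro indep_setsD[OF ind]) (auto simp: K_def)
    then have pr: "prob (?a \<inter> ?b) = prob ?a * prob ?b"
      by (simp add: UNIV_bool ac_simps)
    have "emeasure D B = emeasure (distr M D X) B" by (simp add: X(2))
    also have "\<dots> = prob ?b" using B by (simp add: emeasure_distr emeasure_eq_measure)
    finally have eB: "emeasure D B = prob ?b" .
    have "emeasure (distr M (N \<Otimes>\<^sub>M D) (\<lambda>\<omega>. (Y \<omega>, X \<omega>))) (A \<times> B)
      = emeasure M ((\<lambda>\<omega>. (Y \<omega>, X \<omega>)) -` (A \<times> B) \<inter> space M)"
      using A B by (intro emeasure_distr) auto
    also have "(\<lambda>\<omega>. (Y \<omega>, X \<omega>)) -` (A \<times> B) \<inter> space M = ?a \<inter> ?b" by auto
    also have "emeasure M (?a \<inter> ?b) = emeasure (distr M N Y) A * emeasure D B"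
      using A by (simp add: eB emeasure_distr emeasure_eq_measure pr ennreal_mult)
    finally show "emeasure (distr M N Y) A * emeasure D B
      = emeasure (distr M (N \<Otimes>\<^sub>M D) (\<lambda>\<omega>. (Y \<omega>, X \<omega>))) (A \<times> B)" ..
  qed
  have "(\<integral>\<^sup>+\<omega>. \<phi> (Y \<omega>) (X \<omega>) \<partial>M) = (\<integral>\<^sup>+z. (case z of (y, x) \<Rightarrow> \<phi> y x) \<partial>distr M (N \<Otimes>\<^sub>M D) (\<lambda>\<omega>. (Y \<omega>, X \<omega>)))"
    using \<phi> by (subst nn_integral_distr) auto
  also have "\<dots> = (\<integral>\<^sup>+y. (\<integral>\<^sup>+x. \<phi> y x \<partial>D) \<partial>distr M N Y)"
    unfolding joint[symmetric] using \<phi>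
    by (subst D.nn_integral_fst[symmetric]) (simp_all cong: measurable_cong_sets sets_pair_measure_cong)
  also have "\<dots> = (\<integral>\<^sup>+\<omega>. (\<integral>\<^sup>+x. \<phi> (Y \<omega>) x \<partial>D) \<partial>M)"
    using D.borel_measurable_nn_integral[OF \<phi>] by (subst nn_integral_distr) auto
  finally show ?thesis .
qed

lemma (in prob_space) nn_integral_affine_sq_deviation:
  fixes X :: "'a \<Rightarrow> 'v::euclidean_space"
  assumes X: "has_bochner_integral M X m"
    and var: "(\<integral>\<^sup>+x. ennreal ((norm (X x - m))\<^sup>2) \<partial>M) \<le> ennreal s" and s: "0 \<le> s"
    and c: "0 \<le> c" and q: "0 \<le> q"
  shows "(\<integral>\<^sup>+x. ennreal (c + q * (norm (X x - a))\<^sup>2) \<partial>M) \<le> ennreal (c + q * ((norm (m - a))\<^sup>2 + s))"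
proof -
  have [measurable]: "X \<in> borel_measurable M" using X by auto
  have "(\<integral>\<^sup>+x. ennreal (c + q * (norm (X x - a))\<^sup>2) \<partial>M)
      = (\<integral>\<^sup>+x. ennreal c + ennreal q * ennreal ((norm (X x - a))\<^sup>2) \<partial>M)"
    using c q by (simp add: ennreal_plus ennreal_mult)
  also have "\<dots> = ennreal c + ennreal q * (\<integral>\<^sup>+x. ennreal ((norm (X x - a))\<^sup>2) \<partial>M)"
    by (subst nn_integral_add) (auto simp: nn_integral_cmult emeasure_space_1)
  also have "\<dots> \<le> ennreal c + ennreal q * ennreal ((norm (m - a))\<^sup>2 + s)"
    by (intro add_left_mono mult_left_mono nn_integral_sq_deviation[OF X var s]) auto
  also have "\<dots> = ennreal (c + q * ((norm (m - a))\<^sup>2 + s))"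
    using c q s by (simp add: ennreal_plus ennreal_mult)
  finally show ?thesis .
qed

text \<open>The state after \<open>t\<close> steps is \<open>(z\<^sub>t, z\<^sup>a\<^sup>g)\<close>; the point \<open>z\<^sup>m\<^sup>d\<close> is a function of both.\<close>

definition eg_step :: "('v::real_vector \<Rightarrow> 'a \<Rightarrow> 'v) \<Rightarrow> ('v \<Rightarrow> 'b \<Rightarrow> 'v) \<Rightarrow> (nat \<Rightarrow> real) \<Rightarrow> nat \<Rightarrow>
    'v \<times> 'v \<Rightarrow> 'a \<Rightarrow> 'b \<Rightarrow> 'b \<Rightarrow> 'v \<times> 'v" where
  "eg_step gs as \<eta> k z x z1 z2 =
     (let u = fst z; ag = snd z;
          gx = gs ((1 - alpha k) *\<^sub>R ag + alpha k *\<^sub>R u) x;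
          h = u - \<eta> k *\<^sub>R (gx + as u z1)
      in (u - \<eta> k *\<^sub>R (gx + as h z2), (1 - alpha k) *\<^sub>R ag + alpha k *\<^sub>R h))"

primrec eg_iter :: "('v::real_vector \<Rightarrow> 'a \<Rightarrow> 'v) \<Rightarrow> ('v \<Rightarrow> 'b \<Rightarrow> 'v) \<Rightarrow> (nat \<Rightarrow> real) \<Rightarrow> 'v \<Rightarrow>
    (nat \<Rightarrow> 'a) \<Rightarrow> (nat \<Rightarrow> 'b) \<Rightarrow> (nat \<Rightarrow> 'b) \<Rightarrow> nat \<Rightarrow> 'v \<times> 'v" where
  "eg_iter gs as \<eta> z0 \<xi> \<zeta>h \<zeta> 0 = (z0, z0)"
| "eg_iter gs as \<eta> z0 \<xi> \<zeta>h \<zeta> (Suc t) =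
     eg_step gs as \<eta> (Suc t) (eg_iter gs as \<eta> z0 \<xi> \<zeta>h \<zeta> t) (\<xi> (Suc t)) (\<zeta>h (Suc t)) (\<zeta> (Suc t))"

primrec eg_restarted :: "('v::real_vector \<Rightarrow> 'a \<Rightarrow> 'v) \<Rightarrow> ('v \<Rightarrow> 'b \<Rightarrow> 'v) \<Rightarrow> (nat \<Rightarrow> nat \<Rightarrow> real) \<Rightarrow>
    (nat \<Rightarrow> nat) \<Rightarrow> 'v \<Rightarrow> (nat \<Rightarrow> nat \<Rightarrow> 'a) \<Rightarrow> (nat \<Rightarrow> nat \<Rightarrow> 'b) \<Rightarrow> (nat \<Rightarrow> nat \<Rightarrow> 'b) \<Rightarrow> nat \<Rightarrow> 'v" where
  "eg_restarted gs as \<eta> T z0 \<xi> \<zeta>h \<zeta> 0 = z0"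
| "eg_restarted gs as \<eta> T z0 \<xi> \<zeta>h \<zeta> (Suc s) =
     snd (eg_iter gs as (\<eta> (Suc s)) (eg_restarted gs as \<eta> T z0 \<xi> \<zeta>h \<zeta> s)
       (\<xi> (Suc s)) (\<zeta>h (Suc s)) (\<zeta> (Suc s)) (T (Suc s)))"

section \<open>The one-step inequality in expectation\<close>

locale stochastic_saddle = bilinear_saddle f g A w \<mu> L K + DX: prob_space DX + DZ: prob_space DZ
  for f :: "'v::euclidean_space \<Rightarrow> real" and g A :: "'v \<Rightarrow> 'v" and w :: 'v and \<mu> L K :: real
    and DX :: "'a measure" and DZ :: "'b measure" +
  fixes gs :: "'v \<Rightarrow> 'a \<Rightarrow> 'v" and as :: "'v \<Rightarrow> 'b \<Rightarrow> 'v" and vS vB :: real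
  assumes var_nonneg: "0 \<le> vS" "0 \<le> vB"
    and gs_measurable [measurable]: "(\<lambda>(z, x). gs z x) \<in> borel_measurable (borel \<Otimes>\<^sub>M DX)"
    and as_measurable [measurable]: "(\<lambda>(z, x). as z x) \<in> borel_measurable (borel \<Otimes>\<^sub>M DZ)"
    and gs_unbiased: "has_bochner_integral DX (gs z) (g z)"
    and as_unbiased: "has_bochner_integral DZ (as z) (A z)"
    and gs_variance: "(\<integral>\<^sup>+x. ennreal ((norm (gs z x - g z))\<^sup>2) \<partial>DX) \<le> ennreal vS"
    and as_variance: "(\<integral>\<^sup>+x. ennreal ((norm (as z x - A z))\<^sup>2) \<partial>DZ) \<le> ennreal vB"
begin

text \<open>The weight \<open>p\<close> is a separate argument because the one-step bound lowers the
  index from k to k - 1 while keeping the weight of step k.\<close>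

definition potential :: "nat \<Rightarrow> real \<Rightarrow> 'v \<times> 'v \<Rightarrow> real" where
  "potential k p z = real k * (real k + 1) * gap (snd z) + p * (norm (fst z - w))\<^sup>2"

lemma potential_measurable [measurable]: "potential k p \<in> borel_measurable borel"
  unfolding potential_def borel_prod[symmetric] by measurable

text \<open>z2 is integrated first because the half point is a function of x and z1 and stays fixed
  meanwhile. With e = \<open>\<eta> k\<close>, z2 costs k e vB, z1 costs (1 + 1 / \<beta>) k e vB
  and the gradient sample k e vS / (1 - r); this is the origin of 2 + 1 / \<beta>.\<close>

lemma expected_potential_step:
  fixes k :: nat and \<eta> :: "nat \<Rightarrow> real"
  assumes k: "1 \<le> k" and p: "0 < p" "\<eta> k = k / p" and r: "0 < r" "r < 1" and beta: "0 < \<beta>"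
    and step: "(1 + \<beta>) * K\<^sup>2 * (\<eta> k)\<^sup>2 + L * alpha k * \<eta> k \<le> r"
  shows "(\<integral>\<^sup>+x. (\<integral>\<^sup>+z1. (\<integral>\<^sup>+z2. ennreal (potential k p (eg_step gs as \<eta> k z x z1 z2)) \<partial>DZ) \<partial>DZ) \<partial>DX)
    \<le> ennreal (potential (k - 1) p z + k * \<eta> k * (vS / (1 - r) + (2 + 1 / \<beta>) * vB))"
proof -
  define e u ag where "e = \<eta> k" and "u = fst z" and "ag = snd z"
  define md where "md = (1 - alpha k) *\<^sub>R ag + alpha k *\<^sub>R u"
  define h where "h x z1 = u - e *\<^sub>R (gs md x + as u z1)" for x z1
  define ag' where "ag' x z1 = (1 - alpha k) *\<^sub>R ag + alpha k *\<^sub>R h x z1" for x z1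
  have e: "0 < e" and pe: "p = k / e" and ke: "real k = p * e"
    using p k by (simp_all add: e_def)
  let ?V = "p * e\<^sup>2 * vB"
  let ?c = "real k * (real k - 1) * gap ag + r * p * (norm (u - w))\<^sup>2"
  have c0: "0 \<le> ?c" using k r p gap_nonneg by simp
  have V0: "0 \<le> ?V" using p e var_nonneg by simp
  have inner: "(\<integral>\<^sup>+z2. ennreal (potential k p (eg_step gs as \<eta> k z x z1 z2)) \<partial>DZ)
      \<le> ennreal ((real k * (real k + 1) * gap (ag' x z1) + p * (norm (u - e *\<^sub>R (gs md x + A (h x z1)) - w))\<^sup>2) + ?V)"
    for x z1
  proof -
    \<comment> \<open>Factoring - e out of the full step turns its distance to w into the deviation
      of the last sample from a centre that does not depend on z2.\<close>
    define a where "a = (1 / e) *\<^sub>R (u - w) - gs md x"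
    have sq: "(norm (u - e *\<^sub>R (gs md x + y) - w))\<^sup>2 = e\<^sup>2 * (norm (y - a))\<^sup>2" for y
    proof -
      have "u - e *\<^sub>R (gs md x + y) - w = (- e) *\<^sub>R (y - a)"
        using e by (simp add: a_def algebra_simps)
      then have "(norm (u - e *\<^sub>R (gs md x + y) - w))\<^sup>2 = (norm ((- e) *\<^sub>R (y - a)))\<^sup>2"
        by (rule arg_cong)
      then show ?thesis by (simp add: power_mult_distrib)
    qed
    have "potential k p (eg_step gs as \<eta> k z x z1 z2)
        = real k * (real k + 1) * gap (ag' x z1) + p * e\<^sup>2 * (norm (as (h x z1) z2 - a))\<^sup>2" for z2
      by (simp add: potential_def eg_step_def Let_def ag'_def h_def md_def u_def ag_def e_def mult.assoc
          flip: sq[unfolded h_def md_def u_def ag_def e_def])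
    then have "(\<integral>\<^sup>+z2. ennreal (potential k p (eg_step gs as \<eta> k z x z1 z2)) \<partial>DZ)
      = (\<integral>\<^sup>+z2. ennreal (real k * (real k + 1) * gap (ag' x z1) + p * e\<^sup>2 * (norm (as (h x z1) z2 - a))\<^sup>2) \<partial>DZ)"
      by simp
    also have "\<dots> \<le> ennreal (real k * (real k + 1) * gap (ag' x z1)
        + p * e\<^sup>2 * ((norm (A (h x z1) - a))\<^sup>2 + vB))"
      by (rule DZ.nn_integral_affine_sq_deviation[OF as_unbiased as_variance])
        (use var_nonneg gap_nonneg p in auto)
    also have "\<dots> = ennreal ((real k * (real k + 1) * gap (ag' x z1)
        + p * (norm (u - e *\<^sub>R (gs md x + A (h x z1)) - w))\<^sup>2) + ?V)"
      unfolding sq by (simp add: algebra_simps)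
    finally show ?thesis .
  qed
  let ?q = "k * e * (1 + 1 / \<beta>)"
  let ?s = "k * e / (1 - r)"
  let ?b = "g md + ((1 - r) / e) *\<^sub>R (u - w)"
  have q0: "0 \<le> ?q" and s0: "0 \<le> ?s" using e beta r by auto
  have mid: "(\<integral>\<^sup>+z1. (\<integral>\<^sup>+z2. ennreal (potential k p (eg_step gs as \<eta> k z x z1 z2)) \<partial>DZ) \<partial>DZ)
     \<le> ennreal ((?c + ?V + ?q * vB) + ?s * (norm (gs md x - ?b))\<^sup>2)" for x
  proof -
    have "(\<integral>\<^sup>+z1. (\<integral>\<^sup>+z2. ennreal (potential k p (eg_step gs as \<eta> k z x z1 z2)) \<partial>DZ) \<partial>DZ)
      \<le> (\<integral>\<^sup>+z1. ennreal ((?c + ?V + ?s * (norm (gs md x - ?b))\<^sup>2) + ?q * (norm (as u z1 - A u))\<^sup>2) \<partial>DZ)"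
    proof (intro nn_integral_mono order_trans[OF inner] ennreal_leI)
      fix z1
      have "real k * (real k + 1) * gap (ag' x z1) + p * (norm (u - e *\<^sub>R (gs md x + A (h x z1)) - w))\<^sup>2
        \<le> ?c + ?s * (norm (gs md x - ?b))\<^sup>2 + ?q * (norm (as u z1 - A u))\<^sup>2"
        unfolding ag'_def
        by (rule potential_step[OF k e pe r(2) beta step[folded e_def] md_def h_def])
      then show "real k * (real k + 1) * gap (ag' x z1) + p * (norm (u - e *\<^sub>R (gs md x + A (h x z1)) - w))\<^sup>2 + ?V
        \<le> (?c + ?V + ?s * (norm (gs md x - ?b))\<^sup>2) + ?q * (norm (as u z1 - A u))\<^sup>2" by linarith
    qed
    also have "\<dots> \<le> ennreal ((?c + ?V + ?s * (norm (gs md x - ?b))\<^sup>2) + ?q * ((norm (A u - A u))\<^sup>2 + vB))"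
      by (rule DZ.nn_integral_affine_sq_deviation[OF as_unbiased as_variance])
        (intro var_nonneg q0 add_nonneg_nonneg[OF add_nonneg_nonneg[OF c0 V0]] mult_nonneg_nonneg[OF s0] zero_le_power2)+
    also have "\<dots> = ennreal ((?c + ?V + ?q * vB) + ?s * (norm (gs md x - ?b))\<^sup>2)"
      by (simp add: add_ac)
    finally show ?thesis .
  qed
  have "(\<integral>\<^sup>+x. (\<integral>\<^sup>+z1. (\<integral>\<^sup>+z2. ennreal (potential k p (eg_step gs as \<eta> k z x z1 z2)) \<partial>DZ) \<partial>DZ) \<partial>DX)
     \<le> (\<integral>\<^sup>+x. ennreal ((?c + ?V + ?q * vB) + ?s * (norm (gs md x - ?b))\<^sup>2) \<partial>DX)"
    by (intro nn_integral_mono mid)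
  also have "\<dots> \<le> ennreal ((?c + ?V + ?q * vB) + ?s * ((norm (g md - ?b))\<^sup>2 + vS))"
    by (rule DX.nn_integral_affine_sq_deviation[OF gs_unbiased gs_variance])
      (intro var_nonneg s0 add_nonneg_nonneg[OF add_nonneg_nonneg[OF c0 V0]] mult_nonneg_nonneg[OF q0])+
  \<comment> \<open>The bias of the shifted square is p (1 - r) |u - w|^2, which completes r p to p,
    so the shift leaves no net cost.\<close>
  also have "(?c + ?V + ?q * vB) + ?s * ((norm (g md - ?b))\<^sup>2 + vS)
    = potential (k - 1) p z + k * \<eta> k * (vS / (1 - r) + (2 + 1 / \<beta>) * vB)"
  proof -
    have "g md - ?b = (- ((1 - r) / e)) *\<^sub>R (u - w)" by simp
    then have "(norm (g md - ?b))\<^sup>2 = (norm ((- ((1 - r) / e)) *\<^sub>R (u - w)))\<^sup>2" by (rule arg_cong)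
    also have "\<dots> = ((1 - r) / e)\<^sup>2 * (norm (u - w))\<^sup>2"
      unfolding norm_scaleR power_mult_distrib by (simp only: power2_abs power2_minus)
    finally have 1: "?s * (norm (g md - ?b))\<^sup>2 = p * (1 - r) * (norm (u - w))\<^sup>2"
      using e r unfolding ke by (simp add: power2_eq_square)
    have 2: "real (k - 1) = real k - 1" using k by (simp add: of_nat_diff)
    have 3: "?V + ?q * vB + ?s * vS = k * e * (vS / (1 - r) + (2 + 1 / \<beta>) * vB)"
      unfolding ke by (simp add: algebra_simps power2_eq_square)
    have 4: "?c + p * (1 - r) * (norm (u - w))\<^sup>2 = potential (k - 1) p z"
      unfolding potential_def 2 u_def ag_def by (simp add: algebra_simps)
    have "(?c + ?V + ?q * vB) + ?s * ((norm (g md - ?b))\<^sup>2 + vS)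
      = (?c + ?s * (norm (g md - ?b))\<^sup>2) + (?V + ?q * vB + ?s * vS)"
      by (simp only: distrib_left add_ac)
    then show ?thesis unfolding 1 3 4 e_def[symmetric] .
  qed
  finally show ?thesis .
qed

lemma eg_step_measurable:
  "(\<lambda>(((z, x), z1), z2). eg_step gs as \<eta> k z x z1 z2)
     \<in> measurable (((borel \<Otimes>\<^sub>M DX) \<Otimes>\<^sub>M DZ) \<Otimes>\<^sub>M DZ) borel"
  unfolding eg_step_def Let_def split_beta' borel_prod[symmetric]
  by measurable

end

section \<open>Step sizes and epoch lengths\<close>

text \<open>\<theta> = \<kappa> e is the share of \<kappa> k in the denominator. The coupling term
  equals r \<theta>^2 <= r \<theta>; by k * alpha k <= 2 and 2 L <= r M the smoothness term is at
  most r M / (M + \<kappa> k) = r (1 - \<theta>).\<close>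

lemma stepsize_condition:
  fixes L K r \<beta> M \<kappa> e :: real
  assumes L: "0 < L" and K: "0 \<le> K" and r: "0 < r" and beta: "0 < \<beta>"
    and M: "2 / r * L \<le> M" and \<kappa>: "\<kappa> = sqrt ((1 + \<beta>) / r) * K" and e: "e = k / (M + \<kappa> * real k)"
  shows "(1 + \<beta>) * K\<^sup>2 * e\<^sup>2 + L * alpha k * e \<le> r"
proof -
  define d \<theta> where "d = M + \<kappa> * real k" and "\<theta> = \<kappa> * e"
  have "0 < 2 / r * L" using r L by simp
  then have M0: "0 < M" using M by linarith
  have \<kappa>0: "0 \<le> \<kappa>" using \<kappa> K r beta by simp
  then have d: "0 < d" "\<kappa> * real k \<le> d" using M0 by (simp_all add: d_def add_pos_nonneg)
  have e0: "0 \<le> e" using d by (simp add: e d_def)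
  have \<theta>: "0 \<le> \<theta>" "\<theta> \<le> 1"
    using \<kappa>0 e0 d by (simp_all add: \<theta>_def e d_def[symmetric] field_simps)
  have "(1 + \<beta>) * K\<^sup>2 = r * \<kappa>\<^sup>2"
    using r beta by (simp add: \<kappa> power_mult_distrib)
  then have "(1 + \<beta>) * K\<^sup>2 * e\<^sup>2 = r * \<theta>\<^sup>2" by (simp add: \<theta>_def power_mult_distrib)
  also have "\<dots> \<le> r * \<theta>"
    using r \<theta> by (simp add: power2_eq_square mult_left_le)
  finally have 1: "(1 + \<beta>) * K\<^sup>2 * e\<^sup>2 \<le> r * \<theta>" .
  have "alpha k * real k \<le> 2" by (simp add: alpha_def field_simps)
  then have "L * (alpha k * real k) \<le> L * 2" using L by (intro mult_left_mono) auto
  also have "\<dots> \<le> r * M" using M r by (simp add: field_simps)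
  finally have "L * (alpha k * real k) / d \<le> r * M / d" using d by (intro divide_right_mono) auto
  also have "M / d = 1 - \<theta>"
  proof -
    have "M = d - \<kappa> * real k" by (simp add: d_def)
    then show ?thesis using d by (simp add: \<theta>_def e d_def[symmetric] diff_divide_distrib)
  qed
  then have "r * M / d = r * (1 - \<theta>)" by (metis times_divide_eq_right)
  finally have "L * alpha k * e \<le> r * (1 - \<theta>)"
    by (simp add: e d_def[symmetric] mult.assoc)
  with 1 show ?thesis by (simp add: right_diff_distrib)
qed

text \<open>Each term of the epoch length controls one contribution: sqrt (L / \<mu>) the bound 2 L
  / r, K / \<mu> the part \<kappa> N, and the noise term the other branch of the maximum. All are
  compared with \<mu> N (N + 1).\<close>

lemma epoch_length_contraction:
  fixes L K r \<beta> \<mu> \<sigma> \<Gamma> N :: real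
  assumes \<mu>: "0 < \<mu>" and L: "0 < L" and K: "0 \<le> K" and r: "0 < r" "r < 1" and beta: "0 < \<beta>"
    and \<sigma>: "0 \<le> \<sigma>" and \<Gamma>: "0 < \<Gamma>"
    and N: "epoch_const r \<beta> * (sqrt (L / \<mu>) + K / \<mu> + \<sigma>\<^sup>2 / (\<mu>\<^sup>2 * \<Gamma>\<^sup>2)) \<le> N"
    and M: "M = max (2 / r * L) (\<sigma> * sqrt (N * (N + 1)\<^sup>2) / \<Gamma>)" and \<kappa>: "\<kappa> = sqrt ((1 + \<beta>) / r) * K"
  shows "4 * (M + \<kappa> * N) / (\<mu> * N * (N + 1)) \<le> exp (- 1)"
proof -
  define c where "c = epoch_const r \<beta>"
  have c: "1000 \<le> c" "1000 / r \<le> c" "c = 1000 * ((1 + \<beta>) / r)"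
    using r beta by (simp_all add: c_def epoch_const_def field_simps)
  have nn: "0 \<le> sqrt (L / \<mu>)" "0 \<le> K / \<mu>" "0 \<le> \<sigma>\<^sup>2 / (\<mu>\<^sup>2 * \<Gamma>\<^sup>2)" "0 < sqrt (L / \<mu>)"
    using \<mu> L K by auto
  have split: "c * sqrt (L / \<mu>) \<le> N" "c * (K / \<mu>) \<le> N" "c * (\<sigma>\<^sup>2 / (\<mu>\<^sup>2 * \<Gamma>\<^sup>2)) \<le> N"
  proof -
    have le: "c * x \<le> N" if "x \<le> sqrt (L / \<mu>) + K / \<mu> + \<sigma>\<^sup>2 / (\<mu>\<^sup>2 * \<Gamma>\<^sup>2)" for x
      using mult_left_mono[OF that, of c] N c by (simp add: c_def)
    show "c * sqrt (L / \<mu>) \<le> N" "c * (K / \<mu>) \<le> N" "c * (\<sigma>\<^sup>2 / (\<mu>\<^sup>2 * \<Gamma>\<^sup>2)) \<le> N"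
      by (rule le; use nn in linarith)+
  qed
  have N0: "0 < N" using split(1) nn(4) c by (smt (verit) mult_pos_pos)
  have NN: "N\<^sup>2 \<le> N * (N + 1)" using N0 by (simp add: power2_eq_square)
  have "(c * sqrt (L / \<mu>))\<^sup>2 \<le> N\<^sup>2"
    using c(1) nn by (intro power_mono split(1) mult_nonneg_nonneg) linarith+
  then have cL: "c\<^sup>2 * L \<le> \<mu> * N\<^sup>2"
    using \<mu> L by (simp add: power_mult_distrib field_simps)
  \<comment> \<open>One factor c is bounded below by 1000 / r, to dominate the 2 / r of the step
    size, and the other by 1000.\<close>
  have "1000 * (1000 / r) \<le> c * c" using c r by (intro mult_mono) auto
  then have "2 / r * L \<le> (c\<^sup>2 / 500000) * L"
    using L by (intro mult_right_mono) (auto simp: power2_eq_square)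
  also have "\<dots> \<le> \<mu> * N\<^sup>2 / 500000" using cL by simp
  also have "\<dots> \<le> (\<mu> * N\<^sup>2) / 100" using \<mu> by (intro divide_left_mono) auto
  also have "\<dots> \<le> \<mu> * (N * (N + 1)) / 100" using NN \<mu> by (simp add: mult_left_mono)
  finally have 1: "2 / r * L \<le> \<mu> * (N * (N + 1)) / 100" .
  have "1000 * (\<sigma>\<^sup>2 / (\<mu>\<^sup>2 * \<Gamma>\<^sup>2)) \<le> N"
    using split(3) mult_right_mono[OF c(1) nn(3)] by linarith
  then have "1000 * (\<sigma> / \<Gamma>)\<^sup>2 \<le> \<mu>\<^sup>2 * N"
    using \<mu> \<Gamma> by (simp add: field_simps power_divide)
  \<comment> \<open>961 = 31^2 is the largest perfect square below 1000, so the square root gives an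
    integer constant.\<close>
  then have "961 * (\<sigma> / \<Gamma>)\<^sup>2 \<le> \<mu>\<^sup>2 * N"
    using zero_le_power2[of "\<sigma> / \<Gamma>"] by linarith
  then have "(31 * (\<sigma> / \<Gamma>))\<^sup>2 \<le> (\<mu> * sqrt N)\<^sup>2"
    unfolding power_mult_distrib using N0 by simp
  then have "31 * (\<sigma> / \<Gamma>) \<le> \<mu> * sqrt N"
    by (rule power2_le_imp_le) (use \<mu> N0 in auto)
  then have "31 * (\<sigma> / \<Gamma>) * (sqrt N * (N + 1)) \<le> \<mu> * sqrt N * (sqrt N * (N + 1))"
    using N0 by (intro mult_right_mono) auto
  also have "\<dots> = \<mu> * (sqrt N * sqrt N) * (N + 1)" by (simp only: mult_ac)
  also have "\<dots> = \<mu> * (N * (N + 1))" using N0 by simp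
  finally have 2: "\<sigma> * sqrt (N * (N + 1)\<^sup>2) / \<Gamma> \<le> \<mu> * (N * (N + 1)) / 31"
    using N0 by (simp add: real_sqrt_mult mult_ac)
  \<comment> \<open>A number of at least 1 dominates its square root, so the factor (1 + \<beta>) /
    r of \<open>epoch_const\<close> covers the root in \<kappa>.\<close>
  have b: "1 \<le> (1 + \<beta>) / r" using r beta by simp
  then have "sqrt ((1 + \<beta>) / r) \<le> (1 + \<beta>) / r"
    by (intro real_le_lsqrt) (auto intro: self_le_power)
  also have "\<dots> = c / 1000" using c(3) by linarith
  finally have "\<kappa> \<le> c / 1000 * K" unfolding \<kappa> using K by (rule mult_right_mono)
  also have "\<dots> \<le> \<mu> * N / 1000" using split(2) \<mu> by (simp add: field_simps)
  finally have "\<kappa> * N \<le> \<mu> * N / 1000 * N" using N0 by (intro mult_right_mono) auto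
  also have "\<dots> = \<mu> * N\<^sup>2 / 1000" by (simp add: power2_eq_square)
  also have "\<dots> \<le> (\<mu> * N\<^sup>2) / 100" using \<mu> by (intro divide_left_mono) auto
  also have "\<dots> \<le> \<mu> * (N * (N + 1)) / 100" using NN \<mu> by (simp add: mult_left_mono)
  finally have 3: "\<kappa> * N \<le> \<mu> * (N * (N + 1)) / 100" .
  have pos: "0 < \<mu> * (N * (N + 1))" using \<mu> N0 by simp
  define X where "X = \<mu> * (N * (N + 1))"
  note bounds = 1 2 3 pos
  \<comment> \<open>M is at most X / 31 in either branch of the maximum and \<kappa> N at most X /
    100, while 4 / 31 + 4 / 100 < 1 / 3.\<close>
  have "4 * (M + \<kappa> * N) \<le> 1 / 3 * X"
    using bounds unfolding M X_def[symmetric] by (auto simp: max_def)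
  then have "4 * (M + \<kappa> * N) / (\<mu> * (N * (N + 1))) \<le> 1 / 3"
    using pos unfolding X_def by (simp only: pos_divide_le_eq)
  also have "(1::real) / 3 \<le> 1 / exp 1" using exp_le by (intro divide_left_mono) auto
  also have "\<dots> = exp (- 1)" by (simp add: exp_minus inverse_eq_divide)
  finally show ?thesis by (simp add: mult.assoc)
qed

lemma epoch_estimate_sq: "(epoch_estimate \<Gamma>\<^sub>0 s)\<^sup>2 = \<Gamma>\<^sub>0\<^sup>2 * exp (1 - real s)"
  by (simp add: epoch_estimate_def power_mult_distrib exp_double[symmetric])

section \<open>Epochs and restarts\<close>

text \<open>\<open>Init\<close> is dated to epoch 0, before all epochs, which are numbered from
  1.\<close>

primrec draw_time :: "draw \<Rightarrow> nat \<times> nat" where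
  "draw_time Init = (0, 0)"
| "draw_time (Xi s t) = (s, t)"
| "draw_time (Zeta_half s t) = (s, t)"
| "draw_time (Zeta s t) = (s, t)"

text \<open>Lexicographic past. Steps are numbered from 1, so for s >= 1 \<open>past T s 0\<close>
  consists of \<open>Init\<close> and the draws of earlier epochs: what the start of epoch s may
  depend on.\<close>

definition past :: "(nat \<Rightarrow> nat) \<Rightarrow> nat \<Rightarrow> nat \<Rightarrow> draw set" where
  "past T s t = {d \<in> draws T. fst (draw_time d) < s \<or> fst (draw_time d) = s \<and> snd (draw_time d) \<le> t}"

lemma draws_step: "1 \<le> s \<Longrightarrow> t \<in> {1..T s} \<Longrightarrow> {Xi s t, Zeta_half s t, Zeta s t} \<subseteq> draws T"
  by (auto simp: draws_def)

lemma past_subset_draws: "past T s t \<subseteq> draws T"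
  by (auto simp: past_def)

lemma past_Suc:
  "1 \<le> s \<Longrightarrow> Suc t \<le> T s \<Longrightarrow>
   past T s t \<union> {Xi s (Suc t), Zeta_half s (Suc t), Zeta s (Suc t)} \<subseteq> past T s (Suc t)"
  by (auto simp: past_def draws_def)

lemma past_next_epoch: "past T s t \<subseteq> past T (Suc s) 0"
  by (auto simp: past_def)

text \<open>The start is tied to \<open>Init\<close> by measurability only, because the rescaled
  starting point is a function of the drawn pair and not the pair itself.\<close>

locale sampled_saddle = stochastic_saddle f g A w \<mu> L K DX DZ gs as vS vB + P: prob_space P
  for f :: "'v::euclidean_space \<Rightarrow> real" and g A :: "'v \<Rightarrow> 'v" and w :: 'v and \<mu> L K :: real
    and DX :: "'a measure" and DZ :: "'b measure"
    and gs :: "'v \<Rightarrow> 'a \<Rightarrow> 'v" and as :: "'v \<Rightarrow> 'b \<Rightarrow> 'v" and vS vB :: real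
    and P :: "'w measure" +
  fixes E :: "draw \<Rightarrow> 'w set set" and T :: "nat \<Rightarrow> nat" and W0 :: "'w \<Rightarrow> 'v"
    and \<xi> :: "nat \<Rightarrow> nat \<Rightarrow> 'w \<Rightarrow> 'a" and \<zeta>h \<zeta> :: "nat \<Rightarrow> nat \<Rightarrow> 'w \<Rightarrow> 'b"
  assumes indep: "P.indep_sets E (draws T)"
    and stable: "d \<in> draws T \<Longrightarrow> Int_stable (E d)"
    and E_Xi: "1 \<le> s \<Longrightarrow> t \<in> {1..T s} \<Longrightarrow> E (Xi s t) = generated P (\<xi> s t) DX"
    and E_Zeta_half: "1 \<le> s \<Longrightarrow> t \<in> {1..T s} \<Longrightarrow> E (Zeta_half s t) = generated P (\<zeta>h s t) DZ"
    and E_Zeta: "1 \<le> s \<Longrightarrow> t \<in> {1..T s} \<Longrightarrow> E (Zeta s t) = generated P (\<zeta> s t) DZ"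
    and Xi_sample: "1 \<le> s \<Longrightarrow> t \<in> {1..T s} \<Longrightarrow> \<xi> s t \<in> measurable P DX \<and> distr P DX (\<xi> s t) = DX"
    and Zeta_half_sample: "1 \<le> s \<Longrightarrow> t \<in> {1..T s} \<Longrightarrow> \<zeta>h s t \<in> measurable P DZ \<and> distr P DZ (\<zeta>h s t) = DZ"
    and Zeta_sample: "1 \<le> s \<Longrightarrow> t \<in> {1..T s} \<Longrightarrow> \<zeta> s t \<in> measurable P DZ \<and> distr P DZ (\<zeta> s t) = DZ"
    and W0_measurable: "W0 \<in> measurable (joint_algebra P E {Init}) borel"
begin

abbreviation "history \<equiv> joint_algebra P E"

lemma E_subset_Pow: "d \<in> draws T \<Longrightarrow> E d \<subseteq> Pow (space P)"
  using indep sets.space_closed[of P] by (auto simp: P.indep_sets_def)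

lemma history_mono:
  "X \<in> measurable (history I) N \<Longrightarrow> I \<subseteq> J \<Longrightarrow> J \<subseteq> draws T \<Longrightarrow> X \<in> measurable (history J) N"
  by (rule measurable_joint_algebra_mono) (assumption | rule E_subset_Pow | erule (1) subsetD)+

lemma history_sample:
  "d \<in> I \<Longrightarrow> I \<subseteq> draws T \<Longrightarrow> E d = generated P X N \<Longrightarrow> X \<in> measurable P N \<Longrightarrow> X \<in> measurable (history I) N"
  by (rule measurable_joint_algebra_generated) (assumption | rule E_subset_Pow | erule (1) subsetD)+

text \<open>\<open>nn_integral_fresh_sample\<close> is applied three times, to \<open>Zeta\<close>,
  \<open>Zeta_half\<close> and \<open>Xi\<close> in this order. The samples not yet integrated join
  Z in the history, which is why the histories \<open>?I2\<close>, \<open>?I1\<close> and I shrink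
  along the way.\<close>

lemma nn_integral_eg_step:
  assumes s: "1 \<le> s" and t: "t \<in> {1..T s}"
    and I: "I \<subseteq> draws T" "Xi s t \<notin> I" "Zeta_half s t \<notin> I" "Zeta s t \<notin> I"
    and Z: "Z \<in> measurable (history I) borel"
    and \<phi>: "\<phi> \<in> borel_measurable borel"
  shows "(\<integral>\<^sup>+\<omega>. \<phi> (eg_step gs as \<eta> k (Z \<omega>) (\<xi> s t \<omega>) (\<zeta>h s t \<omega>) (\<zeta> s t \<omega>)) \<partial>P)
    = (\<integral>\<^sup>+\<omega>. (\<integral>\<^sup>+x. (\<integral>\<^sup>+z1. (\<integral>\<^sup>+z2. \<phi> (eg_step gs as \<eta> k (Z \<omega>) x z1 z2) \<partial>DZ) \<partial>DZ) \<partial>DX) \<partial>P)"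
proof -
  let ?N1 = "borel \<Otimes>\<^sub>M DX" and ?N2 = "(borel \<Otimes>\<^sub>M DX) \<Otimes>\<^sub>M DZ"
  let ?I1 = "insert (Xi s t) I" and ?I2 = "insert (Zeta_half s t) (insert (Xi s t) I)"
  have dr: "Xi s t \<in> draws T" "Zeta_half s t \<in> draws T" "Zeta s t \<in> draws T"
    using draws_step[of s t T, OF s t] by auto
  have sub: "?I1 \<subseteq> draws T" "?I2 \<subseteq> draws T" using I dr by auto
  define \<phi>3 where "\<phi>3 y z2 = (case y of ((z, x), z1) \<Rightarrow> \<phi> (eg_step gs as \<eta> k z x z1 z2))" for y z2
  define \<phi>2 where "\<phi>2 y z1 = (\<integral>\<^sup>+z2. \<phi>3 (y, z1) z2 \<partial>DZ)" for y z1
  define \<phi>1 where "\<phi>1 z x = (\<integral>\<^sup>+z1. \<phi>2 (z, x) z1 \<partial>DZ)" for z x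
  have m3: "(\<lambda>(y, z2). \<phi>3 y z2) \<in> borel_measurable (?N2 \<Otimes>\<^sub>M DZ)"
    using measurable_compose[OF eg_step_measurable \<phi>, of \<eta> k]
    by (simp add: \<phi>3_def split_beta')
  have "(\<lambda>(y, z1). \<phi>2 y z1) = (\<lambda>y. \<integral>\<^sup>+z2. \<phi>3 y z2 \<partial>DZ)"
    by (auto simp: \<phi>2_def)
  then have m2: "(\<lambda>(y, z1). \<phi>2 y z1) \<in> borel_measurable (?N1 \<Otimes>\<^sub>M DZ)"
    using DZ.borel_measurable_nn_integral[OF m3] by simp
  have "(\<lambda>(z, x). \<phi>1 z x) = (\<lambda>y. \<integral>\<^sup>+z1. \<phi>2 y z1 \<partial>DZ)"
    by (auto simp: \<phi>1_def)
  then have m1: "(\<lambda>(z, x). \<phi>1 z x) \<in> borel_measurable (borel \<Otimes>\<^sub>M DX)"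
    using DZ.borel_measurable_nn_integral[OF m2] by simp
  have X: "\<xi> s t \<in> measurable (history ?I1) DX"
    by (rule history_sample[OF _ sub(1) E_Xi[OF s t]]) (use Xi_sample[OF s t] in auto)
  have Z1: "Z \<in> measurable (history ?I1) borel"
    by (rule history_mono[OF Z _ sub(1)]) auto
  have Y1: "(\<lambda>\<omega>. (Z \<omega>, \<xi> s t \<omega>)) \<in> measurable (history ?I1) ?N1"
    using X Z1 by measurable
  have Y1': "(\<lambda>\<omega>. (Z \<omega>, \<xi> s t \<omega>)) \<in> measurable (history ?I2) ?N1"
    by (rule history_mono[OF Y1 _ sub(2)]) auto
  have ZH: "\<zeta>h s t \<in> measurable (history ?I2) DZ"
    by (rule history_sample[OF _ sub(2) E_Zeta_half[OF s t]]) (use Zeta_half_sample[OF s t] in auto)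
  have Y2: "(\<lambda>\<omega>. ((Z \<omega>, \<xi> s t \<omega>), \<zeta>h s t \<omega>)) \<in> measurable (history ?I2) ?N2"
    using Y1' ZH by measurable
  have "(\<integral>\<^sup>+\<omega>. \<phi> (eg_step gs as \<eta> k (Z \<omega>) (\<xi> s t \<omega>) (\<zeta>h s t \<omega>) (\<zeta> s t \<omega>)) \<partial>P)
     = (\<integral>\<^sup>+\<omega>. \<phi>3 ((Z \<omega>, \<xi> s t \<omega>), \<zeta>h s t \<omega>) (\<zeta> s t \<omega>) \<partial>P)"
    by (simp add: \<phi>3_def)
  also have "\<dots> = (\<integral>\<^sup>+\<omega>. (\<integral>\<^sup>+z2. \<phi>3 ((Z \<omega>, \<xi> s t \<omega>), \<zeta>h s t \<omega>) z2 \<partial>DZ) \<partial>P)"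
    by (rule P.nn_integral_fresh_sample[OF indep stable sub(2) dr(3) _ Y2 E_Zeta[OF s t] _ _ m3])
      (use I Zeta_sample[OF s t] in auto)
  also have "\<dots> = (\<integral>\<^sup>+\<omega>. \<phi>2 (Z \<omega>, \<xi> s t \<omega>) (\<zeta>h s t \<omega>) \<partial>P)"
    by (simp add: \<phi>2_def)
  also have "\<dots> = (\<integral>\<^sup>+\<omega>. (\<integral>\<^sup>+z1. \<phi>2 (Z \<omega>, \<xi> s t \<omega>) z1 \<partial>DZ) \<partial>P)"
    by (rule P.nn_integral_fresh_sample[OF indep stable sub(1) dr(2) _ Y1 E_Zeta_half[OF s t] _ _ m2])
      (use I Zeta_half_sample[OF s t] in auto)
  also have "\<dots> = (\<integral>\<^sup>+\<omega>. \<phi>1 (Z \<omega>) (\<xi> s t \<omega>) \<partial>P)"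
    by (simp add: \<phi>1_def)
  also have "\<dots> = (\<integral>\<^sup>+\<omega>. (\<integral>\<^sup>+x. \<phi>1 (Z \<omega>) x \<partial>DX) \<partial>P)"
    by (rule P.nn_integral_fresh_sample[OF indep stable I(1) dr(1) I(2) Z E_Xi[OF s t] _ _ m1])
      (use Xi_sample[OF s t] in auto)
  also have "\<dots> = (\<integral>\<^sup>+\<omega>. (\<integral>\<^sup>+x. (\<integral>\<^sup>+z1. (\<integral>\<^sup>+z2. \<phi> (eg_step gs as \<eta> k (Z \<omega>) x z1 z2) \<partial>DZ) \<partial>DZ) \<partial>DX) \<partial>P)"
    by (simp add: \<phi>1_def \<phi>2_def \<phi>3_def)
  finally show ?thesis .
qed

section \<open>One epoch: potential and distance\<close>

definition epoch_state :: "(nat \<Rightarrow> real) \<Rightarrow> nat \<Rightarrow> ('w \<Rightarrow> 'v) \<Rightarrow> nat \<Rightarrow> 'w \<Rightarrow> 'v \<times> 'v" where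
  "epoch_state \<eta> s W t \<omega> = eg_iter gs as \<eta> (W \<omega>) (\<lambda>t. \<xi> s t \<omega>) (\<lambda>t. \<zeta>h s t \<omega>) (\<lambda>t. \<zeta> s t \<omega>) t"

lemma epoch_state_measurable:
  assumes s: "1 \<le> s" and W: "W \<in> measurable (history (past T s 0)) borel"
  shows "t \<le> T s \<Longrightarrow> epoch_state \<eta> s W t \<in> measurable (history (past T s t)) borel"
proof (induction t)
  case 0
  have "(\<lambda>\<omega>. (W \<omega>, W \<omega>)) \<in> measurable (history (past T s 0)) (borel \<Otimes>\<^sub>M borel)"
    using W by measurable
  then show ?case by (simp add: epoch_state_def[abs_def] borel_prod)
next
  case (Suc t)
  let ?N = "history (past T s (Suc t))"
  have t: "Suc t \<in> {1..T s}" using Suc.prems by auto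
  note sub = past_Suc[of s t T, OF s Suc.prems] and d = past_subset_draws[of T s "Suc t"]
  have "epoch_state \<eta> s W t \<in> measurable ?N borel"
    using Suc.prems sub by (intro history_mono[OF Suc.IH _ d]) auto
  moreover have "\<xi> s (Suc t) \<in> measurable ?N DX"
    by (rule history_sample[OF _ d E_Xi[OF s t]]) (use sub Xi_sample[OF s t] in auto)
  moreover have "\<zeta>h s (Suc t) \<in> measurable ?N DZ"
    by (rule history_sample[OF _ d E_Zeta_half[OF s t]]) (use sub Zeta_half_sample[OF s t] in auto)
  moreover have "\<zeta> s (Suc t) \<in> measurable ?N DZ"
    by (rule history_sample[OF _ d E_Zeta[OF s t]]) (use sub Zeta_sample[OF s t] in auto)
  ultimately have "(\<lambda>\<omega>. (((epoch_state \<eta> s W t \<omega>, \<xi> s (Suc t) \<omega>), \<zeta>h s (Suc t) \<omega>), \<zeta> s (Suc t) \<omega>))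
      \<in> measurable ?N (((borel \<Otimes>\<^sub>M DX) \<Otimes>\<^sub>M DZ) \<Otimes>\<^sub>M DZ)"
    by measurable
  from measurable_compose[OF this eg_step_measurable[of \<eta> "Suc t"]]
  show ?case by (simp add: epoch_state_def[abs_def])
qed

text \<open>The distances do not telescope, since their weight grows with t. What behaves well is
  the potential divided by M + \<kappa> t: in expectation it rises by at most v k^2 / M^2 at step
  k.\<close>

lemma epoch_potential:
  fixes \<eta> :: "nat \<Rightarrow> real" and M \<kappa> r \<beta> v G :: real
  assumes s: "1 \<le> s" and W: "W \<in> measurable (history (past T s 0)) borel"
    and M: "0 < M" and \<kappa>: "0 \<le> \<kappa>" and r: "0 < r" "r < 1" and beta: "0 < \<beta>"
    and \<eta>: "\<And>k. \<eta> k = k / (M + \<kappa> * k)"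
    and step: "\<And>k. 1 \<le> k \<Longrightarrow> (1 + \<beta>) * K\<^sup>2 * (\<eta> k)\<^sup>2 + L * alpha k * \<eta> k \<le> r"
    and v: "v = vS / (1 - r) + (2 + 1 / \<beta>) * vB"
    and G: "0 \<le> G" "(\<integral>\<^sup>+\<omega>. ennreal ((norm (W \<omega> - w))\<^sup>2) \<partial>P) \<le> ennreal G"
  shows "t \<le> T s \<Longrightarrow> (\<integral>\<^sup>+\<omega>. ennreal (potential t (M + \<kappa> * t) (epoch_state \<eta> s W t \<omega>)) \<partial>P)
    \<le> ennreal ((M + \<kappa> * t) * (G + v / M\<^sup>2 * (\<Sum>k=1..t. (real k)\<^sup>2)))"
proof (induction t)
  case 0
  have [measurable]: "W \<in> borel_measurable P"
    by (rule P.measurable_joint_algebra_imp[OF indep past_subset_draws W])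
  \<comment> \<open>At t = 0 the gap has weight 0, so the start enters through its distance
    alone.\<close>
  have "(\<integral>\<^sup>+\<omega>. ennreal (M * (norm (W \<omega> - w))\<^sup>2) \<partial>P) = ennreal M * (\<integral>\<^sup>+\<omega>. ennreal ((norm (W \<omega> - w))\<^sup>2) \<partial>P)"
    using M by (simp add: ennreal_mult nn_integral_cmult)
  also have "\<dots> \<le> ennreal M * ennreal G" by (rule mult_left_mono[OF G(2)]) simp
  finally show ?case
    using M G by (simp add: potential_def epoch_state_def ennreal_mult)
next
  case (Suc t)
  define k where "k = Suc t"
  define p q where "p = M + \<kappa> * t" and "q = M + \<kappa> * k"
  define c where "c = G + v / M\<^sup>2 * (\<Sum>k=1..t. (real k)\<^sup>2)"
  let ?Z = "epoch_state \<eta> s W t"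
  have v0: "0 \<le> v" using var_nonneg r beta unfolding v by simp
  have c0: "0 \<le> c" using G v0 by (simp add: c_def sum_nonneg)
  have p: "0 < p" using M \<kappa> by (simp add: p_def add_pos_nonneg)
  have pq: "p \<le> q" "M \<le> q" using \<kappa> by (simp_all add: p_def q_def k_def mult_left_mono)
  have k: "k \<in> {1..T s}" "1 \<le> k" using Suc.prems by (auto simp: k_def)
  have Zm: "?Z \<in> measurable (history (past T s t)) borel"
    using Suc.prems by (intro epoch_state_measurable[OF s W]) auto
  have [measurable]: "?Z \<in> measurable P borel"
    by (rule P.measurable_joint_algebra_imp[OF indep past_subset_draws Zm])
  have "(\<integral>\<^sup>+\<omega>. ennreal (potential k q (epoch_state \<eta> s W k \<omega>)) \<partial>P)
    = (\<integral>\<^sup>+\<omega>. (\<integral>\<^sup>+x. (\<integral>\<^sup>+z1. (\<integral>\<^sup>+z2. ennreal (potential k q (eg_step gs as \<eta> k (?Z \<omega>) x z1 z2)) \<partial>DZ) \<partial>DZ) \<partial>DX) \<partial>P)"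
    unfolding epoch_state_def k_def eg_iter.simps
    by (rule nn_integral_eg_step[OF s k(1)[unfolded k_def] past_subset_draws _ _ _ Zm[unfolded epoch_state_def[abs_def]]])
      (auto simp: past_def)
  also have "\<dots> \<le> (\<integral>\<^sup>+\<omega>. ennreal (potential (k - 1) q (?Z \<omega>) + k * \<eta> k * v) \<partial>P)"
    unfolding v
    by (intro nn_integral_mono expected_potential_step[where \<eta> = \<eta> and k = k, OF k(2) _ _ r beta step[OF k(2)]])
      (use p pq in \<open>auto simp: \<eta> q_def\<close>)
  \<comment> \<open>Passing from weight q to the weight p of the induction hypothesis costs the
    factor q / p; the gap tolerates it, being nonnegative with q / p >= 1.\<close>
  also have "\<dots> \<le> (\<integral>\<^sup>+\<omega>. ennreal (q / p) * ennreal (potential t p (?Z \<omega>)) + ennreal (v / M * (real k)\<^sup>2) \<partial>P)"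
  proof (rule nn_integral_mono)
    fix \<omega>
    let ?a = "real t * (real t + 1) * gap (snd (?Z \<omega>))"
    have a0: "0 \<le> ?a" using gap_nonneg by simp
    have "1 * ?a \<le> q / p * ?a"
      using a0 p pq by (intro mult_right_mono) auto
    then have "potential (k - 1) q (?Z \<omega>) \<le> q / p * potential t p (?Z \<omega>)"
      using p unfolding potential_def k_def by (simp add: distrib_left)
    moreover have "k * \<eta> k * v \<le> v / M * (real k)\<^sup>2"
    proof -
      have "k * \<eta> k * v = (v * (real k)\<^sup>2) / q" by (simp add: \<eta> q_def power2_eq_square)
      also have "\<dots> \<le> (v * (real k)\<^sup>2) / M" using v0 M pq by (intro divide_left_mono) auto
      finally show ?thesis by simp
    qed
    ultimately have "ennreal (potential (k - 1) q (?Z \<omega>) + k * \<eta> k * v)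
      \<le> ennreal (q / p * potential t p (?Z \<omega>) + v / M * (real k)\<^sup>2)"
      by (intro ennreal_leI add_mono)
    also have "\<dots> = ennreal (q / p) * ennreal (potential t p (?Z \<omega>)) + ennreal (v / M * (real k)\<^sup>2)"
    proof -
      have "0 \<le> potential t p (?Z \<omega>)" using a0 p by (simp add: potential_def)
      then have "ennreal (q / p * potential t p (?Z \<omega>)) = ennreal (q / p) * ennreal (potential t p (?Z \<omega>))"
        using p pq by (intro ennreal_mult) auto
      then show ?thesis
        using p pq M v0 \<open>0 \<le> potential t p (?Z \<omega>)\<close> by (subst ennreal_plus) auto
    qed
    finally show "ennreal (potential (k - 1) q (?Z \<omega>) + k * \<eta> k * v) \<le> \<dots>" .
  qed
  also have "\<dots> = ennreal (q / p) * (\<integral>\<^sup>+\<omega>. ennreal (potential t p (?Z \<omega>)) \<partial>P) + ennreal (v / M * (real k)\<^sup>2)"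
    by (subst nn_integral_add) (auto simp: nn_integral_cmult P.emeasure_space_1)
  also have "\<dots> \<le> ennreal (q / p) * ennreal (p * c) + ennreal (v / M * (real k)\<^sup>2)"
    using Suc by (intro add_right_mono mult_left_mono) (auto simp: p_def c_def)
  also have "\<dots> = ennreal (q * c + v / M * (real k)\<^sup>2)"
    using p pq c0 v0 M by (simp add: ennreal_mult[symmetric] ennreal_plus[symmetric] del: ennreal_plus)
  \<comment> \<open>M <= q puts the common factor q in front of the new noise term as well,
    restoring the shape of the bound.\<close>
  also have "\<dots> \<le> ennreal (q * (c + v / M\<^sup>2 * (real k)\<^sup>2))"
  proof (rule ennreal_leI)
    have "v / M * (real k)\<^sup>2 = M * (v / M\<^sup>2 * (real k)\<^sup>2)"
      using M by (simp add: power2_eq_square)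
    also have "\<dots> \<le> q * (v / M\<^sup>2 * (real k)\<^sup>2)"
      using v0 pq by (intro mult_right_mono) auto
    finally show "q * c + v / M * (real k)\<^sup>2 \<le> q * (c + v / M\<^sup>2 * (real k)\<^sup>2)"
      by (simp add: distrib_left)
  qed
  also have "c + v / M\<^sup>2 * (real k)\<^sup>2 = G + v / M\<^sup>2 * (\<Sum>k=1..Suc t. (real k)\<^sup>2)"
    unfolding c_def k_def by (simp add: distrib_left)
  finally show ?case unfolding k_def q_def .
qed

text \<open>The 4 is 2 times 2: the noise is at most another \<Gamma>^2, and \<open>gap_ge\<close>
  loses 2 / \<mu> when the gap is traded for the distance.\<close>

lemma epoch_distance:
  fixes \<eta> :: "nat \<Rightarrow> real" and M \<kappa> r \<beta> \<sigma> \<Gamma> :: real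
  assumes s: "1 \<le> s" and W: "W \<in> measurable (history (past T s 0)) borel"
    and M: "0 < M" and \<kappa>: "0 \<le> \<kappa>" and r: "0 < r" "r < 1" and beta: "0 < \<beta>"
    and \<eta>: "\<And>k. \<eta> k = k / (M + \<kappa> * k)"
    and step: "\<And>k. 1 \<le> k \<Longrightarrow> (1 + \<beta>) * K\<^sup>2 * (\<eta> k)\<^sup>2 + L * alpha k * \<eta> k \<le> r"
    and v: "3 * \<sigma>\<^sup>2 = vS / (1 - r) + (2 + 1 / \<beta>) * vB" and \<sigma>: "0 \<le> \<sigma>"
    and \<Gamma>: "0 < \<Gamma>" "(\<integral>\<^sup>+\<omega>. ennreal ((norm (W \<omega> - w))\<^sup>2) \<partial>P) \<le> ennreal (\<Gamma>\<^sup>2)"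
    and N: "N = real (T s)" "1 \<le> T s" and MN: "\<sigma> * sqrt (N * (N + 1)\<^sup>2) / \<Gamma> \<le> M"
  shows "(\<integral>\<^sup>+\<omega>. ennreal ((norm (snd (epoch_state \<eta> s W (T s) \<omega>) - w))\<^sup>2) \<partial>P)
    \<le> ennreal (4 * (M + \<kappa> * N) / (\<mu> * N * (N + 1)) * \<Gamma>\<^sup>2)"
proof -
  let ?Z = "epoch_state \<eta> s W (T s)"
  let ?S = "\<Sum>k=1..T s. (real k)\<^sup>2"
  have Zm: "?Z \<in> measurable (history (past T s (T s))) borel"
    by (rule epoch_state_measurable[OF s W]) auto
  have "?Z \<in> measurable P (borel \<Otimes>\<^sub>M borel)"
    unfolding borel_prod by (rule P.measurable_joint_algebra_imp[OF indep past_subset_draws Zm])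
  then have [measurable]: "(\<lambda>\<omega>. snd (?Z \<omega>)) \<in> borel_measurable P" by measurable
  have N1: "1 \<le> N" using N by simp
  \<comment> \<open>The factor 3 matches the 3 \<sigma>^2 in the noise; this inequality is the
    reason for 1 / sqrt 3 in \<open>noise_level\<close> and for N (N + 1)^2 in the step
    size.\<close>
  have S: "3 * ?S \<le> N * (N + 1)\<^sup>2"
  proof -
    have "6 * (\<Sum>k=1..n. (real k)\<^sup>2) = real n * (real n + 1) * (2 * real n + 1)" for n
      by (induction n) (simp_all add: power2_eq_square algebra_simps)
    from this[of "T s"] have "3 * ?S = N * (N + 1) * (2 * N + 1) / 2" by (simp add: N)
    also have "\<dots> \<le> N * (N + 1) * (N + 1)" using N1 by (simp add: field_simps)
    finally show ?thesis by (simp add: power2_eq_square mult.assoc)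
  qed
  have "\<sigma> * sqrt (N * (N + 1)\<^sup>2) \<le> M * \<Gamma>" using MN \<Gamma> by (simp add: field_simps)
  then have "(\<sigma> * sqrt (N * (N + 1)\<^sup>2))\<^sup>2 \<le> (M * \<Gamma>)\<^sup>2"
    using \<sigma> N1 by (intro power_mono) auto
  then have MG: "\<sigma>\<^sup>2 * (N * (N + 1)\<^sup>2) \<le> M\<^sup>2 * \<Gamma>\<^sup>2"
    using N1 by (simp add: power_mult_distrib)
  have "\<sigma>\<^sup>2 * (3 * ?S) \<le> \<sigma>\<^sup>2 * (N * (N + 1)\<^sup>2)" by (rule mult_left_mono[OF S]) simp
  with MG have "3 * \<sigma>\<^sup>2 * ?S \<le> M\<^sup>2 * \<Gamma>\<^sup>2" by (simp add: mult_ac)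
  then have noise: "3 * \<sigma>\<^sup>2 / M\<^sup>2 * ?S \<le> \<Gamma>\<^sup>2" using M by (simp add: field_simps)
  let ?c = "\<mu> / 2 * (N * (N + 1))"
  have c: "0 < ?c" using mu_pos N1 by simp
  have "ennreal ?c * (\<integral>\<^sup>+\<omega>. ennreal ((norm (snd (?Z \<omega>) - w))\<^sup>2) \<partial>P)
    = (\<integral>\<^sup>+\<omega>. ennreal (?c * (norm (snd (?Z \<omega>) - w))\<^sup>2) \<partial>P)"
  proof -
    have "ennreal (?c * y\<^sup>2) = ennreal ?c * ennreal (y\<^sup>2)" for y
      using c by (intro ennreal_mult) auto
    then show ?thesis by (simp only:) (subst nn_integral_cmult, auto)
  qed
  also have "\<dots> \<le> (\<integral>\<^sup>+\<omega>. ennreal (potential (T s) (M + \<kappa> * T s) (?Z \<omega>)) \<partial>P)"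
  proof (intro nn_integral_mono ennreal_leI)
    fix \<omega>
    have "N * (N + 1) * (\<mu> / 2 * (norm (snd (?Z \<omega>) - w))\<^sup>2) \<le> N * (N + 1) * gap (snd (?Z \<omega>))"
      using N1 by (intro mult_left_mono gap_ge) auto
    moreover have "0 \<le> (M + \<kappa> * T s) * (norm (fst (?Z \<omega>) - w))\<^sup>2"
      using M \<kappa> by simp
    ultimately show "?c * (norm (snd (?Z \<omega>) - w))\<^sup>2 \<le> potential (T s) (M + \<kappa> * T s) (?Z \<omega>)"
      unfolding potential_def N(1)[symmetric] by (simp add: mult_ac)
  qed
  also have "\<dots> \<le> ennreal ((M + \<kappa> * T s) * (\<Gamma>\<^sup>2 + 3 * \<sigma>\<^sup>2 / M\<^sup>2 * ?S))"
    by (rule epoch_potential[OF s W M \<kappa> r beta \<eta> step v _ \<Gamma>(2)]) auto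
  also have "\<dots> \<le> ennreal ((M + \<kappa> * N) * (2 * \<Gamma>\<^sup>2))"
    using noise M \<kappa> N1 unfolding N(1)[symmetric] by (intro ennreal_leI mult_left_mono) auto
  finally have le: "ennreal ?c * (\<integral>\<^sup>+\<omega>. ennreal ((norm (snd (?Z \<omega>) - w))\<^sup>2) \<partial>P)
    \<le> ennreal ((M + \<kappa> * N) * (2 * \<Gamma>\<^sup>2))" .
  have "x = ennreal (1 / a) * (ennreal a * x)" if "0 < a" for a x
    using that by (simp add: mult.assoc[symmetric] ennreal_mult[symmetric])
  from this[OF c] have "(\<integral>\<^sup>+\<omega>. ennreal ((norm (snd (?Z \<omega>) - w))\<^sup>2) \<partial>P)
    = ennreal (1 / ?c) * (ennreal ?c * (\<integral>\<^sup>+\<omega>. ennreal ((norm (snd (?Z \<omega>) - w))\<^sup>2) \<partial>P))" .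
  also have "\<dots> \<le> ennreal (1 / ?c) * ennreal ((M + \<kappa> * N) * (2 * \<Gamma>\<^sup>2))"
    by (rule mult_left_mono[OF le]) simp
  also have "\<dots> = ennreal (1 / ?c * ((M + \<kappa> * N) * (2 * \<Gamma>\<^sup>2)))"
    using c M \<kappa> N1 by (subst ennreal_mult) auto
  also have "1 / ?c * ((M + \<kappa> * N) * (2 * \<Gamma>\<^sup>2)) = 4 * (M + \<kappa> * N) / (\<mu> * N * (N + 1)) * \<Gamma>\<^sup>2"
    using mu_pos N1 by (simp add: field_simps)
  finally show ?thesis .
qed

section \<open>Chaining the epochs\<close>

definition restart_point :: "(nat \<Rightarrow> nat \<Rightarrow> real) \<Rightarrow> nat \<Rightarrow> 'w \<Rightarrow> 'v" where
  "restart_point \<eta> S \<omega> = eg_restarted gs as \<eta> T (W0 \<omega>) (\<lambda>s t. \<xi> s t \<omega>) (\<lambda>s t. \<zeta>h s t \<omega>) (\<lambda>s t. \<zeta> s t \<omega>) S"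

lemma restart_point_Suc: "restart_point \<eta> (Suc S) \<omega> = snd (epoch_state (\<eta> (Suc S)) (Suc S) (restart_point \<eta> S) (T (Suc S)) \<omega>)"
  by (simp add: restart_point_def epoch_state_def)

lemma restart_point_measurable: "restart_point \<eta> S \<in> measurable (history (past T (Suc S) 0)) borel"
proof (induction S)
  case 0
  have "W0 \<in> measurable (history (past T (Suc 0) 0)) borel"
    by (rule history_mono[OF W0_measurable _ past_subset_draws]) (auto simp: past_def draws_def)
  then show ?case by (simp add: restart_point_def[abs_def])
next
  case (Suc S)
  have "epoch_state (\<eta> (Suc S)) (Suc S) (restart_point \<eta> S) (T (Suc S))
      \<in> measurable (history (past T (Suc S) (T (Suc S)))) (borel \<Otimes>\<^sub>M borel)"
    unfolding borel_prod by (rule epoch_state_measurable[OF _ Suc]) auto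
  then have "restart_point \<eta> (Suc S) \<in> measurable (history (past T (Suc S) (T (Suc S)))) borel"
    unfolding restart_point_Suc[abs_def] by measurable
  then show ?case
    by (rule history_mono[OF _ past_next_epoch past_subset_draws])
qed

text \<open>The induction keeps the estimate in use valid: the bound after S epochs is the square of
  \<open>epoch_estimate\<close> for epoch S + 1, which is what the step sizes of that epoch take for
  granted.\<close>

lemma restart_point_distance:
  fixes r \<beta> \<sigma> \<Gamma>\<^sub>0 :: real
  assumes r: "0 < r" "r < 1" and beta: "0 < \<beta>"
    and v: "3 * \<sigma>\<^sup>2 = vS / (1 - r) + (2 + 1 / \<beta>) * vB" and \<sigma>: "0 \<le> \<sigma>"
    and \<eta>: "\<eta> = (\<lambda>s. stepsize r \<beta> L K \<sigma> (epoch_estimate \<Gamma>\<^sub>0 s) (T s))"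
    and \<Gamma>\<^sub>0: "0 < \<Gamma>\<^sub>0" "(\<integral>\<^sup>+\<omega>. ennreal ((norm (W0 \<omega> - w))\<^sup>2) \<partial>P) \<le> ennreal (\<Gamma>\<^sub>0\<^sup>2)"
    and epochs: "\<And>s. 1 \<le> s \<Longrightarrow> epoch_const r \<beta> * epoch_scale L K \<mu> \<sigma> \<Gamma>\<^sub>0 s \<le> real (T s)"
  shows "(\<integral>\<^sup>+\<omega>. ennreal ((norm (restart_point \<eta> S \<omega> - w))\<^sup>2) \<partial>P) \<le> ennreal (\<Gamma>\<^sub>0\<^sup>2 * exp (- real S))"
proof (induction S)
  case 0
  then show ?case using \<Gamma>\<^sub>0 by (simp add: restart_point_def)
next
  case (Suc S)
  define s where "s = Suc S"
  define \<Gamma> where "\<Gamma> = epoch_estimate \<Gamma>\<^sub>0 s"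
  define N where "N = real (T s)"
  define M where "M = max (2 / r * L) (\<sigma> * sqrt (N * (N + 1)\<^sup>2) / \<Gamma>)"
  define \<kappa> where "\<kappa> = sqrt ((1 + \<beta>) / r) * K"
  have s: "1 \<le> s" by (simp add: s_def)
  have \<Gamma>: "0 < \<Gamma>" using \<Gamma>\<^sub>0 by (simp add: \<Gamma>_def epoch_estimate_def)
  have \<Gamma>2: "\<Gamma>\<^sup>2 = \<Gamma>\<^sub>0\<^sup>2 * exp (1 - real s)" by (simp add: \<Gamma>_def epoch_estimate_sq)
  have IH: "(\<integral>\<^sup>+\<omega>. ennreal ((norm (restart_point \<eta> S \<omega> - w))\<^sup>2) \<partial>P) \<le> ennreal (\<Gamma>\<^sup>2)"
    using Suc by (simp add: \<Gamma>2 s_def)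
  have N: "epoch_const r \<beta> * (sqrt (L / \<mu>) + K / \<mu> + \<sigma>\<^sup>2 / (\<mu>\<^sup>2 * \<Gamma>\<^sup>2)) \<le> N"
    using epochs[OF s] by (simp add: epoch_scale_def \<Gamma>2 N_def mult.assoc)
  have "0 < epoch_const r \<beta> * (sqrt (L / \<mu>) + K / \<mu> + \<sigma>\<^sup>2 / (\<mu>\<^sup>2 * \<Gamma>\<^sup>2))"
    using r beta mu_pos L_pos K_nonneg
    by (intro mult_pos_pos add_pos_nonneg) (auto simp: epoch_const_def)
  \<comment> \<open>A positive real lower bound forces the natural number T s to be at least
    1.\<close>
  then have T1: "1 \<le> T s" using N by (simp add: N_def)
  have "0 < 2 / r * L" using r L_pos by simp
  then have M: "0 < M" by (simp add: M_def less_max_iff_disj)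
  have \<kappa>0: "0 \<le> \<kappa>" using r beta K_nonneg by (simp add: \<kappa>_def)
  have \<eta>s: "\<eta> s k = k / (M + \<kappa> * k)" for k
    by (simp add: \<eta> stepsize_def M_def \<kappa>_def N_def \<Gamma>_def)
  have "(\<integral>\<^sup>+\<omega>. ennreal ((norm (restart_point \<eta> s \<omega> - w))\<^sup>2) \<partial>P)
     \<le> ennreal (4 * (M + \<kappa> * N) / (\<mu> * N * (N + 1)) * \<Gamma>\<^sup>2)"
    unfolding s_def restart_point_Suc
  proof (rule epoch_distance[OF _ _ M \<kappa>0 r beta _ _ v \<sigma> \<Gamma> IH])
    show "1 \<le> Suc S" by simp
    show "restart_point \<eta> S \<in> measurable (history (past T (Suc S) 0)) borel" by (rule restart_point_measurable)
    show "\<eta> (Suc S) k = k / (M + \<kappa> * k)" for k using \<eta>s by (simp add: s_def)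
    show "(1 + \<beta>) * K\<^sup>2 * (\<eta> (Suc S) k)\<^sup>2 + L * alpha k * \<eta> (Suc S) k \<le> r" for k
      by (rule stepsize_condition[OF L_pos K_nonneg r(1) beta _ \<kappa>_def \<eta>s[unfolded s_def]]) (simp add: M_def)
    show "N = real (T (Suc S))" "1 \<le> T (Suc S)" using T1 by (simp_all add: N_def s_def)
    show "\<sigma> * sqrt (N * (N + 1)\<^sup>2) / \<Gamma> \<le> M" by (simp add: M_def)
  qed
  also have "\<dots> \<le> ennreal (exp (- 1) * \<Gamma>\<^sup>2)"
    by (intro ennreal_leI mult_right_mono
        epoch_length_contraction[OF mu_pos L_pos K_nonneg r beta \<sigma> \<Gamma> N M_def \<kappa>_def]) simp
  also have "exp (- 1) * \<Gamma>\<^sup>2 = \<Gamma>\<^sub>0\<^sup>2 * exp (- real s)"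
    by (simp add: \<Gamma>2 mult_exp_exp)
  finally show ?case by (simp add: s_def)
qed

end

section \<open>Rescaling the dual variable\<close>

text \<open>Both bounds are tested on a unit vector. Positivity of the smoothness constants is
  obtained in this way from that of the strong convexity constants.\<close>

lemma smooth_strongly_convex_le:
  fixes f :: "real^'k \<Rightarrow> real"
  assumes "smooth_strongly_convex L \<mu> f"
  shows "\<mu> \<le> L"
proof -
  obtain v :: "real^'k" where v: "norm v = 1" using vector_choose_size[of 1] by auto
  have "\<mu> / 2 * (norm (v - 0))\<^sup>2 \<le> L / 2 * (norm (v - 0))\<^sup>2"
    using assms unfolding smooth_strongly_convex_def by (meson order_trans)
  then show ?thesis using v by simp
qed

lemma smooth_strongly_convex_measurable:
  assumes "smooth_strongly_convex L \<mu> f"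
  shows "f \<in> borel_measurable borel"
  using assms unfolding smooth_strongly_convex_def
  by (intro borel_measurable_continuous_onI continuous_at_imp_continuous_on)
    (auto intro: differentiable_imp_continuous_within)

lemma grad_coupling_x: "grad (\<lambda>x. bilinear_coupling B ux uy x y) x = B *v y - ux"
proof -
  have "(\<lambda>x. bilinear_coupling B ux uy x y) = (\<lambda>x. x \<bullet> (B *v y - ux) + uy \<bullet> y)"
    by (auto simp: bilinear_coupling_def inner_diff_right)
  then show ?thesis by (simp only: grad_affine)
qed

lemma grad_coupling_y: "grad (\<lambda>y. bilinear_coupling B ux uy x y) y = transpose B *v x + uy"
proof -
  have "x \<bullet> (B *v y) = y \<bullet> (transpose B *v x)" for y
    by (metis dot_lmul_matrix inner_commute transpose_matrix_vector)
  then have "(\<lambda>y. bilinear_coupling B ux uy x y) = (\<lambda>y. y \<bullet> (transpose B *v x + uy) + - (x \<bullet> ux))"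
    by (auto simp: bilinear_coupling_def inner_add_right inner_commute)
  then show ?thesis by (simp only: grad_affine)
qed

text \<open>Optimality in each variable, with the upper smoothness bound at the saddle point, bounds
  a linear function of the perturbation d from below by a multiple of - |d|^2.\<close>

lemma saddle_point_stationary:
  fixes B :: "real^'m^'n"
  assumes F: "smooth_strongly_convex L\<^sub>F \<mu>\<^sub>F F" and G: "smooth_strongly_convex L\<^sub>G \<mu>\<^sub>G G"
    and saddle: "saddle_point (\<lambda>x y. F x + bilinear_coupling B ux uy x y - G y) wx wy"
  shows "grad F wx + (B *v wy - ux) = 0" and "grad G wy - (transpose B *v wx + uy) = 0"
proof -
  show "grad F wx + (B *v wy - ux) = 0"
  proof (rule vector_eq_0_if_quadratic_bound)
    fix d
    have "F wx + bilinear_coupling B ux uy wx wy \<le> F (wx + d) + bilinear_coupling B ux uy (wx + d) wy"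
      using saddle by (simp add: saddle_point_def)
    moreover have "F (wx + d) - F wx - grad F wx \<bullet> (wx + d - wx) \<le> L\<^sub>F / 2 * (norm (wx + d - wx))\<^sup>2"
      using F by (simp only: smooth_strongly_convex_def)
    ultimately show "0 \<le> (grad F wx + (B *v wy - ux)) \<bullet> d + L\<^sub>F / 2 * (norm d)\<^sup>2"
      by (simp add: bilinear_coupling_def inner_add_left inner_diff_left inner_commute[of d])
  qed
  show "grad G wy - (transpose B *v wx + uy) = 0"
  proof (rule vector_eq_0_if_quadratic_bound)
    fix d
    have "bilinear_coupling B ux uy wx (wy + d) - G (wy + d) \<le> bilinear_coupling B ux uy wx wy - G wy"
      using saddle by (simp add: saddle_point_def)
    moreover have "G (wy + d) - G wy - grad G wy \<bullet> (wy + d - wy) \<le> L\<^sub>G / 2 * (norm (wy + d - wy))\<^sup>2"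
      using G by (simp only: smooth_strongly_convex_def)
    moreover have "(transpose B *v wx) \<bullet> d = wx \<bullet> (B *v d)"
      by (metis dot_lmul_matrix transpose_matrix_vector)
    ultimately show "0 \<le> (grad G wy - (transpose B *v wx + uy)) \<bullet> d + L\<^sub>G / 2 * (norm d)\<^sup>2"
      by (simp add: bilinear_coupling_def inner_add_left inner_diff_left inner_add_right matrix_vector_right_distrib)
  qed
qed

lemma norm_sq_prod: "(norm z)\<^sup>2 = (norm (fst z))\<^sup>2 + (norm (snd z))\<^sup>2"
  by (simp add: norm_prod_def)

text \<open>The weight \<open>\<R>\<close> on the dual variable is absorbed by the rescaling \<open>y \<mapsto> \<surd>\<R> y\<close>; the two
  definitions below express the gradients in the rescaled coordinates, with \<open>\<rho> = \<surd>\<R>\<close>.\<close>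

definition scaled_grad :: "real \<Rightarrow> ('x::real_vector \<Rightarrow> 'x) \<Rightarrow> ('y::real_vector \<Rightarrow> 'y) \<Rightarrow> 'x \<times> 'y \<Rightarrow> 'x \<times> 'y" where
  "scaled_grad \<rho> gF gG z = (gF (fst z), (1 / \<rho>) *\<^sub>R gG ((1 / \<rho>) *\<^sub>R snd z))"

definition scaled_coupling :: "real \<Rightarrow> ('x::real_vector \<Rightarrow> 'y::real_vector \<Rightarrow> 'x) \<Rightarrow> ('x \<Rightarrow> 'y \<Rightarrow> 'y) \<Rightarrow> 'x \<times> 'y \<Rightarrow> 'x \<times> 'y" where
  "scaled_coupling \<rho> hx hy z =
     (hx (fst z) ((1 / \<rho>) *\<^sub>R snd z), - ((1 / \<rho>) *\<^sub>R hy (fst z) ((1 / \<rho>) *\<^sub>R snd z)))"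

text \<open>The rescaling divides the constants of G by R = \<rho>^2 and B by \<rho>. Both strong
  convexity constants then equal \<open>\<mu>\<^sub>F\<close>, and the smoothness and Lipschitz
  constants become the given maximum and root.\<close>

lemma bilinear_saddle_scaled:
  fixes B :: "real^'m^'n" and F :: "real^'n \<Rightarrow> real" and G :: "real^'m \<Rightarrow> real"
  assumes mu: "0 < \<mu>\<^sub>F" "0 < \<mu>\<^sub>G"
    and F: "smooth_strongly_convex L\<^sub>F \<mu>\<^sub>F F" and G: "smooth_strongly_convex L\<^sub>G \<mu>\<^sub>G G"
    and saddle: "saddle_point (\<lambda>x y. F x + bilinear_coupling B ux uy x y - G y) wx wy"
    and \<rho>: "\<rho> = sqrt (\<mu>\<^sub>G / \<mu>\<^sub>F)"
  shows "bilinear_saddle (\<lambda>z. F (fst z) + G ((1 / \<rho>) *\<^sub>R snd z))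
     (scaled_grad \<rho> (grad F) (grad G))
     (scaled_coupling \<rho> (\<lambda>x y. B *v y - ux) (\<lambda>x y. transpose B *v x + uy))
     (wx, \<rho> *\<^sub>R wy) \<mu>\<^sub>F (max L\<^sub>F (\<mu>\<^sub>F / \<mu>\<^sub>G * L\<^sub>G)) (sqrt (lambda_max (transpose B ** B) * (\<mu>\<^sub>F / \<mu>\<^sub>G)))"
    (is "bilinear_saddle ?f ?g ?A ?w _ ?L ?K")
proof -
  have \<rho>0: "0 < \<rho>" using mu by (simp add: \<rho>)
  have \<rho>2: "\<rho>\<^sup>2 = \<mu>\<^sub>G / \<mu>\<^sub>F" using mu by (simp add: \<rho>)
  have snd_norm: "(norm (snd d))\<^sup>2 = \<mu>\<^sub>G / \<mu>\<^sub>F * (norm ((1 / \<rho>) *\<^sub>R snd d))\<^sup>2" for d :: "(real^'n) \<times> (real^'m)"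
    using \<rho>0 mu by (simp add: power_divide \<rho>2[symmetric])
  have L: "L\<^sub>F \<le> ?L" "L\<^sub>G \<le> ?L * (\<mu>\<^sub>G / \<mu>\<^sub>F)"
  proof -
    have "L\<^sub>G = (\<mu>\<^sub>F / \<mu>\<^sub>G * L\<^sub>G) * (\<mu>\<^sub>G / \<mu>\<^sub>F)" using mu by simp
    also have "\<dots> \<le> ?L * (\<mu>\<^sub>G / \<mu>\<^sub>F)" using mu by (intro mult_right_mono) auto
    finally show "L\<^sub>G \<le> ?L * (\<mu>\<^sub>G / \<mu>\<^sub>F)" .
  qed simp
  have inner_g: "?g y \<bullet> (x - y) = grad F (fst y) \<bullet> (fst x - fst y)
      + grad G ((1 / \<rho>) *\<^sub>R snd y) \<bullet> ((1 / \<rho>) *\<^sub>R snd x - (1 / \<rho>) *\<^sub>R snd y)" for x y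
    by (simp add: scaled_grad_def inner_prod_def scaleR_diff_right[symmetric])
  have norm_d: "(norm (x - y))\<^sup>2 = (norm (fst x - fst y))\<^sup>2
      + \<mu>\<^sub>G / \<mu>\<^sub>F * (norm ((1 / \<rho>) *\<^sub>R snd x - (1 / \<rho>) *\<^sub>R snd y))\<^sup>2" for x y :: "(real^'n) \<times> (real^'m)"
    unfolding norm_sq_prod[of "x - y"] snd_norm[of "x - y"] by (simp add: scaleR_diff_right)
  note Fb = F[unfolded smooth_strongly_convex_def, THEN conjunct2, rule_format]
    and Gb = G[unfolded smooth_strongly_convex_def, THEN conjunct2, rule_format]
  have coup: "x \<bullet> (B *v y) = (transpose B *v x) \<bullet> y" for x y
    by (metis dot_lmul_matrix transpose_matrix_vector)
  have A_diff: "?A x - ?A y = (B *v ((1 / \<rho>) *\<^sub>R snd (x - y)), - ((1 / \<rho>) *\<^sub>R (transpose B *v fst (x - y))))" for x y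
    by (simp add: scaled_coupling_def matrix_vector_mult_diff_distrib scaleR_diff_right algebra_simps)
  show ?thesis
  proof
    show "0 < \<mu>\<^sub>F" by (rule mu)
    show "0 < ?L" using mu smooth_strongly_convex_le[OF F] by (simp add: less_max_iff_disj)
    show "0 \<le> ?K" using lambda_max_nonneg[of B] mu by simp
    show "\<mu>\<^sub>F / 2 * (norm (x - y))\<^sup>2 \<le> ?f x - ?f y - ?g y \<bullet> (x - y)" for x y
    proof -
      have "\<mu>\<^sub>F / 2 * (norm (x - y))\<^sup>2 = \<mu>\<^sub>F / 2 * (norm (fst x - fst y))\<^sup>2
          + \<mu>\<^sub>G / 2 * (norm ((1 / \<rho>) *\<^sub>R snd x - (1 / \<rho>) *\<^sub>R snd y))\<^sup>2"
        unfolding norm_d using mu by (simp add: distrib_left)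
      then show ?thesis
        using Fb[of "fst x" "fst y"] Gb[of "(1 / \<rho>) *\<^sub>R snd x" "(1 / \<rho>) *\<^sub>R snd y"]
        unfolding inner_g by linarith
    qed
    show "?f x - ?f y - ?g y \<bullet> (x - y) \<le> ?L / 2 * (norm (x - y))\<^sup>2" for x y
    proof -
      let ?a = "(norm (fst x - fst y))\<^sup>2" and ?b = "(norm ((1 / \<rho>) *\<^sub>R snd x - (1 / \<rho>) *\<^sub>R snd y))\<^sup>2"
      have "L\<^sub>F / 2 * ?a \<le> ?L / 2 * ?a" by (intro mult_right_mono) auto
      moreover have "L\<^sub>G / 2 * ?b \<le> ?L * (\<mu>\<^sub>G / \<mu>\<^sub>F) / 2 * ?b"
        by (intro mult_right_mono divide_right_mono L(2)) auto
      moreover have "?L / 2 * (norm (x - y))\<^sup>2 = ?L / 2 * ?a + ?L * (\<mu>\<^sub>G / \<mu>\<^sub>F) / 2 * ?b"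
      proof -
        have "l / 2 * (a + q * b) = l / 2 * a + l * q / 2 * b" for l a q b :: real
          by (simp add: field_simps)
        then show ?thesis unfolding norm_d .
      qed
      ultimately show ?thesis
        using Fb[of "fst x" "fst y"] Gb[of "(1 / \<rho>) *\<^sub>R snd x" "(1 / \<rho>) *\<^sub>R snd y"]
        unfolding inner_g by linarith
    qed
    \<comment> \<open>B and its transpose meet with opposite signs and the same factor 1 /
      \<rho>.\<close>
    show "(?A x - ?A y) \<bullet> (x - y) = 0" for x y
    proof -
      have "(?A x - ?A y) \<bullet> d = (B *v ((1 / \<rho>) *\<^sub>R snd d)) \<bullet> fst d - (1 / \<rho>) * ((transpose B *v fst d) \<bullet> snd d)"
        if "d = x - y" for d
        unfolding A_diff that[symmetric] by (simp add: inner_prod_def)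
      from this[OF refl] have "(?A x - ?A y) \<bullet> (x - y) = (B *v ((1 / \<rho>) *\<^sub>R snd (x - y))) \<bullet> fst (x - y)
          - (1 / \<rho>) * ((transpose B *v fst (x - y)) \<bullet> snd (x - y))" .
      moreover have "(B *v ((1 / \<rho>) *\<^sub>R snd d)) \<bullet> fst d = (1 / \<rho>) * ((transpose B *v fst d) \<bullet> snd d)" for d
        unfolding coup[symmetric] by (simp add: matrix_vector_mult_scaleR inner_commute)
      from this[of "x - y"] calculation show ?thesis by linarith
    qed
    show "norm (?A x - ?A y) \<le> ?K * norm (x - y)" for x y
    proof (rule power2_le_imp_le)
      let ?l = "lambda_max (transpose B ** B)" and ?d = "x - y"
      have "(norm (?A x - ?A y))\<^sup>2 = (norm (B *v ((1 / \<rho>) *\<^sub>R snd ?d)))\<^sup>2 + (\<mu>\<^sub>F / \<mu>\<^sub>G) * (norm (transpose B *v fst ?d))\<^sup>2"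
        unfolding A_diff norm_sq_prod[of "(_, _)"] fst_conv snd_conv norm_minus_cancel
        using \<rho>2 by (simp add: power_divide power_mult_distrib)
      also have "\<dots> \<le> ?l * (norm ((1 / \<rho>) *\<^sub>R snd ?d))\<^sup>2 + (\<mu>\<^sub>F / \<mu>\<^sub>G) * (?l * (norm (fst ?d))\<^sup>2)"
        using mu by (intro add_mono mult_left_mono norm_matrix_vector_le_lambda_max
            norm_transpose_vector_le_lambda_max) auto
      also have "(norm ((1 / \<rho>) *\<^sub>R snd ?d))\<^sup>2 = (\<mu>\<^sub>F / \<mu>\<^sub>G) * (norm (snd ?d))\<^sup>2"
        unfolding snd_norm using mu by simp
      also have "?l * ((\<mu>\<^sub>F / \<mu>\<^sub>G) * (norm (snd ?d))\<^sup>2) + (\<mu>\<^sub>F / \<mu>\<^sub>G) * (?l * (norm (fst ?d))\<^sup>2)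
          = ?l * (\<mu>\<^sub>F / \<mu>\<^sub>G) * (norm ?d)\<^sup>2"
        unfolding norm_sq_prod[of ?d] by (simp only: distrib_left mult_ac add_ac)
      also have "\<dots> = (?K * norm ?d)\<^sup>2"
        using lambda_max_nonneg[of B] mu by (simp add: power_mult_distrib)
      finally show "(norm (?A x - ?A y))\<^sup>2 \<le> (?K * norm ?d)\<^sup>2" .
      show "0 \<le> ?K * norm ?d" using lambda_max_nonneg[of B] mu by simp
    qed
    show "?g ?w + ?A ?w = 0"
    proof -
      have "(1 / \<rho>) *\<^sub>R (grad G wy - (transpose B *v wx + uy)) = 0"
        unfolding saddle_point_stationary(2)[OF F G saddle] by simp
      then show ?thesis
        using saddle_point_stationary(1)[OF F G saddle] \<rho>0
        by (simp add: scaled_grad_def scaled_coupling_def scaleR_diff_right zero_prod_def)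
    qed
    show "?f \<in> borel_measurable borel"
    proof -
      note [measurable] = smooth_strongly_convex_measurable[OF F] smooth_strongly_convex_measurable[OF G]
      show ?thesis unfolding borel_prod[symmetric] by measurable
    qed
  qed
qed

section \<open>The iteration in rescaled coordinates\<close>

lemma scaled_combination:
  fixes p q :: "'v::real_vector"
  assumes "\<rho> \<noteq> 0"
  shows "(1 / \<rho>) *\<^sub>R (a *\<^sub>R \<rho> *\<^sub>R p + b *\<^sub>R \<rho> *\<^sub>R q) = a *\<^sub>R p + b *\<^sub>R q"
  using assms by (simp add: scaleR_add_right)

text \<open>The 1 / R in the dual step consists of one 1 / \<rho> from the chain rule and one from
  scaling back.\<close>

lemma scaled_descent:
  fixes p q r :: "'v::real_vector"
  assumes "\<rho> \<noteq> 0" "R = \<rho>\<^sup>2"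
  shows "\<rho> *\<^sub>R p - e *\<^sub>R ((1 / \<rho>) *\<^sub>R q + - ((1 / \<rho>) *\<^sub>R r)) = \<rho> *\<^sub>R (p - (e / R) *\<^sub>R (- r + q))"
  using assms by (simp add: power2_eq_square scaleR_diff_right scaleR_add_right)

text \<open>The md components are part of the state of \<open>ag_eg\<close> but recomputed in
  \<open>eg_step\<close>; carrying their formulas in the statement lets the induction match the
  two.\<close>

lemma ag_eg_scaled:
  assumes \<rho>: "\<rho> \<noteq> 0" and R: "R = \<rho>\<^sup>2"
    and "ag_eg gf gg hx hy R \<eta> x0 y0 \<xi> \<zeta>h \<zeta> t = (x, y, xag, yag, xmd, ymd)"
  shows "eg_iter (\<lambda>z a. scaled_grad \<rho> (\<lambda>x. gf x a) (\<lambda>y. gg y a) z)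
       (\<lambda>z b. scaled_coupling \<rho> (\<lambda>x y. hx x y b) (\<lambda>x y. hy x y b) z) \<eta> (x0, \<rho> *\<^sub>R y0) \<xi> \<zeta>h \<zeta> t
     = ((x, \<rho> *\<^sub>R y), (xag, \<rho> *\<^sub>R yag)) \<and>
     xmd = (1 - alpha (t + 1)) *\<^sub>R xag + alpha (t + 1) *\<^sub>R x \<and>
     ymd = (1 - alpha (t + 1)) *\<^sub>R yag + alpha (t + 1) *\<^sub>R y"
  using assms(3)
proof (induction t arbitrary: x y xag yag xmd ymd)
  case 0
  then show ?case by (auto simp: alpha_def)
next
  case (Suc t)
  obtain u v uag vag umd vmd where
    prev: "ag_eg gf gg hx hy R \<eta> x0 y0 \<xi> \<zeta>h \<zeta> t = (u, v, uag, vag, umd, vmd)"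
    using prod_cases6 by blast
  note IH = Suc.IH[OF prev]
  define k a e where "k = Suc t" and "a = alpha (Suc t)" and "e = \<eta> (Suc t)"
  define uh where "uh = u - e *\<^sub>R (gf umd (\<xi> k) + hx u v (\<zeta>h k))"
  define vh where "vh = v - (e / R) *\<^sub>R (- hy u v (\<zeta>h k) + gg vmd (\<xi> k))"
  have step: "x = u - e *\<^sub>R (gf umd (\<xi> k) + hx uh vh (\<zeta> k))"
      "y = v - (e / R) *\<^sub>R (- hy uh vh (\<zeta> k) + gg vmd (\<xi> k))"
      "xag = (1 - a) *\<^sub>R uag + a *\<^sub>R uh" "yag = (1 - a) *\<^sub>R vag + a *\<^sub>R vh"
      "xmd = (1 - alpha (Suc t + 1)) *\<^sub>R xag + alpha (Suc t + 1) *\<^sub>R x"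
      "ymd = (1 - alpha (Suc t + 1)) *\<^sub>R yag + alpha (Suc t + 1) *\<^sub>R y"
    using Suc.prems by (auto simp: prev Let_def uh_def vh_def k_def a_def e_def)
  have md: "scaled_grad \<rho> (\<lambda>x. gf x c) (\<lambda>y. gg y c) ((1 - a) *\<^sub>R (uag, \<rho> *\<^sub>R vag) + a *\<^sub>R (u, \<rho> *\<^sub>R v))
      = (gf umd c, (1 / \<rho>) *\<^sub>R gg vmd c)" for c
    unfolding scaled_grad_def scaleR_Pair add_Pair fst_conv snd_conv scaled_combination[OF \<rho>]
    using IH by (simp add: a_def)
  have cp: "scaled_coupling \<rho> (\<lambda>x y. hx x y c) (\<lambda>x y. hy x y c) (p, \<rho> *\<^sub>R q)
      = (hx p q c, - ((1 / \<rho>) *\<^sub>R hy p q c))" for c p q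
    using \<rho> by (simp add: scaled_coupling_def)
  have ds: "(p, \<rho> *\<^sub>R q) - e *\<^sub>R ((p1, (1 / \<rho>) *\<^sub>R q1) + (p2, - ((1 / \<rho>) *\<^sub>R q2)))
      = (p - e *\<^sub>R (p1 + p2), \<rho> *\<^sub>R (q - (e / R) *\<^sub>R (- q2 + q1)))" for p q p1 p2 q1 q2
    unfolding scaleR_Pair add_Pair diff_Pair scaled_descent[OF \<rho> R] ..
  have "eg_step (\<lambda>z a. scaled_grad \<rho> (\<lambda>x. gf x a) (\<lambda>y. gg y a) z)
       (\<lambda>z b. scaled_coupling \<rho> (\<lambda>x y. hx x y b) (\<lambda>x y. hy x y b) z) \<eta> (Suc t)
       ((u, \<rho> *\<^sub>R v), (uag, \<rho> *\<^sub>R vag)) (\<xi> k) (\<zeta>h k) (\<zeta> k) = ((x, \<rho> *\<^sub>R y), (xag, \<rho> *\<^sub>R yag))"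
    unfolding eg_step_def Let_def fst_conv snd_conv a_def[symmetric] e_def[symmetric] md cp ds
      uh_def[symmetric] vh_def[symmetric] step(1-4)
    by (simp add: scaleR_add_right mult.commute)
  then show ?case
    using IH step(5,6) by (simp add: k_def)
qed

lemma restarted_ag_eg_scaled:
  assumes \<rho>: "\<rho> \<noteq> 0" and R: "R = \<rho>\<^sup>2"
  shows "eg_restarted (\<lambda>z a. scaled_grad \<rho> (\<lambda>x. gf x a) (\<lambda>y. gg y a) z)
       (\<lambda>z b. scaled_coupling \<rho> (\<lambda>x y. hx x y b) (\<lambda>x y. hy x y b) z) \<eta> T (x0, \<rho> *\<^sub>R y0) \<xi> \<zeta>h \<zeta> S
     = (case restarted_ag_eg gf gg hx hy R \<eta> T x0 y0 \<xi> \<zeta>h \<zeta> S of (x, y) \<Rightarrow> (x, \<rho> *\<^sub>R y))"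
proof (induction S)
  case (Suc S)
  obtain x y where xy: "restarted_ag_eg gf gg hx hy R \<eta> T x0 y0 \<xi> \<zeta>h \<zeta> S = (x, y)" by fastforce
  obtain u v uag vag umd vmd where
    ep: "ag_eg gf gg hx hy R (\<eta> (Suc S)) x y (\<xi> (Suc S)) (\<zeta>h (Suc S)) (\<zeta> (Suc S)) (T (Suc S)) = (u, v, uag, vag, umd, vmd)"
    using prod_cases6 by blast
  show ?case
    using Suc ag_eg_scaled[OF \<rho> R ep] by (simp add: xy ep)
qed simp

section \<open>The sampling oracles in rescaled coordinates\<close>

lemma has_bochner_integral_Pair:
  fixes X :: "'a \<Rightarrow> 'b::euclidean_space" and Y :: "'a \<Rightarrow> 'c::euclidean_space"
  assumes "has_bochner_integral M X x" "has_bochner_integral M Y y"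
  shows "has_bochner_integral M (\<lambda>a. (X a, Y a)) (x, y)"
proof -
  have "has_bochner_integral M (\<lambda>a. (X a, 0 :: 'c)) (x, 0)"
    by (rule has_bochner_integral_bounded_linear[OF bounded_linear_Pair[OF bounded_linear_ident bounded_linear_zero] assms(1)])
  moreover have "has_bochner_integral M (\<lambda>a. (0 :: 'b, Y a)) (0, y)"
    by (rule has_bochner_integral_bounded_linear[OF bounded_linear_Pair[OF bounded_linear_zero bounded_linear_ident] assms(2)])
  ultimately show ?thesis
    using has_bochner_integral_add by fastforce
qed

text \<open>The factor 1 / \<rho> on the dual gradient squares to the weight 1 / R of the variance
  assumption, so that assumption carries over with the same constant.\<close>

lemma scaled_grad_oracle:
  fixes gf :: "real^'n \<Rightarrow> 'a \<Rightarrow> real^'n" and gg :: "real^'m \<Rightarrow> 'a \<Rightarrow> real^'m"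
  assumes Str: "stochastic_gradients_Str F G R D gf gg \<sigma>" and \<rho>: "\<rho> \<noteq> 0" "R = \<rho>\<^sup>2"
  shows "(\<lambda>(z, a). scaled_grad \<rho> (\<lambda>x. gf x a) (\<lambda>y. gg y a) z) \<in> borel_measurable (borel \<Otimes>\<^sub>M D)"
    and "has_bochner_integral D (\<lambda>a. scaled_grad \<rho> (\<lambda>x. gf x a) (\<lambda>y. gg y a) z) (scaled_grad \<rho> (grad F) (grad G) z)"
    and "(\<integral>\<^sup>+a. ennreal ((norm (scaled_grad \<rho> (\<lambda>x. gf x a) (\<lambda>y. gg y a) z - scaled_grad \<rho> (grad F) (grad G) z))\<^sup>2) \<partial>D)
      \<le> ennreal (\<sigma>\<^sup>2)"
proof -
  have [measurable]: "(\<lambda>(x, a). gf x a) \<in> borel_measurable (borel \<Otimes>\<^sub>M D)"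
    "(\<lambda>(y, a). gg y a) \<in> borel_measurable (borel \<Otimes>\<^sub>M D)"
    using Str by (simp_all add: stochastic_gradients_Str_def)
  show "(\<lambda>(z, a). scaled_grad \<rho> (\<lambda>x. gf x a) (\<lambda>y. gg y a) z) \<in> borel_measurable (borel \<Otimes>\<^sub>M D)"
    unfolding scaled_grad_def split_beta' borel_prod[symmetric] by measurable
  show "has_bochner_integral D (\<lambda>a. scaled_grad \<rho> (\<lambda>x. gf x a) (\<lambda>y. gg y a) z) (scaled_grad \<rho> (grad F) (grad G) z)"
    unfolding scaled_grad_def
    by (intro has_bochner_integral_Pair has_bochner_integral_scaleR_right)
      (use Str in \<open>auto simp: stochastic_gradients_Str_def\<close>)
  have "(norm (scaled_grad \<rho> (\<lambda>x. gf x a) (\<lambda>y. gg y a) z - scaled_grad \<rho> (grad F) (grad G) z))\<^sup>2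
      = (norm (gf (fst z) a - grad F (fst z)))\<^sup>2
        + 1 / R * (norm (gg ((1 / \<rho>) *\<^sub>R snd z) a - grad G ((1 / \<rho>) *\<^sub>R snd z)))\<^sup>2" for a
    unfolding scaled_grad_def diff_Pair norm_sq_prod[of "(_, _)"] fst_conv snd_conv scaleR_diff_right[symmetric]
    by (simp add: power_mult_distrib power_divide \<rho>(2))
  then show "(\<integral>\<^sup>+a. ennreal ((norm (scaled_grad \<rho> (\<lambda>x. gf x a) (\<lambda>y. gg y a) z - scaled_grad \<rho> (grad F) (grad G) z))\<^sup>2) \<partial>D)
      \<le> ennreal (\<sigma>\<^sup>2)"
    using Str by (simp only: stochastic_gradients_Str_def)
qed

lemma scaled_coupling_oracle:
  fixes hx :: "real^'n \<Rightarrow> real^'m \<Rightarrow> 'b \<Rightarrow> real^'n" and hy :: "real^'n \<Rightarrow> real^'m \<Rightarrow> 'b \<Rightarrow> real^'m"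
  assumes Bil: "stochastic_gradients_Bil H R D hx hy \<sigma>" and \<rho>: "\<rho> \<noteq> 0" "R = \<rho>\<^sup>2"
    and H: "\<And>x y. grad (\<lambda>x. H x y) x = Hx x y" "\<And>x y. grad (\<lambda>y. H x y) y = Hy x y"
  shows "(\<lambda>(z, b). scaled_coupling \<rho> (\<lambda>x y. hx x y b) (\<lambda>x y. hy x y b) z) \<in> borel_measurable (borel \<Otimes>\<^sub>M D)"
    and "has_bochner_integral D (\<lambda>b. scaled_coupling \<rho> (\<lambda>x y. hx x y b) (\<lambda>x y. hy x y b) z) (scaled_coupling \<rho> Hx Hy z)"
    and "(\<integral>\<^sup>+b. ennreal ((norm (scaled_coupling \<rho> (\<lambda>x y. hx x y b) (\<lambda>x y. hy x y b) z - scaled_coupling \<rho> Hx Hy z))\<^sup>2) \<partial>D)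
      \<le> ennreal (\<sigma>\<^sup>2)"
proof -
  note Bil' = Bil[unfolded stochastic_gradients_Bil_def H]
  have mx: "(\<lambda>((x, y), b). hx x y b) \<in> borel_measurable ((borel \<Otimes>\<^sub>M borel) \<Otimes>\<^sub>M D)"
    and my: "(\<lambda>((x, y), b). hy x y b) \<in> borel_measurable ((borel \<Otimes>\<^sub>M borel) \<Otimes>\<^sub>M D)"
    using Bil' by (simp_all add: borel_prod)
  have "(\<lambda>p. ((fst (fst p), (1 / \<rho>) *\<^sub>R snd (fst p)), snd p))
      \<in> measurable (((borel :: (real^'n) measure) \<Otimes>\<^sub>M (borel :: (real^'m) measure)) \<Otimes>\<^sub>M D) ((borel \<Otimes>\<^sub>M borel) \<Otimes>\<^sub>M D)"
    by measurable
  from measurable_compose[OF this mx] measurable_compose[OF this my]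
  have [measurable]: "(\<lambda>p. hx (fst (fst p)) ((1 / \<rho>) *\<^sub>R snd (fst p)) (snd p)) \<in> borel_measurable ((borel \<Otimes>\<^sub>M borel) \<Otimes>\<^sub>M D)"
    "(\<lambda>p. hy (fst (fst p)) ((1 / \<rho>) *\<^sub>R snd (fst p)) (snd p)) \<in> borel_measurable ((borel \<Otimes>\<^sub>M borel) \<Otimes>\<^sub>M D)"
    by simp_all
  show "(\<lambda>(z, b). scaled_coupling \<rho> (\<lambda>x y. hx x y b) (\<lambda>x y. hy x y b) z) \<in> borel_measurable (borel \<Otimes>\<^sub>M D)"
    unfolding scaled_coupling_def split_beta' borel_prod[symmetric] by measurable
  show "has_bochner_integral D (\<lambda>b. scaled_coupling \<rho> (\<lambda>x y. hx x y b) (\<lambda>x y. hy x y b) z) (scaled_coupling \<rho> Hx Hy z)"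
    unfolding scaled_coupling_def
    by (intro has_bochner_integral_Pair has_bochner_integral_minus has_bochner_integral_scaleR_right)
      (use Bil' in auto)
  have "(norm (scaled_coupling \<rho> (\<lambda>x y. hx x y b) (\<lambda>x y. hy x y b) z - scaled_coupling \<rho> Hx Hy z))\<^sup>2
      = (norm (hx (fst z) ((1 / \<rho>) *\<^sub>R snd z) b - Hx (fst z) ((1 / \<rho>) *\<^sub>R snd z)))\<^sup>2
        + 1 / R * (norm (hy (fst z) ((1 / \<rho>) *\<^sub>R snd z) b - Hy (fst z) ((1 / \<rho>) *\<^sub>R snd z)))\<^sup>2" for b
  proof -
    have "norm (- ((1 / \<rho>) *\<^sub>R p) - - ((1 / \<rho>) *\<^sub>R q)) = norm ((1 / \<rho>) *\<^sub>R (p - q))" for p q :: "real^'m"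
      by (metis minus_diff_minus norm_minus_cancel scaleR_diff_right)
    then show ?thesis
      unfolding scaled_coupling_def diff_Pair norm_sq_prod[of "(_, _)"] fst_conv snd_conv
      by (simp add: power_mult_distrib power_divide \<rho>(2))
  qed
  then show "(\<integral>\<^sup>+b. ennreal ((norm (scaled_coupling \<rho> (\<lambda>x y. hx x y b) (\<lambda>x y. hy x y b) z - scaled_coupling \<rho> Hx Hy z))\<^sup>2) \<partial>D)
      \<le> ennreal (\<sigma>\<^sup>2)"
    using Bil' by (simp only:)
qed

section \<open>Iteration complexity\<close>

text \<open>About 2 ln (\<Gamma> / \<epsilon>) epochs suffice. The constant part of the epoch
  lengths is paid once per epoch and yields the logarithm; the exponential part is a geometric
  series dominated by its end, of order \<Gamma>^2 / \<epsilon>^2, hence without a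
  logarithm.\<close>

lemma iteration_complexity_bound:
  fixes T :: "nat \<Rightarrow> nat" and C a b \<Gamma> \<epsilon> :: real
  assumes C: "0 \<le> C" and a: "0 \<le> a" and b: "0 \<le> b" and \<Gamma>: "0 < \<Gamma>" and \<epsilon>: "0 < \<epsilon>"
    and T: "\<And>s. 1 \<le> s \<Longrightarrow> real (T s) \<le> C * (a + b * exp (real s - 1))"
    and err: "\<And>S. err S \<le> ennreal (\<Gamma>\<^sup>2 * exp (- real S))"
  shows "ereal_of_enat (iteration_complexity T err \<epsilon>)
    \<le> ereal (3 * C * (a * max 1 (ln (\<Gamma> / \<epsilon>)) + b * \<Gamma>\<^sup>2 / \<epsilon>\<^sup>2))"
proof -
  define l where "l = ln (\<Gamma> / \<epsilon>)"
  define S where "S = nat \<lceil>2 * l\<rceil>"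
  have l2: "exp (2 * l) = \<Gamma>\<^sup>2 / \<epsilon>\<^sup>2"
    using \<Gamma> \<epsilon> by (simp add: l_def exp_double power_divide)
  have S: "2 * l \<le> real S" unfolding S_def by linarith
  have "exp (- real S) \<le> exp (- (2 * l))" using S by simp
  then have "\<Gamma>\<^sup>2 * exp (- real S) \<le> \<Gamma>\<^sup>2 * exp (- (2 * l))" by (rule mult_left_mono) simp
  also have "\<dots> = \<epsilon>\<^sup>2" using \<Gamma> by (simp add: exp_minus l2)
  finally have "err S \<le> ennreal (\<epsilon>\<^sup>2)"
    using err[of S] by (meson ennreal_leI order_trans)
  then have "iteration_complexity T err \<epsilon> \<le> enat (\<Sum>s=1..S. T s)"
    unfolding iteration_complexity_def by (intro INF_lower) simp
  then have "ereal_of_enat (iteration_complexity T err \<epsilon>) \<le> ereal_of_enat (enat (\<Sum>s=1..S. T s))"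
    by (simp only: ereal_of_enat_le_iff)
  also have "\<dots> = ereal (\<Sum>s=1..S. real (T s))" by simp
  also have "(\<Sum>s=1..S. real (T s)) \<le> 3 * C * (a * max 1 l + b * \<Gamma>\<^sup>2 / \<epsilon>\<^sup>2)"
  \<comment> \<open>S = 0 means that the start is already accurate enough. Otherwise the ceiling is
    positive and \<open>nat\<close> does not truncate, which gives S <= 2 l + 1.\<close>
  proof (cases "S = 0")
    case True
    then show ?thesis using C a b by (simp add: max_def)
  next
    case False
    then have "real S \<le> 2 * l + 1" unfolding S_def by linarith
    then have S3: "real S \<le> 3 * max 1 l" and "exp (real S) \<le> exp 1 * exp (2 * l)"
      by (auto simp: max_def mult_exp_exp)
    note this(2)
    also have "exp 1 * exp (2 * l) \<le> 3 * exp (2 * l)" using exp_le by (intro mult_right_mono) auto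
    finally have eS: "exp (real S) \<le> 3 * (\<Gamma>\<^sup>2 / \<epsilon>\<^sup>2)" by (simp only: l2)
    \<comment> \<open>The induction needs only e >= 2.\<close>
    have geo: "(\<Sum>s=1..n. exp (real s - 1)) \<le> exp (real n)" for n
    proof (induction n)
      case (Suc n)
      have "2 * exp (real n) \<le> exp 1 * exp (real n)"
        using exp_ge_add_one_self[of 1] by (intro mult_right_mono) auto
      then show ?case using Suc by (simp add: mult_exp_exp)
    qed simp
    have "(\<Sum>s=1..S. real (T s)) \<le> (\<Sum>s=1..S. C * (a + b * exp (real s - 1)))"
      by (intro sum_mono T) auto
    also have "\<dots> = C * (a * S + b * (\<Sum>s=1..S. exp (real s - 1)))"
      by (simp add: sum_distrib_left[symmetric] sum.distrib)
    also have "\<dots> \<le> C * (a * (3 * max 1 l) + b * (3 * (\<Gamma>\<^sup>2 / \<epsilon>\<^sup>2)))"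
      using C a b S3 order_trans[OF geo eS] by (intro mult_left_mono add_mono) auto
    finally show ?thesis by (simp add: distrib_left mult_ac)
  qed
  finally show ?thesis by (simp add: l_def)
qed

text \<open>The first bound hides \<open>\<Gamma>\<^sub>0\<close> as the O-notation does and is
  confined to small \<epsilon>; the second displays it and covers all \<epsilon>. The final identity
  equates the two forms of the rate.\<close>

theorem corollary4p3:
  fixes F :: "real^'n \<Rightarrow> real" and G :: "real^'m \<Rightarrow> real"
    and H :: "real^'n \<Rightarrow> real^'m \<Rightarrow> real"
    and B :: "real^'m^'n" and ux wx :: "real^'n" and uy wy :: "real^'m"
    and L\<^sub>F \<mu>\<^sub>F L\<^sub>G \<mu>\<^sub>G L\<^sub>S\<^sub>t\<^sub>r L\<^sub>B\<^sub>i\<^sub>l \<mu>\<^sub>S\<^sub>t\<^sub>r R \<sigma>\<^sub>S\<^sub>t\<^sub>r \<sigma>\<^sub>B\<^sub>i\<^sub>l \<sigma> r \<beta> \<Gamma>\<^sub>0 C :: real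
    and D\<^sub>\<xi> :: "'a measure" and D\<^sub>\<zeta> :: "'b measure"
    and gf :: "real^'n \<Rightarrow> 'a \<Rightarrow> real^'n" and gg :: "real^'m \<Rightarrow> 'a \<Rightarrow> real^'m"
    and hx :: "real^'n \<Rightarrow> real^'m \<Rightarrow> 'b \<Rightarrow> real^'n"
    and hy :: "real^'n \<Rightarrow> real^'m \<Rightarrow> 'b \<Rightarrow> real^'m"
    and M :: "'w measure" and x0 :: "'w \<Rightarrow> real^'n" and y0 :: "'w \<Rightarrow> real^'m"
    and \<xi> :: "nat \<Rightarrow> nat \<Rightarrow> 'w \<Rightarrow> 'a" and \<zeta>h \<zeta> :: "nat \<Rightarrow> nat \<Rightarrow> 'w \<Rightarrow> 'b"
    and T :: "nat \<Rightarrow> nat" and \<eta> :: "nat \<Rightarrow> nat \<Rightarrow> real"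
    and out :: "nat \<Rightarrow> 'w \<Rightarrow> (real^'n) \<times> (real^'m)" and err :: "nat \<Rightarrow> ennreal"
  assumes dims: "CARD('n) \<ge> CARD('m)"
    and mu_pos: "\<mu>\<^sub>F > 0" "\<mu>\<^sub>G > 0"
    and F: "smooth_strongly_convex L\<^sub>F \<mu>\<^sub>F F"
    and G: "smooth_strongly_convex L\<^sub>G \<mu>\<^sub>G G"
    and H: "H = bilinear_coupling B ux uy"
    and L_Str: "L\<^sub>S\<^sub>t\<^sub>r = max L\<^sub>F (\<mu>\<^sub>F / \<mu>\<^sub>G * L\<^sub>G)"
    and L_Bil: "L\<^sub>B\<^sub>i\<^sub>l = sqrt (lambda_max (transpose B ** B) * (\<mu>\<^sub>F / \<mu>\<^sub>G))"
    and mu_Str: "\<mu>\<^sub>S\<^sub>t\<^sub>r = \<mu>\<^sub>F"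
    and R: "R = \<mu>\<^sub>G / \<mu>\<^sub>F"
    and saddle: "saddle_point (\<lambda>x y. F x + H x y - G y) wx wy"
    and Str: "stochastic_gradients_Str F G R D\<^sub>\<xi> gf gg \<sigma>\<^sub>S\<^sub>t\<^sub>r"
    and Bil: "stochastic_gradients_Bil H R D\<^sub>\<zeta> hx hy \<sigma>\<^sub>B\<^sub>i\<^sub>l"
    and r: "0 < r" "r < 1" and beta: "0 < \<beta>"
    and sigma: "\<sigma> = noise_level r \<beta> \<sigma>\<^sub>S\<^sub>t\<^sub>r \<sigma>\<^sub>B\<^sub>i\<^sub>l"
    and sampling: "independent_sampling M D\<^sub>\<xi> D\<^sub>\<zeta> T x0 y0 \<xi> \<zeta>h \<zeta>"
    and eta: "\<eta> = (\<lambda>s. stepsize r \<beta> L\<^sub>S\<^sub>t\<^sub>r L\<^sub>B\<^sub>i\<^sub>l \<sigma> (epoch_estimate \<Gamma>\<^sub>0 s) (T s))"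
    and out: "out = (\<lambda>S \<omega>. restarted_ag_eg gf gg hx hy R \<eta> T (x0 \<omega>) (y0 \<omega>)
                              (\<lambda>s t. \<xi> s t \<omega>) (\<lambda>s t. \<zeta>h s t \<omega>) (\<lambda>s t. \<zeta> s t \<omega>) S)"
    and err: "err = (\<lambda>S. \<integral>\<^sup>+\<omega>. ennreal (sq_dist R wx wy (out S \<omega>)) \<partial>M)"
    and Gamma0: "\<Gamma>\<^sub>0 > 0" "(\<integral>\<^sup>+\<omega>. ennreal (sq_dist R wx wy (x0 \<omega>, y0 \<omega>)) \<partial>M) \<le> ennreal (\<Gamma>\<^sub>0\<^sup>2)"
    and epochs: "\<forall>s\<ge>1. epoch_const r \<beta> * epoch_scale L\<^sub>S\<^sub>t\<^sub>r L\<^sub>B\<^sub>i\<^sub>l \<mu>\<^sub>S\<^sub>t\<^sub>r \<sigma> \<Gamma>\<^sub>0 s \<le> real (T s) \<and>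
                   real (T s) \<le> C * epoch_scale L\<^sub>S\<^sub>t\<^sub>r L\<^sub>B\<^sub>i\<^sub>l \<mu>\<^sub>S\<^sub>t\<^sub>r \<sigma> \<Gamma>\<^sub>0 s"
  shows
    "(\<forall>\<epsilon>. 0 < \<epsilon> \<and> \<epsilon> \<le> min (exp (- 1)) (1 / \<Gamma>\<^sub>0) \<longrightarrow>
        ereal_of_enat (iteration_complexity T err \<epsilon>)
          \<le> ereal (6 * C * ((sqrt (L\<^sub>S\<^sub>t\<^sub>r / \<mu>\<^sub>S\<^sub>t\<^sub>r) + L\<^sub>B\<^sub>i\<^sub>l / \<mu>\<^sub>S\<^sub>t\<^sub>r) * ln (1 / \<epsilon>)
                            + \<sigma>\<^sup>2 / (\<mu>\<^sub>S\<^sub>t\<^sub>r\<^sup>2 * \<epsilon>\<^sup>2)))) \<and>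
     (\<forall>\<epsilon>>0. ereal_of_enat (iteration_complexity T err \<epsilon>)
          \<le> ereal (3 * C * ((sqrt (L\<^sub>S\<^sub>t\<^sub>r / \<mu>\<^sub>S\<^sub>t\<^sub>r) + L\<^sub>B\<^sub>i\<^sub>l / \<mu>\<^sub>S\<^sub>t\<^sub>r) * max 1 (ln (\<Gamma>\<^sub>0 / \<epsilon>))
                            + \<sigma>\<^sup>2 / (\<mu>\<^sub>S\<^sub>t\<^sub>r\<^sup>2 * \<epsilon>\<^sup>2)))) \<and>
     (\<forall>\<epsilon> l. (sqrt (L\<^sub>S\<^sub>t\<^sub>r / \<mu>\<^sub>S\<^sub>t\<^sub>r) + L\<^sub>B\<^sub>i\<^sub>l / \<mu>\<^sub>S\<^sub>t\<^sub>r) * l + \<sigma>\<^sup>2 / (\<mu>\<^sub>S\<^sub>t\<^sub>r\<^sup>2 * \<epsilon>\<^sup>2)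
          = (sqrt (max (L\<^sub>F / \<mu>\<^sub>F) (L\<^sub>G / \<mu>\<^sub>G)) + sqrt (lambda_max (transpose B ** B) / (\<mu>\<^sub>F * \<mu>\<^sub>G))) * l
            + \<sigma>\<^sup>2 / (\<mu>\<^sub>F\<^sup>2 * \<epsilon>\<^sup>2))"
proof -
  let ?a = "sqrt (L\<^sub>S\<^sub>t\<^sub>r / \<mu>\<^sub>S\<^sub>t\<^sub>r) + L\<^sub>B\<^sub>i\<^sub>l / \<mu>\<^sub>S\<^sub>t\<^sub>r"
  let ?b = "\<sigma>\<^sup>2 / (\<mu>\<^sub>S\<^sub>t\<^sub>r\<^sup>2 * \<Gamma>\<^sub>0\<^sup>2)"
  define \<rho> where "\<rho> = sqrt R"
  have R0: "0 < R" using mu_pos R by simp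
  then have \<rho>: "\<rho> \<noteq> 0" "R = \<rho>\<^sup>2" and \<rho>_eq: "\<rho> = sqrt (\<mu>\<^sub>G / \<mu>\<^sub>F)" using mu_pos by (simp_all add: \<rho>_def R)
  define E where "E = (\<lambda>d. case d of
        Init \<Rightarrow> generated M (\<lambda>\<omega>. (x0 \<omega>, y0 \<omega>)) borel
      | Xi s t \<Rightarrow> generated M (\<xi> s t) D\<^sub>\<xi>
      | Zeta_half s t \<Rightarrow> generated M (\<zeta>h s t) D\<^sub>\<zeta>
      | Zeta s t \<Rightarrow> generated M (\<zeta> s t) D\<^sub>\<zeta>)"
  define gs where "gs z a = scaled_grad \<rho> (\<lambda>x. gf x a) (\<lambda>y. gg y a) z" for z a
  define as where "as z b = scaled_coupling \<rho> (\<lambda>x y. hx x y b) (\<lambda>x y. hy x y b) z" for z b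
  define w where "w = (wx, \<rho> *\<^sub>R wy)"
  define W0 where "W0 = (\<lambda>\<omega>. (x0 \<omega>, \<rho> *\<^sub>R y0 \<omega>))"
  note samp = sampling[unfolded independent_sampling_def E_def[symmetric]]
  have PM: "prob_space M" and xy [measurable]: "x0 \<in> borel_measurable M" "y0 \<in> borel_measurable M"
    and ind: "prob_space.indep_sets M E (draws T)"
    using samp by blast+
  have W0: "W0 \<in> measurable (joint_algebra M E {Init}) borel"
  proof -
    have "(\<lambda>\<omega>. (x0 \<omega>, y0 \<omega>)) \<in> measurable (joint_algebra M E {Init}) borel"
      by (rule measurable_joint_algebra_generated[of Init])
        (auto simp: E_def generated_def borel_prod[symmetric])
    then have [measurable]: "(\<lambda>\<omega>. (x0 \<omega>, y0 \<omega>)) \<in> measurable (joint_algebra M E {Init}) (borel \<Otimes>\<^sub>M borel)"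
      by (simp add: borel_prod)
    have "(\<lambda>\<omega>. (fst (x0 \<omega>, y0 \<omega>), \<rho> *\<^sub>R snd (x0 \<omega>, y0 \<omega>))) \<in> measurable (joint_algebra M E {Init}) (borel \<Otimes>\<^sub>M borel)"
      by measurable
    then show ?thesis by (simp add: W0_def borel_prod)
  qed
  note Hgrad = grad_coupling_x[of B ux uy] grad_coupling_y[of B ux uy]
  note str = scaled_grad_oracle[OF Str \<rho>, folded gs_def]
  note bil = scaled_coupling_oracle[OF Bil[unfolded H] \<rho> Hgrad, folded as_def]
  interpret bilinear_saddle "\<lambda>z. F (fst z) + G ((1 / \<rho>) *\<^sub>R snd z)" "scaled_grad \<rho> (grad F) (grad G)"
    "scaled_coupling \<rho> (\<lambda>x y. B *v y - ux) (\<lambda>x y. transpose B *v x + uy)" w \<mu>\<^sub>F L\<^sub>S\<^sub>t\<^sub>r L\<^sub>B\<^sub>i\<^sub>l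
    unfolding w_def L_Str L_Bil
    by (rule bilinear_saddle_scaled[OF mu_pos F G saddle[unfolded H] \<rho>_eq])
  interpret sampled_saddle "\<lambda>z. F (fst z) + G ((1 / \<rho>) *\<^sub>R snd z)" "scaled_grad \<rho> (grad F) (grad G)"
    "scaled_coupling \<rho> (\<lambda>x y. B *v y - ux) (\<lambda>x y. transpose B *v x + uy)" w \<mu>\<^sub>F L\<^sub>S\<^sub>t\<^sub>r L\<^sub>B\<^sub>i\<^sub>l
    D\<^sub>\<xi> D\<^sub>\<zeta> gs as "\<sigma>\<^sub>S\<^sub>t\<^sub>r\<^sup>2" "\<sigma>\<^sub>B\<^sub>i\<^sub>l\<^sup>2" M E T W0 \<xi> \<zeta>h \<zeta>
  proof (intro sampled_saddle.intro stochastic_saddle.intro stochastic_saddle_axioms.intro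
      sampled_saddle_axioms.intro)
    show "bilinear_saddle (\<lambda>z. F (fst z) + G ((1 / \<rho>) *\<^sub>R snd z)) (scaled_grad \<rho> (grad F) (grad G))
      (scaled_coupling \<rho> (\<lambda>x y. B *v y - ux) (\<lambda>x y. transpose B *v x + uy)) w \<mu>\<^sub>F L\<^sub>S\<^sub>t\<^sub>r L\<^sub>B\<^sub>i\<^sub>l"
      by (rule bilinear_saddle_axioms)
    show "prob_space D\<^sub>\<xi>" using Str by (simp only: stochastic_gradients_Str_def)
    show "prob_space D\<^sub>\<zeta>" using Bil by (simp only: stochastic_gradients_Bil_def)
    show "prob_space M" by (rule PM)
    show "prob_space.indep_sets M E (draws T)" by (rule ind)
    show "W0 \<in> measurable (joint_algebra M E {Init}) borel" by (rule W0)
    show "Int_stable (E d)" for d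
      by (auto simp: E_def Int_stable_generated split: draw.split)
    show "0 \<le> \<sigma>\<^sub>S\<^sub>t\<^sub>r\<^sup>2" "0 \<le> \<sigma>\<^sub>B\<^sub>i\<^sub>l\<^sup>2" by simp_all
  qed (fact str bil | use samp in \<open>auto simp: E_def\<close>)+
  have \<sigma>0: "0 \<le> \<sigma>" and \<sigma>3: "3 * \<sigma>\<^sup>2 = \<sigma>\<^sub>S\<^sub>t\<^sub>r\<^sup>2 / (1 - r) + (2 + 1 / \<beta>) * \<sigma>\<^sub>B\<^sub>i\<^sub>l\<^sup>2"
  proof -
    have "0 \<le> 1 / (1 - r) * \<sigma>\<^sub>S\<^sub>t\<^sub>r\<^sup>2 + (2 + 1 / \<beta>) * \<sigma>\<^sub>B\<^sub>i\<^sub>l\<^sup>2" using r beta by simp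
    then show "0 \<le> \<sigma>" "3 * \<sigma>\<^sup>2 = \<sigma>\<^sub>S\<^sub>t\<^sub>r\<^sup>2 / (1 - r) + (2 + 1 / \<beta>) * \<sigma>\<^sub>B\<^sub>i\<^sub>l\<^sup>2"
      unfolding sigma noise_level_def by (simp_all add: power_mult_distrib power_divide)
  qed
  have dist: "sq_dist R wx wy z = (norm ((fst z, \<rho> *\<^sub>R snd z) - w))\<^sup>2" for z
    unfolding w_def diff_Pair norm_sq_prod[of "(_, _)"] fst_conv snd_conv scaleR_diff_right[symmetric] sq_dist_def
    by (simp add: power_mult_distrib \<rho>(2))
  have "restart_point \<eta> S \<omega> = (fst (out S \<omega>), \<rho> *\<^sub>R snd (out S \<omega>))" for S \<omega>
    unfolding restart_point_def unfolding gs_def[abs_def] as_def[abs_def] W0_def out restarted_ag_eg_scaled[OF \<rho>] by (simp add: split_beta)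
  then have err_eq: "err S = (\<integral>\<^sup>+\<omega>. ennreal ((norm (restart_point \<eta> S \<omega> - w))\<^sup>2) \<partial>M)" for S
    unfolding err dist by simp
  have err_le: "err S \<le> ennreal (\<Gamma>\<^sub>0\<^sup>2 * exp (- real S))" for S
    unfolding err_eq
  proof (rule restart_point_distance[OF r beta \<sigma>3 \<sigma>0 eta Gamma0(1)])
    show "(\<integral>\<^sup>+\<omega>. ennreal ((norm (W0 \<omega> - w))\<^sup>2) \<partial>M) \<le> ennreal (\<Gamma>\<^sub>0\<^sup>2)"
      using Gamma0(2) unfolding dist by (simp add: W0_def)
    show "epoch_const r \<beta> * epoch_scale L\<^sub>S\<^sub>t\<^sub>r L\<^sub>B\<^sub>i\<^sub>l \<mu>\<^sub>F \<sigma> \<Gamma>\<^sub>0 s \<le> real (T s)" if "1 \<le> s" for s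
      using epochs that by (simp add: mu_Str)
  qed
  have a0: "0 < ?a" using L_pos K_nonneg mu_pos by (auto simp: mu_Str intro!: add_pos_nonneg)
  have b0: "0 \<le> ?b" by simp
  have scale: "epoch_scale L\<^sub>S\<^sub>t\<^sub>r L\<^sub>B\<^sub>i\<^sub>l \<mu>\<^sub>S\<^sub>t\<^sub>r \<sigma> \<Gamma>\<^sub>0 s = ?a + ?b * exp (real s - 1)" for s
  proof -
    have "exp (1 - real s) * exp (real s - 1) = 1" by (simp add: mult_exp_exp)
    then have "1 / exp (1 - real s) = exp (real s - 1)" by (simp add: field_simps)
    then show ?thesis
      unfolding epoch_scale_def by (metis (no_types) divide_divide_eq_left mult.right_neutral times_divide_eq_right)
  qed
  \<comment> \<open>The sign of C follows from epoch 1: its length is nonnegative and the scale that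
    multiplies C is positive.\<close>
  have C0: "0 \<le> C"
  proof (rule ccontr)
    assume "\<not> 0 \<le> C"
    moreover have "0 < ?a + ?b * exp (real 1 - 1)" using b0 by (intro add_pos_nonneg[OF a0]) auto
    ultimately have "C * (?a + ?b * exp (real 1 - 1)) < 0" by (intro mult_neg_pos) auto
    moreover have "real (T 1) \<le> C * (?a + ?b * exp (real 1 - 1))"
      using epochs unfolding scale by blast
    ultimately show False by linarith
  qed
  have bound: "ereal_of_enat (iteration_complexity T err \<epsilon>)
      \<le> ereal (3 * C * (?a * max 1 (ln (\<Gamma>\<^sub>0 / \<epsilon>)) + \<sigma>\<^sup>2 / (\<mu>\<^sub>S\<^sub>t\<^sub>r\<^sup>2 * \<epsilon>\<^sup>2)))" if "0 < \<epsilon>" for \<epsilon>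
  proof -
    have "?b * \<Gamma>\<^sub>0\<^sup>2 / \<epsilon>\<^sup>2 = \<sigma>\<^sup>2 / (\<mu>\<^sub>S\<^sub>t\<^sub>r\<^sup>2 * \<epsilon>\<^sup>2)" using Gamma0(1) by simp
    moreover have "ereal_of_enat (iteration_complexity T err \<epsilon>)
      \<le> ereal (3 * C * (?a * max 1 (ln (\<Gamma>\<^sub>0 / \<epsilon>)) + ?b * \<Gamma>\<^sub>0\<^sup>2 / \<epsilon>\<^sup>2))"
    proof (rule iteration_complexity_bound[OF C0 less_imp_le[OF a0] b0 Gamma0(1) that _ err_le])
      show "real (T s) \<le> C * (?a + ?b * exp (real s - 1))" if "1 \<le> s" for s
        using epochs that unfolding scale by blast
    qed
    ultimately show ?thesis by (simp only:)
  qed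
  have bound': "ereal_of_enat (iteration_complexity T err \<epsilon>)
      \<le> ereal (6 * C * (?a * ln (1 / \<epsilon>) + \<sigma>\<^sup>2 / (\<mu>\<^sub>S\<^sub>t\<^sub>r\<^sup>2 * \<epsilon>\<^sup>2)))"
    if \<epsilon>: "0 < \<epsilon>" "\<epsilon> \<le> min (exp (- 1)) (1 / \<Gamma>\<^sub>0)" for \<epsilon>
  proof -
    \<comment> \<open>The threshold exp (- 1) makes ln (1 / \<epsilon>) at least 1, which absorbs
      the maximum; the threshold \<open>1 / \<Gamma>\<^sub>0\<close> makes
      \<open>ln \<Gamma>\<^sub>0\<close> at most ln (1 / \<epsilon>). Together they cost the factor
      2 between the constants 3 and 6.\<close>
    have "ln \<epsilon> \<le> ln (exp (- 1))" using \<epsilon> by (subst ln_le_cancel_iff) auto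
    then have 1: "1 \<le> ln (1 / \<epsilon>)" using \<epsilon> by (simp add: ln_div)
    have "\<Gamma>\<^sub>0 \<le> 1 / \<epsilon>" using \<epsilon> Gamma0(1) by (simp add: field_simps)
    then have "ln \<Gamma>\<^sub>0 \<le> ln (1 / \<epsilon>)" using \<epsilon> Gamma0(1) by (subst ln_le_cancel_iff) auto
    then have "ln (\<Gamma>\<^sub>0 / \<epsilon>) \<le> 2 * ln (1 / \<epsilon>)" using \<epsilon> Gamma0(1) by (simp add: ln_div)
    with 1 have le: "?a * max 1 (ln (\<Gamma>\<^sub>0 / \<epsilon>)) \<le> ?a * (2 * ln (1 / \<epsilon>))"
      using a0 by (intro mult_left_mono) auto
    have "a * m + n \<le> 2 * (a * l + n)" if "a * m \<le> a * (2 * l)" "0 \<le> n" for a m l n :: real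
      using that by simp
    from this[OF le, of "\<sigma>\<^sup>2 / (\<mu>\<^sub>S\<^sub>t\<^sub>r\<^sup>2 * \<epsilon>\<^sup>2)"] have "?a * max 1 (ln (\<Gamma>\<^sub>0 / \<epsilon>)) + \<sigma>\<^sup>2 / (\<mu>\<^sub>S\<^sub>t\<^sub>r\<^sup>2 * \<epsilon>\<^sup>2)
        \<le> 2 * (?a * ln (1 / \<epsilon>) + \<sigma>\<^sup>2 / (\<mu>\<^sub>S\<^sub>t\<^sub>r\<^sup>2 * \<epsilon>\<^sup>2))"
      by simp
    then have "3 * C * (?a * max 1 (ln (\<Gamma>\<^sub>0 / \<epsilon>)) + \<sigma>\<^sup>2 / (\<mu>\<^sub>S\<^sub>t\<^sub>r\<^sup>2 * \<epsilon>\<^sup>2))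
        \<le> 3 * C * (2 * (?a * ln (1 / \<epsilon>) + \<sigma>\<^sup>2 / (\<mu>\<^sub>S\<^sub>t\<^sub>r\<^sup>2 * \<epsilon>\<^sup>2)))"
      using C0 by (intro mult_left_mono) auto
    also have "\<dots> = 6 * C * (?a * ln (1 / \<epsilon>) + \<sigma>\<^sup>2 / (\<mu>\<^sub>S\<^sub>t\<^sub>r\<^sup>2 * \<epsilon>\<^sup>2))" by simp
    finally show ?thesis using bound[OF \<epsilon>(1)] by (meson ereal_less_eq(3) order_trans)
  qed
  have cond: "?a = sqrt (max (L\<^sub>F / \<mu>\<^sub>F) (L\<^sub>G / \<mu>\<^sub>G)) + sqrt (lambda_max (transpose B ** B) / (\<mu>\<^sub>F * \<mu>\<^sub>G))"
  proof -
    have "L\<^sub>S\<^sub>t\<^sub>r / \<mu>\<^sub>F = max (L\<^sub>F / \<mu>\<^sub>F) (L\<^sub>G / \<mu>\<^sub>G)"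
      using mu_pos by (simp add: L_Str max_divide_distrib_right)
    moreover have "L\<^sub>B\<^sub>i\<^sub>l / \<mu>\<^sub>F = sqrt (lambda_max (transpose B ** B) * (\<mu>\<^sub>F / \<mu>\<^sub>G) / \<mu>\<^sub>F\<^sup>2)"
      using mu_pos by (simp add: L_Bil real_sqrt_divide real_sqrt_mult)
    moreover have "lambda_max (transpose B ** B) * (\<mu>\<^sub>F / \<mu>\<^sub>G) / \<mu>\<^sub>F\<^sup>2 = lambda_max (transpose B ** B) / (\<mu>\<^sub>F * \<mu>\<^sub>G)"
      using mu_pos by (simp add: power2_eq_square)
    ultimately show ?thesis by (simp add: mu_Str)
  qed
  show ?thesis
  proof (intro conjI allI impI)
    fix \<epsilon> :: real
    assume "0 < \<epsilon> \<and> \<epsilon> \<le> min (exp (- 1)) (1 / \<Gamma>\<^sub>0)"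
    then show "ereal_of_enat (iteration_complexity T err \<epsilon>)
        \<le> ereal (6 * C * (?a * ln (1 / \<epsilon>) + \<sigma>\<^sup>2 / (\<mu>\<^sub>S\<^sub>t\<^sub>r\<^sup>2 * \<epsilon>\<^sup>2)))"
      by (elim conjE) (rule bound')
  next
    fix \<epsilon> :: real
    assume "0 < \<epsilon>"
    then show "ereal_of_enat (iteration_complexity T err \<epsilon>)
        \<le> ereal (3 * C * (?a * max 1 (ln (\<Gamma>\<^sub>0 / \<epsilon>)) + \<sigma>\<^sup>2 / (\<mu>\<^sub>S\<^sub>t\<^sub>r\<^sup>2 * \<epsilon>\<^sup>2)))"
      by (rule bound)
  next
    fix \<epsilon> l :: real
    show "?a * l + \<sigma>\<^sup>2 / (\<mu>\<^sub>S\<^sub>t\<^sub>r\<^sup>2 * \<epsilon>\<^sup>2)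
        = (sqrt (max (L\<^sub>F / \<mu>\<^sub>F) (L\<^sub>G / \<mu>\<^sub>G)) + sqrt (lambda_max (transpose B ** B) / (\<mu>\<^sub>F * \<mu>\<^sub>G))) * l
          + \<sigma>\<^sup>2 / (\<mu>\<^sub>F\<^sup>2 * \<epsilon>\<^sup>2)"
      unfolding cond unfolding mu_Str ..
  qed
qed

end
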